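(* For every integer $n\ge1$, every $0<s<\min\{1,\frac n2\}$, and every $-2s<\alpha_0<0$, there exists $\varepsilon=\varepsilon(n,s,\alpha_0)>0$ such that the following holds. If $\alpha\in(\alpha_0,0)$ and $p\in(2,2+\varepsilon)$ with $p<2^*_s:=\frac{2n}{n-2s}$, and $\beta:=\alpha+s-n\left(\frac12-\frac1p\right)$, then every minimizer of the fractional Caffarelli--Kohn--Nirenberg inequality $$\|u\|_{D^s_\alpha(\mathbb R^n)}^2\ge\Lambda_{n,s,p,\alpha,\beta}\,\big\|u|\cdot|^{-\beta}\big\|_{L^p(\mathbb R^n)}^2,\qquad u\in D^s_\alpha(\mathbb R^n),$$ is a radial function.
   Context: $D^s_\alpha(\mathbb R^n)$ is the closure of $C^\infty_c(\mathbb R^n)$ (real-valued functions) with respect to the norm $$\|u\|_{D^s_\alpha(\mathbb R^n)}^2:=\int_{\mathbb R^n}\int_{\mathbb R^n}\frac{(u(x)-u(y))^2}{|x|^\alpha|x-y|^{n+2s}|y|^\alpha}\,dx\,dy .$$ $\Lambda_{n,s,p,\alpha,\beta}>0$ is the optimal constant in the displayed inequality; a minimizer is a non-zero function attaining equality. A function is radial if it depends only on $|x|$ (up to a.e. equality). *)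

theory Defs
  imports "HOL-Analysis.Analysis"
begin

text \<open>Smooth functions on the whole space: all iterated directional derivatives exist and
  are continuous.\<close>

fun C_k :: "nat \<Rightarrow> (real^'n \<Rightarrow> real) \<Rightarrow> bool" where
  "C_k 0 f \<longleftrightarrow> continuous_on UNIV f"
| "C_k (Suc k) f \<longleftrightarrow>
     (\<forall>x. f differentiable (at x)) \<and> (\<forall>v. C_k k (\<lambda>x. frechet_derivative f (at x) v))"

definition test_functions :: "(real^'n \<Rightarrow> real) set" where
  "test_functions = {f. (\<forall>k. C_k k f) \<and> compact (closure {x. f x \<noteq> 0})}"

text \<open>The squared norm of \<open>D\<^sup>s\<^sub>\<alpha>\<close>. The conventions \<open>0 powr a = 0\<close> and \<open>c / 0 = 0\<close> only affect
  the null set where \<open>x = 0\<close>, \<open>y = 0\<close> or \<open>x = y\<close>.\<close>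

definition D_norm_sq :: "real \<Rightarrow> real \<Rightarrow> (real^'n \<Rightarrow> real) \<Rightarrow> ennreal" where
  "D_norm_sq s \<alpha> u =
     (\<integral>\<^sup>+x. (\<integral>\<^sup>+y. ennreal ((u x - u y)\<^sup>2 /
        (norm x powr \<alpha> * norm (x - y) powr (real CARD('n) + 2 * s) * norm y powr \<alpha>))
      \<partial>lebesgue) \<partial>lebesgue)"

text \<open>The closure of the test functions, realised as a space of measurable functions.
  The double integral vanishes on constants, so convergence in it alone determines the limit
  only up to an additive constant; the requirement of convergence almost everywhere (which,
  after passing to a subsequence, every Cauchy sequence satisfies by the
  Caffarelli--Kohn--Nirenberg inequality) selects the right representative of the
  abstract completion.\<close>

definition D_space :: "real \<Rightarrow> real \<Rightarrow> (real^'n \<Rightarrow> real) set" where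
  "D_space s \<alpha> = {u \<in> borel_measurable lebesgue.
     \<exists>\<phi>::nat \<Rightarrow> real^'n \<Rightarrow> real. (\<forall>k. \<phi> k \<in> test_functions) \<and>
       ((\<lambda>k. D_norm_sq s \<alpha> (\<lambda>x. u x - \<phi> k x)) \<longlonglongrightarrow> 0) \<and>
       (AE x in lebesgue. (\<lambda>k. \<phi> k x) \<longlonglongrightarrow> u x)}"

definition Lp_norm :: "real \<Rightarrow> (real^'n \<Rightarrow> real) \<Rightarrow> ennreal" where
  "Lp_norm p f =
     (let I = (\<integral>\<^sup>+x. ennreal (\<bar>f x\<bar> powr p) \<partial>lebesgue)
      in if I = \<infinity> then \<infinity> else ennreal (enn2real I powr (1 / p)))"

definition CKN_rhs :: "real \<Rightarrow> real \<Rightarrow> (real^'n \<Rightarrow> real) \<Rightarrow> ennreal" where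
  "CKN_rhs p \<beta> u = (Lp_norm p (\<lambda>x. u x * norm x powr (- \<beta>)))\<^sup>2"

text \<open>The optimal constant is the largest one for which the inequality holds. It depends on the
  dimension, so the index type is passed explicitly.\<close>

definition CKN_const :: "'n::finite itself \<Rightarrow> real \<Rightarrow> real \<Rightarrow> real \<Rightarrow> real \<Rightarrow> ennreal" where
  "CKN_const _ s p \<alpha> \<beta> =
     Sup {C. \<forall>u \<in> (D_space s \<alpha> :: (real^'n \<Rightarrow> real) set). D_norm_sq s \<alpha> u \<ge> C * CKN_rhs p \<beta> u}"

definition CKN_minimizer :: "real \<Rightarrow> real \<Rightarrow> real \<Rightarrow> real \<Rightarrow> (real^'n \<Rightarrow> real) \<Rightarrow> bool" where
  "CKN_minimizer s p \<alpha> \<beta> u \<longleftrightarrow>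
     u \<in> D_space s \<alpha> \<and> \<not> (AE x in lebesgue. u x = 0) \<and>
     D_norm_sq s \<alpha> u = CKN_const TYPE('n) s p \<alpha> \<beta> * CKN_rhs p \<beta> u"

definition radial :: "(real^'n \<Rightarrow> real) \<Rightarrow> bool" where
  "radial u \<longleftrightarrow> (\<exists>f::real \<Rightarrow> real. AE x in lebesgue. u x = f (norm x))"

end

theory Submission
  imports Defs
begin

text \<open>
  With \<open>h = |x|\<^sup>\<gamma> u\<close>, \<open>\<gamma> = (n - 2s)/2 - \<alpha>\<close>, and the dilation-invariant measure
  \<open>d\<mu> = |x|\<^sup>-\<^sup>n dx\<close>, the right-hand side of the inequality becomes \<open>\<parallel>h\<parallel>\<^sub>p\<^sup>2\<close> in \<open>L\<^sup>p(\<mu>)\<close> and the energy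
  becomes \<open>\<lambda>\<^sub>\<alpha> \<parallel>h\<parallel>\<^sub>2\<^sup>2 + E(h)\<close>, where the Gagliardo form \<open>E\<close> does not depend on \<open>\<alpha>\<close> and \<open>\<lambda>\<^sub>\<alpha>\<close> is
  the sharp Hardy constant. Let \<open>h\<close> belong to a minimizer, \<open>R\<close> be a reflection and
  \<open>d = (h - h \<circ> R)/2\<close>. The parallelogram law for the energy and the 2-uniform smoothness of
  \<open>L\<^sup>p\<close> show that the Rayleigh quotient of the odd function \<open>d\<close> is at most \<open>(p - 1) \<Lambda>\<close>.

  On odd functions the form \<open>E\<close> is bounded below by a multiple of \<open>\<parallel>d\<parallel>\<^sub>2\<^sup>2\<close>, uniformly in
  \<open>\<alpha>\<close>; a Nash-type inequality shows that \<open>\<parallel>d\<parallel>\<^sub>p\<^sup>2\<close> exceeds \<open>\<parallel>d\<parallel>\<^sub>2\<^sup>2\<close> only by a small multiple of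
  \<open>\<parallel>d\<parallel>\<^sub>2\<^sup>2 + E(d)\<close> for \<open>p\<close> close to 2; and slowly varying cutoffs of \<open>|x|\<^sup>-\<^sup>\<gamma>\<close> show that \<open>\<Lambda>\<close> is
  almost at most \<open>\<lambda>\<^sub>\<alpha>\<close>. Hence \<open>d = 0\<close> for every reflection. The constant \<open>\<lambda>\<^sub>\<alpha>\<close> is never
  computed: it is eliminated between \<open>d\<close> and the cutoff.
\<close>

subsection \<open>Reflections and the scale-invariant measure\<close>

text \<open>The obstacle is that the Hardy constant is formally
  \<open>2 * (weight g K - weight 0 K)\<close> with \<open>K = kap s\<close>, a difference of two
  infinite numbers because of the singularity on the diagonal. The expansion is therefore carried
  out for truncated kernels, and the constant is cancelled between two functions before the limit;
  what survives has nonnegative terms only and makes sense in \<open>ennreal\<close>.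

  Why \<open>p\<close> near 2 helps: let lambda be the Hardy constant and normalise d in L^2. The
  energy of d is lambda + E(d) with E(d) >= c, while the cutoff has quotient at most lambda + c/2.
  At p = 2 the bound on d would read lambda + E(d) <= lambda + c/2, which is false with margin c/2,
  and this margin survives for p slightly above 2. For uniformity in alpha, note that alpha enters
  only through \<open>g\<close>, that 0 < g <= k with k its value at alpha_0, and that the energy of
  the cutoff is convex in \<open>g\<close>.

  Elements of the energy space carry no integrability by definition, and test functions need not
  vanish at the origin; membership in L^2(mu) and L^p(mu) comes from a non-sharp Hardy inequality
  and Fatou's lemma.\<close>

definition reflection :: "'a::euclidean_space \<Rightarrow> 'a \<Rightarrow> 'a" where
  "reflection a x = x - (2 * (a \<bullet> x) / (a \<bullet> a)) *\<^sub>R a"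

lemma linear_reflection: "linear (reflection a)"
  by (rule linearI) (auto simp: reflection_def inner_add_right algebra_simps add_divide_distrib)

lemma reflection_reflection [simp]: "reflection a (reflection a x) = x"
  by (cases "a = 0") (auto simp: reflection_def inner_diff_right)

lemma inner_reflection [simp]: "reflection a x \<bullet> reflection a y = x \<bullet> y"
  by (cases "a = 0") (auto simp: reflection_def inner_diff_right inner_diff_left inner_commute)

lemma norm_reflection [simp]: "norm (reflection a x) = norm x"
  by (simp add: norm_eq)

lemma reflection_diff: "reflection a x - reflection a y = reflection a (x - y)"
  by (simp add: linear_diff linear_reflection)

lemma continuous_on_reflection [continuous_intros]: "continuous_on A (reflection a)"
  using linear_reflection linear_continuous_on linear_linear by blast

lemma measurable_reflection [measurable]: "reflection a \<in> borel_measurable borel"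
  by (intro borel_measurable_continuous_onI continuous_on_reflection)

text \<open>The vector \<open>x - y\<close> is orthogonal to \<open>x + y\<close> when the norms
  agree, so its mirror exchanges the two points. For \<open>x = y\<close> the mirror is
  \<open>reflection 0\<close>, which is the identity.\<close>

lemma reflection_maps_to:
  assumes "norm x = norm y"
  shows "reflection (x - y) x = y"
proof (cases "x = y")
  case False
  have "x \<bullet> x = y \<bullet> y" using assms by (simp add: norm_eq)
  then have *: "2 * ((x - y) \<bullet> x) = (x - y) \<bullet> (x - y)"
    by (simp add: inner_diff_left inner_diff_right inner_commute)
  have "(x - y) \<bullet> (x - y) \<noteq> 0" using False by simp
  then show ?thesis
    unfolding reflection_def * by simp
qed (simp add: reflection_def)

lemma nn_integral_lborel_shift:
  fixes f :: "'a::euclidean_space \<Rightarrow> ennreal"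
  assumes [measurable]: "f \<in> borel_measurable borel"
  shows "(\<integral>\<^sup>+x. f (x + t) \<partial>lborel) = (\<integral>\<^sup>+x. f x \<partial>lborel)"
proof -
  have "(\<integral>\<^sup>+x. f x \<partial>lborel) = (\<integral>\<^sup>+x. f x \<partial>distr lborel borel (\<lambda>x. x + t))"
    using lborel_distr_plus[of t] by (simp add: add.commute[of _ t])
  also have "\<dots> = (\<integral>\<^sup>+x. f (x + t) \<partial>lborel)"
    by (subst nn_integral_distr) auto
  finally show ?thesis ..
qed

lemma nn_integral_lborel_scale:
  fixes f :: "'a::euclidean_space \<Rightarrow> ennreal"
  assumes [measurable]: "f \<in> borel_measurable borel" and c: "c \<noteq> 0"
  shows "(\<integral>\<^sup>+x. f x \<partial>lborel) = ennreal (\<bar>c\<bar> ^ DIM('a)) * (\<integral>\<^sup>+x. f (c *\<^sub>R x) \<partial>lborel)"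
  by (subst lborel_affine[OF c, of 0])
     (simp add: nn_integral_density nn_integral_distr nn_integral_cmult)

text \<open>By translation invariance, Fubini gives
  \<open>|R\<^sup>-\<^sup>1 A| |B| = |R\<^sup>-\<^sup>1 B| |A|\<close>; the choice of a ball for \<open>B\<close> shows that \<open>R\<close> preserves volume.\<close>

lemma distr_reflection:
  fixes a :: "'a::euclidean_space"
  shows "distr lborel borel (reflection a) = lborel"
proof (rule measure_eqI)
  fix A assume "A \<in> sets (distr lborel borel (reflection a))"
  then have A [measurable]: "A \<in> sets borel" by simp
  let ?R = "reflection a"
  have vimage: "(\<integral>\<^sup>+x. indicator B (?R x) \<partial>lborel) = emeasure lborel (?R -` B)"
    if [measurable]: "B \<in> sets borel" for B
  proof -
    have "(\<integral>\<^sup>+x. indicator B (?R x) \<partial>lborel) = (\<integral>\<^sup>+x. indicator (?R -` B) x \<partial>lborel)"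
      by (intro nn_integral_cong) (auto simp: indicator_def)
    moreover have "?R -` B \<in> sets lborel"
      using measurable_sets[OF measurable_reflection that] by simp
    ultimately show ?thesis by simp
  qed
  define B where "B = ball (0::'a) 1"
  have B [measurable]: "B \<in> sets borel" by (simp add: B_def)
  let ?I = "\<integral>\<^sup>+x. (\<integral>\<^sup>+y. indicator A (?R x) * indicator B (?R x + y) \<partial>lborel) \<partial>lborel :: ennreal"
  have "?I = (\<integral>\<^sup>+x. indicator A (?R x) * emeasure lborel B \<partial>lborel)"
  proof (intro nn_integral_cong)
    fix x
    have "(\<integral>\<^sup>+y. indicator B (y + ?R x) \<partial>lborel) = emeasure lborel B"
      by (subst nn_integral_lborel_shift) auto
    then show "(\<integral>\<^sup>+y. indicator A (?R x) * indicator B (?R x + y) \<partial>lborel) =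
        indicator A (?R x) * emeasure lborel B"
      by (subst nn_integral_cmult) (auto simp: add.commute)
  qed
  also have "\<dots> = emeasure lborel (?R -` A) * emeasure lborel B"
    by (subst nn_integral_multc) (auto simp: vimage)
  finally have 1: "?I = emeasure lborel (?R -` A) * emeasure lborel B" .
  have "?I = (\<integral>\<^sup>+y. (\<integral>\<^sup>+x. indicator A (?R x) * indicator B (?R x + y) \<partial>lborel) \<partial>lborel)"
    by (rule lborel_pair.Fubini') measurable
  also have "\<dots> = (\<integral>\<^sup>+y. (\<integral>\<^sup>+x. indicator A (?R x - y) * indicator B (?R x) \<partial>lborel) \<partial>lborel)"
  proof (rule nn_integral_cong)
    fix y
    \<comment> \<open>The shift by \<open>?R y\<close> turns into a shift by \<open>y\<close> under
      the reflection; it moves the translation from \<open>B\<close> to \<open>A\<close>.\<close>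
    have "(\<integral>\<^sup>+x. indicator A (?R x - y) * indicator B (?R x) \<partial>lborel) =
       (\<integral>\<^sup>+x. indicator A (?R (x + ?R y) - y) * indicator B (?R (x + ?R y)) \<partial>lborel)"
      by (rule nn_integral_lborel_shift[symmetric]) measurable
    then show "(\<integral>\<^sup>+x. indicator A (?R x) * indicator B (?R x + y) \<partial>lborel) =
       (\<integral>\<^sup>+x. indicator A (?R x - y) * indicator B (?R x) \<partial>lborel)"
      by (simp add: linear_add[OF linear_reflection])
  qed
  also have "\<dots> = (\<integral>\<^sup>+x. (\<integral>\<^sup>+y. indicator A (?R x - y) * indicator B (?R x) \<partial>lborel) \<partial>lborel)"
    by (rule lborel_pair.Fubini') measurable
  also have "\<dots> = (\<integral>\<^sup>+x. emeasure lborel A * indicator B (?R x) \<partial>lborel)"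
  proof (intro nn_integral_cong)
    fix x
    have "(\<integral>\<^sup>+y. indicator A y \<partial>lborel) = (\<integral>\<^sup>+y. indicator A (y + ?R x) \<partial>lborel)"
      by (rule nn_integral_lborel_shift[symmetric]) measurable
    also have "\<dots> = (\<integral>\<^sup>+y. indicator A (?R x - y) \<partial>lborel)"
      by (subst nn_integral_lborel_scale[where c = "-1"]) (auto simp: ennreal_1)
    finally show "(\<integral>\<^sup>+y. indicator A (?R x - y) * indicator B (?R x) \<partial>lborel) =
        emeasure lborel A * indicator B (?R x)"
      by (subst nn_integral_multc) (auto simp: add.commute)
  qed
  also have "\<dots> = emeasure lborel A * emeasure lborel (?R -` B)"
    by (subst nn_integral_cmult) (auto simp: vimage)
  also have "?R -` B = B"
    by (auto simp: B_def)
  finally have "emeasure lborel (?R -` A) * emeasure lborel B = emeasure lborel A * emeasure lborel B"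
    using 1 by simp
  moreover have "unit_ball_vol (real DIM('a)) \<noteq> 0"
    by (metis unit_ball_vol_pos less_irrefl of_nat_0_le_iff)
  then have "emeasure lborel B \<noteq> 0" "emeasure lborel B \<noteq> \<infinity>"
    using emeasure_lborel_ball_finite[of "0::'a" 1]
    unfolding B_def by (auto simp: emeasure_ball)
  ultimately have "emeasure lborel (?R -` A) = emeasure lborel A"
    by (metis ennreal_mult_cancel_left infinity_ennreal_def mult.commute)
  then show "emeasure (distr lborel borel ?R) A = emeasure lborel A"
    by (subst emeasure_distr) auto
qed simp

lemma nn_integral_lborel_reflection:
  assumes [measurable]: "f \<in> borel_measurable borel"
  shows "(\<integral>\<^sup>+x. f (reflection a x) \<partial>lborel) = (\<integral>\<^sup>+x. f x \<partial>lborel)"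
  by (subst distr_reflection[of a, symmetric], subst nn_integral_distr) auto

text \<open>In polar coordinates this is dr/r times surface measure, the Haar measure of the
  half-line times the sphere; hence dilations act without a Jacobian.\<close>

definition mu :: "(real^'n::finite) measure" where
  "mu = density lborel (\<lambda>x. ennreal (norm x powr - real CARD('n)))"

lemma sets_mu [simp, measurable_cong]: "sets mu = sets borel"
  by (simp add: mu_def)

lemma space_mu [simp]: "space mu = UNIV"
  by (simp add: mu_def)

lemma nn_integral_mu:
  fixes f :: "real^'n::finite \<Rightarrow> ennreal"
  assumes [measurable]: "f \<in> borel_measurable borel"
  shows "(\<integral>\<^sup>+x. f x \<partial>mu) = (\<integral>\<^sup>+x. ennreal (norm x powr - real CARD('n)) * f x \<partial>lborel)"
  unfolding mu_def by (subst nn_integral_density) auto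

lemma nn_integral_mu_reflection:
  fixes f :: "real^'n::finite \<Rightarrow> ennreal"
  assumes [measurable]: "f \<in> borel_measurable borel"
  shows "(\<integral>\<^sup>+x. f (reflection a x) \<partial>mu) = (\<integral>\<^sup>+x. f x \<partial>mu)"
  using nn_integral_lborel_reflection[of "\<lambda>x. ennreal (norm x powr - real CARD('n)) * f x" a]
  by (simp add: nn_integral_mu)

lemma nn_integral_mu_scale:
  fixes f :: "real^'n::finite \<Rightarrow> ennreal"
  assumes [measurable]: "f \<in> borel_measurable borel" and c: "0 < c"
  shows "(\<integral>\<^sup>+x. f (c *\<^sub>R x) \<partial>mu) = (\<integral>\<^sup>+x. f x \<partial>mu)"
proof -
  have *: "ennreal (norm x powr - real CARD('n)) * f (c *\<^sub>R x) =
    ennreal (c ^ CARD('n)) * (ennreal (norm (c *\<^sub>R x) powr - real CARD('n)) * f (c *\<^sub>R x))" for x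
  proof -
    have "norm x powr - real CARD('n) = c ^ CARD('n) * norm (c *\<^sub>R x) powr - real CARD('n)"
      using c by (simp add: powr_mult powr_minus powr_realpow)
    then show ?thesis
      using c by (simp add: ennreal_mult mult.assoc)
  qed
  have "(\<integral>\<^sup>+x. f x \<partial>mu) = ennreal (c ^ CARD('n)) *
     (\<integral>\<^sup>+x. ennreal (norm (c *\<^sub>R x) powr - real CARD('n)) * f (c *\<^sub>R x) \<partial>lborel)"
    unfolding nn_integral_mu[OF assms(1)] using c
    by (subst nn_integral_lborel_scale[of _ c]) simp_all
  also have "\<dots> = (\<integral>\<^sup>+x. ennreal (norm x powr - real CARD('n)) * f (c *\<^sub>R x) \<partial>lborel)"
    using c by (subst *, subst nn_integral_cmult) auto
  finally show ?thesis by (simp add: nn_integral_mu)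
qed

lemma AE_mu_iff: "(AE x in mu. P (x::real^'n::finite)) \<longleftrightarrow> (AE x in lborel. P x)"
proof -
  have "AE x in lborel. x \<noteq> (0::real^'n)"
    using AE_lborel_singleton by blast
  then have "(AE x in lborel. (0 < norm x powr - real CARD('n) \<longrightarrow> P x)) \<longleftrightarrow> (AE x in lborel. P x)"
    by (auto elim!: eventually_elim2)
  then show ?thesis
    unfolding mu_def by (subst AE_density) (auto simp: ennreal_zero_less_divide)
qed

lemma emeasure_annulus_finite:
  assumes "0 < a"
  shows "emeasure mu {x::real^'n::finite. a \<le> norm x \<and> norm x \<le> b} < \<infinity>"
proof -
  let ?A = "{x::real^'n. a \<le> norm x \<and> norm x \<le> b}"
  have [measurable]: "?A \<in> sets borel" by measurable
  have "emeasure mu ?A = (\<integral>\<^sup>+x. ennreal (norm x powr - real CARD('n)) * indicator ?A x \<partial>lborel)"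
    unfolding mu_def by (subst emeasure_density) measurable
  also have "\<dots> \<le> (\<integral>\<^sup>+x. ennreal (a powr - real CARD('n)) * indicator (cball (0::real^'n) b) x \<partial>lborel)"
    by (rule nn_integral_mono) (use assms in \<open>auto simp: indicator_def powr_mono2' ennreal_leI\<close>)
  also have "\<dots> = ennreal (a powr - real CARD('n)) * emeasure lborel (cball (0::real^'n) b)"
    by (subst nn_integral_cmult_indicator) auto
  also have "\<dots> < \<infinity>"
    using emeasure_lborel_cball_finite[of "0::real^'n" b] by (simp add: ennreal_mult_less_top)
  finally show ?thesis .
qed

lemma sigma_finite_mu: "sigma_finite_measure (mu :: (real^'n::finite) measure)"
  unfolding mu_def
  by (rule sigma_finite_measure.sigma_finite_iff_density_finite[THEN iffD2, OF sigma_finite_lborel]) auto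

interpretation mu: sigma_finite_measure mu
  by (rule sigma_finite_mu)

interpretation mu2: pair_sigma_finite mu mu
  by unfold_locales

lemma Fubini_mu:
  fixes f :: "real^'n::finite \<Rightarrow> real^'n \<Rightarrow> ennreal"
  assumes "case_prod f \<in> borel_measurable (borel \<Otimes>\<^sub>M borel)"
  shows "(\<integral>\<^sup>+x. (\<integral>\<^sup>+y. f x y \<partial>mu) \<partial>mu) = (\<integral>\<^sup>+y. (\<integral>\<^sup>+x. f x y \<partial>mu) \<partial>mu)"
  by (rule mu2.Fubini'[symmetric]) (use assms in measurable)

text \<open>Reflections and dilations act transitively on the complement of the origin.\<close>

lemma nn_integral_mu_invariant_kernel:
  fixes F :: "real^'n::finite \<Rightarrow> real^'n \<Rightarrow> ennreal"
  assumes [measurable]: "\<And>x. F x \<in> borel_measurable borel"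
    and scale: "\<And>c x y. 0 < c \<Longrightarrow> F (c *\<^sub>R x) (c *\<^sub>R y) = F x y"
    and refl: "\<And>a x y. F (reflection a x) (reflection a y) = F x y"
    and "x \<noteq> 0" "z \<noteq> 0"
  shows "(\<integral>\<^sup>+y. F x y \<partial>mu) = (\<integral>\<^sup>+y. F z y \<partial>mu)"
proof -
  define c where "c = norm z / norm x"
  have c: "0 < c" using assms by (simp add: c_def)
  have n: "norm (c *\<^sub>R x) = norm z" using assms by (simp add: c_def)
  define a where "a = c *\<^sub>R x - z"
  have a: "reflection a (c *\<^sub>R x) = z"
    unfolding a_def by (rule reflection_maps_to[OF n])
  have "(\<integral>\<^sup>+y. F x y \<partial>mu) = (\<integral>\<^sup>+y. F (c *\<^sub>R x) (c *\<^sub>R y) \<partial>mu)"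
    using scale[OF c] by simp
  also have "\<dots> = (\<integral>\<^sup>+y. F (c *\<^sub>R x) y \<partial>mu)"
    by (rule nn_integral_mu_scale) (use c in auto)
  also have "\<dots> = (\<integral>\<^sup>+y. F z (reflection a y) \<partial>mu)"
    using refl[of a "c *\<^sub>R x"] a by simp
  also have "\<dots> = (\<integral>\<^sup>+y. F z y \<partial>mu)"
    by (rule nn_integral_mu_reflection) auto
  finally show ?thesis .
qed

subsection \<open>Quadratic forms of invariant kernels\<close>

text \<open>The invariances make the integral over one variable independent of the other, so that it
  collapses to the constant \<open>weight\<close>. The condition \<open>zero\<close> keeps
  truncations exact at the origin, where there is no ratio of norms.\<close>

locale invariant_kernel =
  fixes K :: "real^'n::finite \<Rightarrow> real^'n \<Rightarrow> real"
  assumes meas: "case_prod K \<in> borel_measurable (borel \<Otimes>\<^sub>M borel)"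
    and nonneg: "0 \<le> K x y"
    and sym: "K x y = K y x"
    and scale: "0 < c \<Longrightarrow> K (c *\<^sub>R x) (c *\<^sub>R y) = K x y"
    and refl: "K (reflection a x) (reflection a y) = K x y"
    and zero: "K x 0 = 0"

definition L2sq :: "(real^'n::finite \<Rightarrow> real) \<Rightarrow> ennreal" where
  "L2sq h = (\<integral>\<^sup>+x. ennreal ((h x)\<^sup>2) \<partial>mu)"

abbreviation tdiff :: "real \<Rightarrow> (real^'n::finite \<Rightarrow> real) \<Rightarrow> real^'n \<Rightarrow> real^'n \<Rightarrow> real" where
  "tdiff g h x y \<equiv> h x * (norm y / norm x) powr (g / 2) - h y * (norm x / norm y) powr (g / 2)"

text \<open>For \<open>h = |x|\<^sup>g u\<close> one has \<open>(tdiff g h x y)\<^sup>2 = (u x - u y)\<^sup>2 (|x| |y|)\<^sup>g\<close>, so this is the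
  energy of \<open>u\<close> in logarithmic coordinates.\<close>

definition Qform ::
  "real \<Rightarrow> (real^'n::finite \<Rightarrow> real^'n \<Rightarrow> real) \<Rightarrow> (real^'n \<Rightarrow> real) \<Rightarrow> ennreal" where
  "Qform g K h = (\<integral>\<^sup>+x. (\<integral>\<^sup>+y. ennreal ((tdiff g h x y)\<^sup>2 * K x y) \<partial>mu) \<partial>mu)"

text \<open>The base point \<open>1\<close> is the vector with all entries 1, an arbitrary nonzero
  choice whose norm is divided out; by \<open>weight_eq\<close> any other gives the same value. The
  value may be infinite, as it is for \<open>kap\<close>.\<close>

definition weight :: "real \<Rightarrow> (real^'n::finite \<Rightarrow> real^'n \<Rightarrow> real) \<Rightarrow> ennreal" where
  "weight g K = (\<integral>\<^sup>+y. ennreal ((norm y / norm (1::real^'n)) powr g * K 1 y) \<partial>mu)"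

lemma AE_mu_nonzero: "AE x in mu. x \<noteq> (0::real^'n::finite)"
  unfolding AE_mu_iff using AE_lborel_singleton by blast

lemma AE_mu_neq: "AE x in mu. x \<noteq> (a::real^'n::finite)"
  unfolding AE_mu_iff using AE_lborel_singleton by blast

lemma nn_integral2_mu_cong:
  fixes F G :: "real^'n::finite \<Rightarrow> real^'n \<Rightarrow> ennreal"
  assumes "\<And>x y. x \<noteq> 0 \<Longrightarrow> y \<noteq> 0 \<Longrightarrow> x \<noteq> y \<Longrightarrow> F x y = G x y"
  shows "(\<integral>\<^sup>+x. (\<integral>\<^sup>+y. F x y \<partial>mu) \<partial>mu) = (\<integral>\<^sup>+x. (\<integral>\<^sup>+y. G x y \<partial>mu) \<partial>mu)"
proof (rule nn_integral_cong_AE)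
  show "AE x in mu. (\<integral>\<^sup>+y. F x y \<partial>mu) = (\<integral>\<^sup>+y. G x y \<partial>mu)"
    using AE_mu_nonzero
  proof eventually_elim
    case (elim x)
    have "AE y in mu. F x y = G x y"
      using AE_mu_nonzero AE_mu_neq[of x] by eventually_elim (use elim assms in auto)
    then show ?case by (rule nn_integral_cong_AE)
  qed
qed

lemma nn_integral2_mu_mono:
  fixes F G :: "real^'n::finite \<Rightarrow> real^'n \<Rightarrow> ennreal"
  assumes "\<And>x y. x \<noteq> 0 \<Longrightarrow> y \<noteq> 0 \<Longrightarrow> x \<noteq> y \<Longrightarrow> F x y \<le> G x y"
  shows "(\<integral>\<^sup>+x. (\<integral>\<^sup>+y. F x y \<partial>mu) \<partial>mu) \<le> (\<integral>\<^sup>+x. (\<integral>\<^sup>+y. G x y \<partial>mu) \<partial>mu)"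
proof (rule nn_integral_mono_AE)
  show "AE x in mu. (\<integral>\<^sup>+y. F x y \<partial>mu) \<le> (\<integral>\<^sup>+y. G x y \<partial>mu)"
    using AE_mu_nonzero
  proof eventually_elim
    case (elim x)
    have "AE y in mu. F x y \<le> G x y"
      using AE_mu_nonzero AE_mu_neq[of x] by eventually_elim (use elim assms in auto)
    then show ?case by (rule nn_integral_mono_AE)
  qed
qed

lemma nn_integral2_mu_add:
  fixes F G :: "real^'n::finite \<Rightarrow> real^'n \<Rightarrow> ennreal"
  assumes [measurable]: "case_prod F \<in> borel_measurable (borel \<Otimes>\<^sub>M borel)"
    "case_prod G \<in> borel_measurable (borel \<Otimes>\<^sub>M borel)"
  shows "(\<integral>\<^sup>+x. (\<integral>\<^sup>+y. F x y + G x y \<partial>mu) \<partial>mu) =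
    (\<integral>\<^sup>+x. (\<integral>\<^sup>+y. F x y \<partial>mu) \<partial>mu) + (\<integral>\<^sup>+x. (\<integral>\<^sup>+y. G x y \<partial>mu) \<partial>mu)"
  by (simp add: nn_integral_add)

lemma nn_integral2_mu_cmult:
  fixes F :: "real^'n::finite \<Rightarrow> real^'n \<Rightarrow> ennreal"
  assumes [measurable]: "case_prod F \<in> borel_measurable (borel \<Otimes>\<^sub>M borel)"
  shows "(\<integral>\<^sup>+x. (\<integral>\<^sup>+y. c * F x y \<partial>mu) \<partial>mu) = c * (\<integral>\<^sup>+x. (\<integral>\<^sup>+y. F x y \<partial>mu) \<partial>mu)"
  by (simp add: nn_integral_cmult)

lemma ennreal_le_2_mult: "a \<le> 2 * b \<Longrightarrow> ennreal a \<le> 2 * ennreal b"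
  using ennreal_leI[of a "2 * b"] ennreal_mult'[of 2 b] by simp

context invariant_kernel
begin

declare meas [measurable]

lemma weight_eq:
  assumes "x \<noteq> 0"
  shows "(\<integral>\<^sup>+y. ennreal ((norm y / norm x) powr g * K x y) \<partial>mu) = weight g K"
  unfolding weight_def
  by (rule nn_integral_mu_invariant_kernel) (use assms in \<open>auto simp: scale refl\<close>)

lemma weight_left:
  assumes [measurable]: "h \<in> borel_measurable borel"
  shows "(\<integral>\<^sup>+x. (\<integral>\<^sup>+y. ennreal ((h x)\<^sup>2 * (norm y / norm x) powr g * K x y) \<partial>mu) \<partial>mu) = weight g K * L2sq h"
proof -
  have "(\<integral>\<^sup>+x. (\<integral>\<^sup>+y. ennreal ((h x)\<^sup>2 * (norm y / norm x) powr g * K x y) \<partial>mu) \<partial>mu) =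
     (\<integral>\<^sup>+x. weight g K * ennreal ((h x)\<^sup>2) \<partial>mu)"
  proof (rule nn_integral_cong_AE, use AE_mu_nonzero in eventually_elim)
    case (elim x)
    have "(\<integral>\<^sup>+y. ennreal ((h x)\<^sup>2 * (norm y / norm x) powr g * K x y) \<partial>mu) =
      (\<integral>\<^sup>+y. ennreal ((h x)\<^sup>2) * ennreal ((norm y / norm x) powr g * K x y) \<partial>mu)"
      by (intro nn_integral_cong) (simp add: ennreal_mult' mult.assoc)
    also have "\<dots> = ennreal ((h x)\<^sup>2) * (\<integral>\<^sup>+y. ennreal ((norm y / norm x) powr g * K x y) \<partial>mu)"
      by (rule nn_integral_cmult) measurable
    finally show ?case
      unfolding weight_eq[OF elim] by (simp add: mult.commute)
  qed
  also have "\<dots> = weight g K * L2sq h"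
    unfolding L2sq_def by (rule nn_integral_cmult) measurable
  finally show ?thesis .
qed

lemma weight_right:
  assumes [measurable]: "h \<in> borel_measurable borel"
  shows "(\<integral>\<^sup>+x. (\<integral>\<^sup>+y. ennreal ((h y)\<^sup>2 * (norm x / norm y) powr g * K x y) \<partial>mu) \<partial>mu) = weight g K * L2sq h"
  by (subst Fubini_mu, measurable, subst sym, rule weight_left[OF assms])

lemma weight_both:
  assumes [measurable]: "h \<in> borel_measurable borel"
  shows "(\<integral>\<^sup>+x. (\<integral>\<^sup>+y. ennreal (((h x)\<^sup>2 * (norm y / norm x) powr g
      + (h y)\<^sup>2 * (norm x / norm y) powr g) * K x y) \<partial>mu) \<partial>mu) = 2 * weight g K * L2sq h"
proof -
  have "(\<integral>\<^sup>+x. (\<integral>\<^sup>+y. ennreal (((h x)\<^sup>2 * (norm y / norm x) powr g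
      + (h y)\<^sup>2 * (norm x / norm y) powr g) * K x y) \<partial>mu) \<partial>mu) =
    (\<integral>\<^sup>+x. (\<integral>\<^sup>+y. ennreal ((h x)\<^sup>2 * (norm y / norm x) powr g * K x y) +
       ennreal ((h y)\<^sup>2 * (norm x / norm y) powr g * K x y) \<partial>mu) \<partial>mu)"
    by (intro nn_integral_cong) (simp add: ring_distribs nonneg flip: ennreal_plus)
  also have "\<dots> = weight g K * L2sq h + weight g K * L2sq h"
    by (subst nn_integral2_mu_add) (auto simp: weight_left weight_right)
  finally show ?thesis by (simp add: mult_2 distrib_right)
qed

text \<open>Ground state substitution: both sides expand the same square, so no principal value is
  needed.\<close>

lemma Qform_add_weight:
  assumes [measurable]: "h \<in> borel_measurable borel"
  shows "Qform g K h + 2 * weight 0 K * L2sq h = Qform 0 K h + 2 * weight g K * L2sq h"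
proof -
  have "Qform g K h + 2 * weight 0 K * L2sq h =
     (\<integral>\<^sup>+x. (\<integral>\<^sup>+y. ennreal ((tdiff g h x y)\<^sup>2 * K x y) + ennreal (((h x)\<^sup>2 * (norm y / norm x) powr 0
      + (h y)\<^sup>2 * (norm x / norm y) powr 0) * K x y) \<partial>mu) \<partial>mu)"
    unfolding Qform_def weight_both[OF assms, symmetric]
    by (subst nn_integral2_mu_add[symmetric]) auto
  also have "\<dots> = (\<integral>\<^sup>+x. (\<integral>\<^sup>+y. ennreal ((tdiff 0 h x y)\<^sup>2 * K x y) + ennreal (((h x)\<^sup>2 * (norm y / norm x) powr g
      + (h y)\<^sup>2 * (norm x / norm y) powr g) * K x y) \<partial>mu) \<partial>mu)"
  proof (rule nn_integral2_mu_cong)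
    fix x y :: "real^'n" assume xy: "x \<noteq> 0" "y \<noteq> 0"
    let ?r = "norm y / norm x" and ?t = "norm x / norm y"
    have r: "0 < ?r" "0 < ?t" using xy by auto
    have 1: "?r powr g = (?r powr (g/2))\<^sup>2" "?t powr g = (?t powr (g/2))\<^sup>2"
      by (simp_all add: power2_eq_square flip: powr_add)
    \<comment> \<open>As these powers are reciprocal, the mixed term of the square is
      \<open>- 2 * h x * h y\<close> for every exponent; only the pure squares depend on
      \<open>g\<close>.\<close>
    have 2: "?r powr (g/2) * ?t powr (g/2) = 1"
      using xy by (simp add: powr_mult[symmetric])
    have 3: "?r powr 0 = 1" "?t powr 0 = 1" using xy by auto
    have "(h x * ?r powr (g / 2) - h y * ?t powr (g / 2))\<^sup>2 + ((h x)\<^sup>2 + (h y)\<^sup>2) =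
      (h x - h y)\<^sup>2 + ((h x)\<^sup>2 * ?r powr g + (h y)\<^sup>2 * ?t powr g)"
      using 2 unfolding 1 by (simp add: power2_eq_square) algebra
    then have "(h x * ?r powr (g / 2) - h y * ?t powr (g / 2))\<^sup>2 * K x y + ((h x)\<^sup>2 * ?r powr 0 + (h y)\<^sup>2 * ?t powr 0) * K x y =
      (h x * ?r powr (0/2) - h y * ?t powr (0/2))\<^sup>2 * K x y + ((h x)\<^sup>2 * ?r powr g + (h y)\<^sup>2 * ?t powr g) * K x y"
      using 3 by (simp flip: distrib_right)
    then show "ennreal ((h x * ?r powr (g / 2) - h y * ?t powr (g / 2))\<^sup>2 * K x y) + ennreal (((h x)\<^sup>2 * ?r powr 0 + (h y)\<^sup>2 * ?t powr 0) * K x y) =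
      ennreal ((h x * ?r powr (0/2) - h y * ?t powr (0/2))\<^sup>2 * K x y) + ennreal (((h x)\<^sup>2 * ?r powr g + (h y)\<^sup>2 * ?t powr g) * K x y)"
      by (subst (1 2) ennreal_plus[symmetric]) (simp_all add: nonneg)
  qed
  also have "\<dots> = Qform 0 K h + 2 * weight g K * L2sq h"
    unfolding Qform_def weight_both[OF assms, symmetric]
    by (subst nn_integral2_mu_add[symmetric]) auto
  finally show ?thesis .
qed

text \<open>From \<open>(a - b)^2 <= 2 * (a^2 + b^2)\<close>. It serves the truncated kernels: their
  weights are finite, so the form is finite on L^2 and terms may be cancelled.\<close>

lemma Qform_zero_le:
  assumes [measurable]: "h \<in> borel_measurable borel"
  shows "Qform 0 K h \<le> 4 * weight 0 K * L2sq h"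
proof -
  have "Qform 0 K h \<le> (\<integral>\<^sup>+x. (\<integral>\<^sup>+y. 2 * ennreal (((h x)\<^sup>2 * (norm y / norm x) powr 0
      + (h y)\<^sup>2 * (norm x / norm y) powr 0) * K x y) \<partial>mu) \<partial>mu)"
    unfolding Qform_def
  proof (rule nn_integral2_mu_mono)
    fix x y :: "real^'n" assume xy: "x \<noteq> 0" "y \<noteq> 0"
    have "(h x - h y)\<^sup>2 \<le> 2 * ((h x)\<^sup>2 + (h y)\<^sup>2)"
      using sum_squares_bound[of "h x" "- h y"] by (simp add: power2_diff algebra_simps)
    then have "(h x - h y)\<^sup>2 * K x y \<le> 2 * (((h x)\<^sup>2 + (h y)\<^sup>2) * K x y)"
      using mult_right_mono[OF _ nonneg[of x y]] by (metis mult.assoc)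
    then have "ennreal ((h x - h y)\<^sup>2 * K x y) \<le> 2 * ennreal (((h x)\<^sup>2 + (h y)\<^sup>2) * K x y)"
      by (rule ennreal_le_2_mult)
    then show "ennreal ((tdiff 0 h x y)\<^sup>2 * K x y)
       \<le> 2 * ennreal (((h x)\<^sup>2 * (norm y / norm x) powr 0 + (h y)\<^sup>2 * (norm x / norm y) powr 0) * K x y)"
      using xy by simp
  qed
  also have "\<dots> = 2 * (2 * weight 0 K * L2sq h)"
    unfolding weight_both[OF assms, symmetric]
    by (rule nn_integral2_mu_cmult) measurable
  finally show ?thesis by (simp add: mult.assoc[symmetric])
qed

end

section \<open>The Gagliardo kernel and its truncations\<close>

definition kap :: "real \<Rightarrow> real^'n::finite \<Rightarrow> real^'n \<Rightarrow> real" where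
  "kap s x y = (norm x * norm y) powr ((real CARD('n) + 2 * s) / 2) / norm (x - y) powr (real CARD('n) + 2 * s)"

definition ktrunc :: "nat \<Rightarrow> (real^'n::finite \<Rightarrow> real^'n \<Rightarrow> real) \<Rightarrow> real^'n \<Rightarrow> real^'n \<Rightarrow> real" where
  "ktrunc j K x y = (if norm y \<le> real j * norm x \<and> norm x \<le> real j * norm y then min (real j) (K x y) else 0)"

text \<open>The Gagliardo kernel has degree \<open>- (n + 2s)\<close> under dilations, and the
  factor \<open>(norm x * norm y) powr ((n + 2s) / 2)\<close> restores degree 0. This factor is free
  of alpha, so one kernel serves all weights.\<close>

lemma invariant_kernel_kap: "invariant_kernel (kap s :: real^'n::finite \<Rightarrow> _)"
proof
  fix c :: real and x y :: "real^'n" assume c: "0 < c"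
  have "(norm (c *\<^sub>R x) * norm (c *\<^sub>R y)) powr ((real CARD('n) + 2 * s) / 2) =
    c powr (real CARD('n) + 2 * s) * (norm x * norm y) powr ((real CARD('n) + 2 * s) / 2)"
  proof -
    have "norm (c *\<^sub>R x) * norm (c *\<^sub>R y) = (c * c) * (norm x * norm y)" using c by simp
    then show ?thesis using c by (simp add: powr_mult powr_powr powr_add[symmetric])
  qed
  moreover have "norm (c *\<^sub>R x - c *\<^sub>R y) powr (real CARD('n) + 2 * s) = c powr (real CARD('n) + 2 * s) * norm (x - y) powr (real CARD('n) + 2 * s)"
    using c by (simp add: powr_mult flip: scaleR_diff_right)
  ultimately show "kap s (c *\<^sub>R x) (c *\<^sub>R y) = kap s x y"
    using c by (simp only: kap_def) simp
next
  show "case_prod (kap s) \<in> borel_measurable (borel \<Otimes>\<^sub>M (borel :: (real^'n) measure))"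
    unfolding kap_def[abs_def] by measurable
qed (auto simp: kap_def reflection_diff norm_minus_commute mult.commute)

lemma invariant_kernel_ktrunc:
  assumes "invariant_kernel K"
  shows "invariant_kernel (ktrunc j K)"
proof -
  interpret invariant_kernel K by fact
  show ?thesis
  proof
    show "case_prod (ktrunc j K) \<in> borel_measurable (borel \<Otimes>\<^sub>M borel)"
      unfolding ktrunc_def[abs_def] by measurable
    show "ktrunc j K x y = ktrunc j K y x" for x y by (auto simp: ktrunc_def sym[of x y])
  qed (auto simp: ktrunc_def nonneg scale refl zero)
qed

text \<open>The truncation bounds both the height and the ratio of the norms, so the integrand is
  bounded and lives on an annulus of finite measure. Cutting by the ratio, not by a fixed region,
  keeps the kernel dilation invariant.\<close>

lemma weight_ktrunc_finite: "weight g (ktrunc j (K :: real^'n::finite \<Rightarrow> _)) < \<infinity>"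
proof (cases "j = 0")
  case True
  then have "ktrunc j K x y \<le> 0" for x y by (auto simp: ktrunc_def)
  then show ?thesis
    unfolding weight_def by (subst nn_integral_0_iff_AE[THEN iffD2])
       (auto simp: ennreal_neg mult_nonneg_nonpos intro!: measurable_const AE_I2)
next
  case False
  let ?n = "norm (1::real^'n)"
  let ?A = "{y::real^'n. ?n / real j \<le> norm y \<and> norm y \<le> real j * ?n}"
  have n: "0 < ?n" by simp
  have "weight g (ktrunc j K) \<le> (\<integral>\<^sup>+y. ennreal (max (real j powr g) ((1 / real j) powr g) * real j) * indicator ?A y \<partial>mu)"
    unfolding weight_def
  proof (rule nn_integral_mono)
    fix y :: "real^'n"
    show "ennreal ((norm y / ?n) powr g * ktrunc j K 1 y) \<le> ennreal (max (real j powr g) ((1 / real j) powr g) * real j) * indicator ?A y"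
    proof (cases "norm y \<le> real j * ?n \<and> ?n \<le> real j * norm y")
      case True
      have r: "1 / real j \<le> norm y / ?n" "norm y / ?n \<le> real j"
        using True False n by (auto simp: field_simps)
      have "(norm y / ?n) powr g \<le> max (real j powr g) ((1 / real j) powr g)"
      proof (cases "0 \<le> g")
        case True
        then show ?thesis using r by (auto intro!: powr_mono2 max.coboundedI1)
      next
        case False
        then show ?thesis using r \<open>j \<noteq> 0\<close> by (auto intro!: powr_mono2' max.coboundedI2)
      qed
      then have "(norm y / ?n) powr g * ktrunc j K 1 y \<le> max (real j powr g) ((1 / real j) powr g) * real j"
        using mult_left_mono[of "ktrunc j K 1 y" "real j" "(norm y / ?n) powr g"]
          mult_right_mono[of "(norm y / ?n) powr g" _ "real j"]
        by (fastforce simp: ktrunc_def)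
      moreover have "y \<in> ?A" using True False n by (auto simp: field_simps)
      ultimately show ?thesis by (auto intro: ennreal_leI)
    qed (auto simp: ktrunc_def)
  qed
  also have "\<dots> = ennreal (max (real j powr g) ((1 / real j) powr g) * real j) * emeasure mu ?A"
    by (subst nn_integral_cmult_indicator) auto
  also have "\<dots> < \<infinity>"
    using emeasure_annulus_finite[of "?n / real j" "real j * ?n", where 'n = 'n] n False
    by (simp add: ennreal_mult_less_top)
  finally show ?thesis .
qed

lemma ktrunc_mono:
  assumes "i \<le> j" "0 \<le> K x y"
  shows "ktrunc i K x y \<le> ktrunc j K x y"
proof -
  have "real i * norm x \<le> real j * norm x" "real i * norm y \<le> real j * norm y"
    using assms by (auto intro: mult_right_mono)
  then show ?thesis using assms by (auto simp: ktrunc_def)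
qed

lemma (in invariant_kernel) eventually_ktrunc:
  "eventually (\<lambda>j. ktrunc j K x y = K x y) sequentially"
proof (cases "x = 0 \<or> y = 0")
  case True
  then have "K x y = 0" using zero[of x] zero[of y] sym[of x y] by auto
  then show ?thesis using True by (auto simp: ktrunc_def)
next
  case False
  obtain j0 :: nat where j0: "max (K x y) (max (norm y / norm x) (norm x / norm y)) \<le> real j0"
    using real_arch_simple by blast
  show ?thesis
    using eventually_ge_at_top[of j0]
  proof eventually_elim
    case (elim j)
    then have "K x y \<le> real j" "norm y / norm x \<le> real j" "norm x / norm y \<le> real j"
      using j0 by auto
    then show ?case using False by (auto simp: ktrunc_def field_simps)
  qed
qed

lemma Qform_ktrunc_LIMSEQ:
  assumes "invariant_kernel K" and [measurable]: "h \<in> borel_measurable borel"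
  shows "(\<lambda>j. Qform g (ktrunc j K) h) \<longlonglongrightarrow> Qform g K h"
proof -
  interpret invariant_kernel K by fact
  have inv: "invariant_kernel (ktrunc j K)" for j
    by (rule invariant_kernel_ktrunc) fact
  note invariant_kernel.meas[OF inv, measurable]
  let ?c = "\<lambda>x y. (tdiff g h x y)\<^sup>2"
  have mono: "ennreal (?c x y * ktrunc i K x y) \<le> ennreal (?c x y * ktrunc j K x y)" if "i \<le> j" for i j x y
    using that by (intro ennreal_leI mult_left_mono ktrunc_mono nonneg) auto
  have inner: "(\<lambda>j. \<integral>\<^sup>+y. ennreal (?c x y * ktrunc j K x y) \<partial>mu) \<longlonglongrightarrow> (\<integral>\<^sup>+y. ennreal (?c x y * K x y) \<partial>mu)"
    for x
  proof (rule nn_integral_LIMSEQ)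
    show "incseq (\<lambda>j y. ennreal (?c x y * ktrunc j K x y))"
      by (intro incseq_SucI le_funI mono) auto
    show "(\<lambda>j. ennreal (?c x y * ktrunc j K x y)) \<longlonglongrightarrow> ennreal (?c x y * K x y)" for y
      by (rule tendsto_eventually, rule eventually_mono[OF eventually_ktrunc[of x y]]) simp
  qed measurable
  show ?thesis
    unfolding Qform_def
  proof (rule nn_integral_LIMSEQ)
    show "incseq (\<lambda>j x. \<integral>\<^sup>+y. ennreal (?c x y * ktrunc j K x y) \<partial>mu)"
      by (intro incseq_SucI le_funI nn_integral_mono mono) auto
  qed (use inner in measurable)
qed

text \<open>Eliminating the weights between \<open>h\<close> and \<open>f\<close> before the truncation is removed keeps
  every term finite.\<close>

lemma Qform_identity:
  assumes "invariant_kernel K" and h [measurable]: "h \<in> borel_measurable borel"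
    and f [measurable]: "f \<in> borel_measurable borel"
    and fin: "L2sq h < \<infinity>" "L2sq f < \<infinity>"
  shows "Qform g K h * L2sq f + Qform 0 K f * L2sq h = Qform g K f * L2sq h + Qform 0 K h * L2sq f"
proof -
  have fin': "L2sq h \<noteq> \<infinity>" "L2sq f \<noteq> \<infinity>" using fin by auto
  have trunc: "Qform g (ktrunc j K) h * L2sq f + Qform 0 (ktrunc j K) f * L2sq h =
    Qform g (ktrunc j K) f * L2sq h + Qform 0 (ktrunc j K) h * L2sq f" for j
  proof -
    interpret invariant_kernel "ktrunc j K"
      by (rule invariant_kernel_ktrunc) fact
    have W: "weight g (ktrunc j K) < \<infinity>" "weight 0 (ktrunc j K) < \<infinity>"
      by (rule weight_ktrunc_finite)+
    have finQ0: "Qform 0 (ktrunc j K) v < \<infinity>" if [measurable]: "v \<in> borel_measurable borel" and "L2sq v < \<infinity>" for v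
      using Qform_zero_le[OF that(1)] W that
      by (auto simp: ennreal_mult_less_top elim!: le_less_trans)
    have finQ: "Qform g (ktrunc j K) v < \<infinity>" if [measurable]: "v \<in> borel_measurable borel" and "L2sq v < \<infinity>" for v
    proof -
      have "Qform g (ktrunc j K) v \<le> Qform g (ktrunc j K) v + 2 * weight 0 (ktrunc j K) * L2sq v"
        by simp
      also have "\<dots> = Qform 0 (ktrunc j K) v + 2 * weight g (ktrunc j K) * L2sq v"
        by (rule Qform_add_weight) fact
      also have "\<dots> < \<infinity>"
        using finQ0[OF that] W that(2) by (auto simp: ennreal_mult_less_top)
      finally show ?thesis .
    qed
    obtain w0 wg where w: "0 \<le> w0" "0 \<le> wg" "weight 0 (ktrunc j K) = ennreal w0" "weight g (ktrunc j K) = ennreal wg"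
      using W by (cases "weight 0 (ktrunc j K)"; cases "weight g (ktrunc j K)") auto
    obtain a b where a: "0 \<le> a" "0 \<le> b" "L2sq h = ennreal a" "L2sq f = ennreal b"
      using fin by (cases "L2sq h"; cases "L2sq f") auto
    obtain p q where p: "0 \<le> p" "0 \<le> q" "Qform 0 (ktrunc j K) h = ennreal p" "Qform 0 (ktrunc j K) f = ennreal q"
      using finQ0[OF h fin(1)] finQ0[OF f fin(2)] by (cases "Qform 0 (ktrunc j K) h"; cases "Qform 0 (ktrunc j K) f") auto
    obtain p' q' where p': "0 \<le> p'" "0 \<le> q'" "Qform g (ktrunc j K) h = ennreal p'" "Qform g (ktrunc j K) f = ennreal q'"
      using finQ[OF h fin(1)] finQ[OF f fin(2)] by (cases "Qform g (ktrunc j K) h"; cases "Qform g (ktrunc j K) f") auto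
    have 1: "p' + 2 * w0 * a = p + 2 * wg * a"
      using Qform_add_weight[OF h, of g] w a p p'
      by (simp add: ennreal_numeral[symmetric] del: ennreal_numeral flip: ennreal_mult ennreal_plus)
    have 2: "q' + 2 * w0 * b = q + 2 * wg * b"
      using Qform_add_weight[OF f, of g] w a p p'
      by (simp add: ennreal_numeral[symmetric] del: ennreal_numeral flip: ennreal_mult ennreal_plus)
    \<comment> \<open>\<open>b\<close> times the first relation minus \<open>a\<close> times the
      second: the weights occur only in multiples of \<open>a * b\<close> and cancel.\<close>
    have "p' * b + q * a = q' * a + p * b"
      using arg_cong[OF 1, of "\<lambda>t. t * b"] arg_cong[OF 2, of "\<lambda>t. t * a"]
      by (simp add: algebra_simps)
    then show ?thesis
      using a p p' by (simp flip: ennreal_mult ennreal_plus)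
  qed
  \<comment> \<open>Multiplication by \<open>c\<close> in \<open>ennreal\<close> is continuous for
    finite \<open>c\<close>; the finiteness of both \<open>L2sq\<close> values enters here.\<close>
  have lim: "(\<lambda>j. u j * c) \<longlonglongrightarrow> l * c" if "u \<longlonglongrightarrow> l" "c < \<infinity>" for u and l c :: ennreal
    using ennreal_tendsto_cmult[of c u l] that by (simp add: mult.commute)
  have "(\<lambda>j. Qform g (ktrunc j K) h * L2sq f + Qform 0 (ktrunc j K) f * L2sq h) \<longlonglongrightarrow>
      Qform g K h * L2sq f + Qform 0 K f * L2sq h"
    by (intro tendsto_add lim Qform_ktrunc_LIMSEQ assms)
  moreover have "(\<lambda>j. Qform g (ktrunc j K) f * L2sq h + Qform 0 (ktrunc j K) h * L2sq f) \<longlonglongrightarrow>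
      Qform g K f * L2sq h + Qform 0 K h * L2sq f"
    by (intro tendsto_add lim Qform_ktrunc_LIMSEQ assms)
  ultimately show ?thesis
    unfolding trunc by (rule LIMSEQ_unique)
qed

section \<open>Coercivity of the form on odd functions\<close>

lemma reflection_eq_0_iff [simp]: "reflection a x = 0 \<longleftrightarrow> x = 0"
  by (metis norm_eq_zero norm_reflection)

lemma not_AE_lborel_notin_open:
  assumes "open U" "x \<in> U" "AE y in lborel. y \<notin> (U :: 'a::euclidean_space set)"
  shows False
proof -
  obtain e where e: "0 < e" "ball x e \<subseteq> U"
    using assms by (auto simp: open_contains_ball)
  have "AE y in lborel. y \<notin> ball x e"
    using assms(3) by eventually_elim (use e in auto)
  then have "emeasure lborel (ball x e) = 0"
    using AE_iff_null_sets[of "ball x e" lborel] by auto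
  moreover have "unit_ball_vol (real DIM('a)) \<noteq> 0"
    by (metis unit_ball_vol_pos less_irrefl of_nat_0_le_iff)
  ultimately show False
    using e by (auto simp: emeasure_ball)
qed

lemma power2_powr_half: "0 < a \<Longrightarrow> (a\<^sup>2) powr (m / 2) = a powr (m :: real)"
  by (simp add: powr_powr flip: powr_numeral)

text \<open>A minorant of \<open>kap\<close> up to a constant that depends on the norms alone, so
  that one variable can be reflected by itself. For \<open>b > 1\<close> it avoids the diagonal,
  where \<open>kap\<close> is singular. The odd gain takes \<open>b = 2\<close>, the Hardy
  inequality a large \<open>b\<close>.\<close>

definition far :: "real \<Rightarrow> real^'n::finite \<Rightarrow> real^'n \<Rightarrow> real" where
  "far b x y = (if x \<noteq> 0 \<and> y \<noteq> 0 \<and> (b * norm x \<le> norm y \<and> norm y \<le> 2 * b * norm x \<or>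
     b * norm y \<le> norm x \<and> norm x \<le> 2 * b * norm y) then 1 else 0)"

lemma invariant_kernel_far: "invariant_kernel (far b :: real^'n::finite \<Rightarrow> _)"
proof
  show "case_prod (far b) \<in> borel_measurable (borel \<Otimes>\<^sub>M (borel :: (real^'n) measure))"
    unfolding far_def[abs_def] by measurable
  fix c :: real and x y :: "real^'n" assume "0 < c"
  then have "b * (c * norm x) \<le> c * norm y \<longleftrightarrow> b * norm x \<le> norm y"
     "c * norm y \<le> 2 * b * (c * norm x) \<longleftrightarrow> norm y \<le> 2 * b * norm x" for x y :: "real^'n"
    by (simp_all add: mult.left_commute[of _ c] mult.assoc)
  then show "far b (c *\<^sub>R x) (c *\<^sub>R y) = far b x y"
    using \<open>0 < c\<close> by (simp add: far_def)
qed (auto simp: far_def)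

text \<open>If \<open>y\<close> has the larger norm, then \<open>norm (x - y) <= 2 * norm y\<close>
  and \<open>norm y <= 2 * b * norm x\<close>, so the squared distance is at most
  \<open>8 * b * norm x * norm y\<close>; this is the source of \<open>1 / (8 * b)\<close>.\<close>

lemma kap_far_ge:
  fixes x y :: "real^'n::finite"
  assumes "x \<noteq> y" "0 < s" "2 \<le> b"
  shows "(1 / (8 * b)) powr ((real CARD('n) + 2 * s) / 2) * far b x y \<le> kap s x y"
proof -
  let ?m = "real CARD('n) + 2 * s"
  have *: "(1 / (8 * b)) powr (?m / 2) \<le> kap s x y"
    if xy: "x \<noteq> 0" "y \<noteq> 0" "b * norm x \<le> norm y" "norm y \<le> 2 * b * norm x" "x \<noteq> y" for x y :: "real^'n"
  proof -
    have "1 * norm x \<le> b * norm x" using assms by (intro mult_right_mono) auto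
    then have "norm (x - y) \<le> 2 * norm y" using xy norm_triangle_ineq4[of x y] by linarith
    then have "(norm (x - y))\<^sup>2 \<le> (2 * norm y)\<^sup>2" by (intro power_mono) auto
    also have "\<dots> \<le> 4 * (norm y * (2 * b * norm x))"
    proof -
      have "(2 * norm y)\<^sup>2 = 4 * (norm y * norm y)" by (simp add: power2_eq_square)
      then show ?thesis using mult_left_mono[OF xy(4) norm_ge_zero[of y]] by linarith
    qed
    finally have "1 / (8 * b) * (norm (x - y))\<^sup>2 \<le> norm x * norm y"
      using assms by (simp add: field_simps)
    then have "(1 / (8 * b) * (norm (x - y))\<^sup>2) powr (?m / 2) \<le> (norm x * norm y) powr (?m / 2)"
      using assms by (intro powr_mono2) auto
    moreover have "(1 / (8 * b) * (norm (x - y))\<^sup>2) powr (?m / 2) = (1 / (8 * b)) powr (?m / 2) * norm (x - y) powr ?m"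
      using power2_powr_half[of "norm (x - y)" ?m] xy by (simp only: powr_mult) simp
    ultimately show ?thesis
      using xy by (simp add: kap_def pos_le_divide_eq)
  qed
  show ?thesis
  proof (cases "far b x y = 0")
    case True
    then show ?thesis by (simp add: kap_def)
  next
    case False
    then have "far b x y = 1" "x \<noteq> 0" "y \<noteq> 0"
      "b * norm x \<le> norm y \<and> norm y \<le> 2 * b * norm x \<or> b * norm y \<le> norm x \<and> norm x \<le> 2 * b * norm y"
      by (auto simp: far_def split: if_splits)
    then show ?thesis
      using *[of x y] *[of y x] assms(1) invariant_kernel.sym[OF invariant_kernel_kap, of s x y] by auto
  qed
qed

lemma Qform_mono_kernel:
  assumes [measurable]: "h \<in> borel_measurable borel" and "invariant_kernel K" and c: "0 \<le> c"
    and le: "\<And>x y. x \<noteq> y \<Longrightarrow> c * K x y \<le> L x y"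
  shows "ennreal c * Qform g K h \<le> Qform g L h"
proof -
  interpret invariant_kernel K by fact
  let ?D = "\<lambda>x y. (tdiff g h x y)\<^sup>2"
  have "ennreal c * Qform g K h = (\<integral>\<^sup>+x. (\<integral>\<^sup>+y. ennreal c * ennreal (?D x y * K x y) \<partial>mu) \<partial>mu)"
    unfolding Qform_def by (rule nn_integral2_mu_cmult[symmetric]) measurable
  also have "\<dots> \<le> Qform g L h"
    unfolding Qform_def
  proof (rule nn_integral2_mu_mono)
    fix x y :: "real^'a" assume "x \<noteq> y"
    then have "?D x y * (c * K x y) \<le> ?D x y * L x y" by (intro mult_left_mono le) auto
    then have "ennreal (c * (?D x y * K x y)) \<le> ennreal (?D x y * L x y)"
      by (intro ennreal_leI) (simp only: mult_ac)
    then show "ennreal c * ennreal (?D x y * K x y) \<le> ennreal (?D x y * L x y)"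
      by (simp only: ennreal_mult'[OF c])
  qed
  finally show ?thesis .
qed

lemma weight_far_finite: "weight 0 (far 2 :: real^'n::finite \<Rightarrow> _) < \<infinity>"
proof -
  \<comment> \<open>On the support of \<open>far 2\<close> the ratio of the norms is at most 4 and
    the kernel is at most 1, so truncation at level 4 changes nothing.\<close>
  have "ktrunc 4 (far 2) = (far 2 :: real^'n \<Rightarrow> _)"
    by (intro ext) (auto simp: ktrunc_def far_def)
  then show ?thesis using weight_ktrunc_finite[of 0 4 "far 2 :: real^'n \<Rightarrow> _"] by simp
qed

lemma weight_far_pos: "0 < weight 0 (far 2 :: real^'n::finite \<Rightarrow> _)"
proof (rule ccontr)
  interpret far: invariant_kernel "far 2 :: real^'n \<Rightarrow> _" by (rule invariant_kernel_far)
  assume "\<not> 0 < weight 0 (far 2 :: real^'n \<Rightarrow> _)"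
  then have "AE y::real^'n in mu. ennreal ((norm y / norm (1::real^'n)) powr 0 * far 2 1 y) = 0"
    unfolding weight_def not_gr_zero by (subst (asm) nn_integral_0_iff_AE) measurable
  then have ae: "AE y::real^'n in lborel. ennreal ((norm y / norm (1::real^'n)) powr 0 * far 2 1 y) = 0"
    unfolding AE_mu_iff .
  have 1: "open ({y. norm y < 4 * norm (1::real^'n)} \<inter> {y. 2 * norm (1::real^'n) < norm y})"
    by (intro open_Int open_Collect_less continuous_intros)
  have 2: "3 *\<^sub>R (1::real^'n) \<in> {y. norm y < 4 * norm (1::real^'n)} \<inter> {y. 2 * norm (1::real^'n) < norm y}"
    by auto
  show False
    by (rule not_AE_lborel_notin_open[OF 1 2], rule eventually_mono[OF ae])
       (auto simp: far_def split: if_splits)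
qed

lemma Qform_zero: "Qform 0 K h = (\<integral>\<^sup>+x. (\<integral>\<^sup>+y. ennreal ((h x - h y)\<^sup>2 * K x y) \<partial>mu) \<partial>mu)"
  unfolding Qform_def by (rule nn_integral2_mu_cong) simp

text \<open>For odd \<open>h\<close> the reflection of \<open>y\<close> alone turns \<open>(h x - h y)\<^sup>2\<close> into \<open>(h x + h y)\<^sup>2\<close>
  without changing the kernel.\<close>

lemma Qform_far_odd:
  fixes h :: "real^'n::finite \<Rightarrow> real"
  assumes [measurable]: "h \<in> borel_measurable borel"
    and odd: "\<And>x. h (reflection a x) = - h x"
  shows "Qform 0 (far b) h = 2 * weight 0 (far b :: real^'n \<Rightarrow> _) * L2sq h"
proof -
  interpret far: invariant_kernel "far b :: real^'n \<Rightarrow> _" by (rule invariant_kernel_far)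
  let ?S = "\<integral>\<^sup>+x. (\<integral>\<^sup>+y. ennreal ((h x + h y)\<^sup>2 * far b x y) \<partial>mu) \<partial>mu"
  have "(\<integral>\<^sup>+y. ennreal ((h x - h y)\<^sup>2 * far b x y) \<partial>mu) = (\<integral>\<^sup>+y. ennreal ((h x + h y)\<^sup>2 * far b x y) \<partial>mu)" for x
  proof -
    have "(\<integral>\<^sup>+y. ennreal ((h x - h y)\<^sup>2 * far b x y) \<partial>mu) =
      (\<integral>\<^sup>+y. ennreal ((h x - h (reflection a y))\<^sup>2 * far b x (reflection a y)) \<partial>mu)"
      by (rule nn_integral_mu_reflection[symmetric]) measurable
    then show ?thesis by (simp add: odd far_def)
  qed
  then have eq: "Qform 0 (far b) h = ?S" unfolding Qform_zero by simp
  \<comment> \<open>The mixed terms cancel in this sum, and by \<open>eq\<close> it is twice the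
    form.\<close>
  have "Qform 0 (far b) h + ?S = (\<integral>\<^sup>+x. (\<integral>\<^sup>+y. ennreal ((h x - h y)\<^sup>2 * far b x y) + ennreal ((h x + h y)\<^sup>2 * far b x y) \<partial>mu) \<partial>mu)"
    unfolding Qform_zero by (subst nn_integral2_mu_add[symmetric]) auto
  also have "\<dots> = (\<integral>\<^sup>+x. (\<integral>\<^sup>+y. 2 * ennreal (((h x)\<^sup>2 * (norm y / norm x) powr 0
      + (h y)\<^sup>2 * (norm x / norm y) powr 0) * far b x y) \<partial>mu) \<partial>mu)"
  proof (rule nn_integral2_mu_cong)
    fix x y :: "real^'n" assume xy: "x \<noteq> 0" "y \<noteq> 0"
    have "(h x - h y)\<^sup>2 * far b x y + (h x + h y)\<^sup>2 * far b x y = 2 * (((h x)\<^sup>2 + (h y)\<^sup>2) * far b x y)"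
      by (simp add: power2_eq_square algebra_simps)
    then have "ennreal ((h x - h y)\<^sup>2 * far b x y) + ennreal ((h x + h y)\<^sup>2 * far b x y) =
       ennreal (2 * (((h x)\<^sup>2 + (h y)\<^sup>2) * far b x y))"
      by (metis far.nonneg ennreal_plus mult_nonneg_nonneg zero_le_power2)
    also have "\<dots> = 2 * ennreal (((h x)\<^sup>2 + (h y)\<^sup>2) * far b x y)"
      by (simp add: ennreal_mult')
    finally show "ennreal ((h x - h y)\<^sup>2 * far b x y) + ennreal ((h x + h y)\<^sup>2 * far b x y) =
       2 * ennreal (((h x)\<^sup>2 * (norm y / norm x) powr 0 + (h y)\<^sup>2 * (norm x / norm y) powr 0) * far b x y)"
      using xy by simp
  qed
  also have "\<dots> = 2 * (2 * weight 0 (far b :: real^'n \<Rightarrow> _) * L2sq h)"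
    unfolding far.weight_both[OF assms(1), symmetric]
    by (rule nn_integral2_mu_cmult) measurable
  finally have "2 * Qform 0 (far b) h = 2 * (2 * weight 0 (far b :: real^'n \<Rightarrow> _) * L2sq h)"
    using eq by (simp add: mult_2)
  then show ?thesis
    by (subst (asm) ennreal_mult_cancel_left) auto
qed

text \<open>\<open>kap\<close> dominates a multiple of \<open>far 2\<close>, whose form is an exact
  multiple of \<open>L2sq\<close> on odd functions. The constant depends neither on the mirror nor
  on the power weight, which makes the final range of exponents uniform in alpha.\<close>

lemma odd_gain:
  assumes s: "0 < s"
  shows "\<exists>c>0. \<forall>a. \<forall>h :: real^'n::finite \<Rightarrow> real.
    h \<in> borel_measurable borel \<longrightarrow> (\<forall>x. h (reflection a x) = - h x) \<longrightarrow>
    ennreal c * L2sq h \<le> Qform 0 (kap s) h"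
proof -
  obtain w where w: "weight 0 (far 2 :: real^'n \<Rightarrow> _) = ennreal w" "0 \<le> w"
    using weight_far_finite[where 'n = 'n] by (cases "weight 0 (far 2 :: real^'n \<Rightarrow> _)") auto
  have w0: "0 < w" using weight_far_pos[where 'n = 'n] w by auto
  define c0 where "c0 = (1 / (8 * 2) :: real) powr ((real CARD('n) + 2 * s) / 2)"
  have c0: "0 < c0" by (simp add: c0_def)
  show ?thesis
  proof (intro exI[of _ "c0 * (2 * w)"] conjI allI impI)
    fix a :: "real^'n" and h :: "real^'n \<Rightarrow> real" assume h: "h \<in> borel_measurable borel"
      and odd: "\<forall>x. h (reflection a x) = - h x"
    have "ennreal (c0 * (2 * w)) * L2sq h = ennreal c0 * Qform 0 (far 2) h"
      using c0 w0 Qform_far_odd[of h a 2] h odd w by (simp add: ennreal_mult mult.assoc)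
    also have "\<dots> \<le> Qform 0 (kap s) h"
      by (rule Qform_mono_kernel[OF h invariant_kernel_far])
         (use c0 kap_far_ge[OF _ s order_refl] in \<open>auto simp: c0_def\<close>)
    finally show "ennreal (c0 * (2 * w)) * L2sq h \<le> Qform 0 (kap s) h" .
  qed (use c0 w0 in auto)
qed

subsection \<open>A subcritical embedding\<close>

lemma powr_le_interpolate:
  fixes x t :: real
  assumes "0 < x" "0 \<le> t" "t \<le> 1"
  shows "x powr t \<le> (1 - t) + t * x"
proof -
  have "exp ((1 - t) *\<^sub>R 0 + t *\<^sub>R ln x) \<le> (1 - t) * exp 0 + t * exp (ln x)"
    using assms by (intro convex_onD[OF exp_convex]) auto
  then show ?thesis using assms by (simp add: powr_def)
qed

text \<open>An optimisation over a radius: \<open>t\<close> stands for \<open>(h x)^2\<close>,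
  \<open>a\<close> for the energy density at \<open>x\<close>, and the hypothesis arises by
  averaging over a ball of radius \<open>r * norm x\<close>. The two summands of \<open>C\<close>
  belong to the two cases of the proof.\<close>

lemma nash_real:
  fixes N s c1 c2 :: real
  assumes "0 < N" "0 < s" "0 < c1" "0 < c2"
  defines "C \<equiv> (4 * 2 powr N / c2) powr (2 * s / N) + (4 / c2) powr (1 + 2 * s / N) / c1"
  assumes "0 \<le> t" "0 \<le> a"
    and *: "\<And>r. 0 < r \<Longrightarrow> r \<le> 1/2 \<Longrightarrow> c2 * t * r powr N \<le> 2 + 2 * a * r powr (N + 2 * s) / c1"
  shows "t powr (1 + 2 * s / N) \<le> C * (t + a)"
proof -
  \<comment> \<open>The threshold at which the radius chosen below equals 1/2; for smaller
    \<open>t\<close> the first summand of \<open>C\<close> suffices.\<close>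
  define K where "K = 4 * 2 powr N / c2"
  have C: "C * (t + a) = K powr (2 * s / N) * t + (4 / c2) powr (1 + 2 * s / N) / c1 * a
     + (K powr (2 * s / N) * a + (4 / c2) powr (1 + 2 * s / N) / c1 * t)"
    by (simp add: C_def K_def algebra_simps add_divide_distrib)
  have nn: "0 \<le> K powr (2 * s / N) * a" "0 \<le> (4 / c2) powr (1 + 2 * s / N) / c1 * t"
    "0 \<le> K powr (2 * s / N) * t" "0 \<le> (4 / c2) powr (1 + 2 * s / N) / c1 * a"
    using assms by auto
  show ?thesis
  proof (cases "t < K")
    case True
    have "t powr (1 + 2 * s / N) = t * t powr (2 * s / N)"
      using assms by (cases "t = 0") (auto simp: powr_add)
    also have "\<dots> \<le> t * K powr (2 * s / N)"
      using True assms by (intro mult_left_mono powr_mono2) auto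
    finally show ?thesis using nn unfolding C by (simp add: mult.commute)
  next
    case False
    have K: "0 < K" using assms by (simp add: K_def)
    then have t: "0 < t" using False by linarith
    \<comment> \<open>Chosen so that the left side of \<open>*\<close> equals 4, which absorbs the
      constant 2 on the right.\<close>
    define r where "r = (4 / (c2 * t)) powr (1 / N)"
    have r: "0 < r" using assms t by (simp add: r_def)
    have rN: "r powr N = 4 / (c2 * t)" using assms t by (simp add: r_def powr_powr)
    have "4 / (c2 * t) \<le> (1/2) powr N"
    proof -
      have "4 * 2 powr N \<le> c2 * t" using False assms by (simp add: K_def field_simps)
      then show ?thesis using assms t by (simp add: powr_divide field_simps)
    qed
    then have "r \<le> ((1/2) powr N) powr (1 / N)"
      unfolding r_def using assms t by (intro powr_mono2) auto
    then have "r \<le> 1/2" using assms by (simp add: powr_powr)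
    from *[OF r this] have "2 \<le> 2 * a * r powr (N + 2 * s) / c1"
      using assms t by (simp add: rN)
    then have "c1 \<le> a * r powr (N + 2 * s)" using assms by (simp add: field_simps)
    also have "r powr (N + 2 * s) = (4 / c2) powr (1 + 2 * s / N) / t powr (1 + 2 * s / N)"
    proof -
      have "r powr (N + 2 * s) = (4 / (c2 * t)) powr (1 + 2 * s / N)"
        unfolding r_def powr_powr using assms by (simp add: field_simps)
      also have "4 / (c2 * t) = (4 / c2) / t" by simp
      finally show ?thesis using assms t by (simp only: powr_divide)
    qed
    finally have "t powr (1 + 2 * s / N) \<le> (4 / c2) powr (1 + 2 * s / N) / c1 * a"
      using assms t by (simp add: field_simps)
    then show ?thesis using nn unfolding C by linarith
  qed
qed

text \<open>For \<open>r <= 1/2\<close> every point of the ball has norm at most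
  \<open>3/2 * norm x\<close>; this bounds the density of \<open>mu\<close> from below and yields
  the factor \<open>2/3\<close>.\<close>

lemma mu_ball_ge:
  fixes x :: "real^'n::finite"
  assumes "x \<noteq> 0" "0 < r" "r \<le> 1/2"
  shows "ennreal ((2/3) powr real CARD('n) * unit_ball_vol (real CARD('n)) * r powr real CARD('n))
     \<le> emeasure mu (ball x (r * norm x))"
proof -
  let ?N = "real CARD('n)" and ?B = "ball x (r * norm x)"
  have "ennreal ((2/3) powr ?N * unit_ball_vol ?N * r powr ?N)
     = ennreal ((3/2 * norm x) powr - ?N) * emeasure lborel ?B"
  proof -
    have "emeasure lborel ?B = ennreal (unit_ball_vol ?N * (r * norm x) powr ?N)"
      using assms by (simp add: emeasure_ball powr_realpow)
    moreover have "(3/2 * norm x) powr - ?N * (unit_ball_vol ?N * (r * norm x) powr ?N) =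
       (2/3) powr ?N * unit_ball_vol ?N * r powr ?N"
    proof -
      have "(3/2 * norm x) powr - ?N * (r * norm x) powr ?N = ((r * norm x) / (3/2 * norm x)) powr ?N"
        by (simp only: powr_divide powr_minus_divide times_divide_eq_left mult_1_left)
      also have "(r * norm x) / (3/2 * norm x) = 2/3 * r" using assms by simp
      also have "(2/3 * r) powr ?N = (2/3) powr ?N * r powr ?N" using assms by (intro powr_mult)
      finally have "unit_ball_vol ?N * ((3/2 * norm x) powr - ?N * (r * norm x) powr ?N) =
        unit_ball_vol ?N * ((2/3) powr ?N * r powr ?N)"
        by (rule arg_cong)
      then show ?thesis by (simp only: mult_ac)
    qed
    ultimately show ?thesis by (metis ennreal_mult' powr_ge_zero)
  qed
  also have "\<dots> = (\<integral>\<^sup>+y. ennreal ((3/2 * norm x) powr - ?N) * indicator ?B y \<partial>lborel)"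
    by (subst nn_integral_cmult_indicator) auto
  also have "\<dots> \<le> (\<integral>\<^sup>+y. ennreal (norm y powr - ?N) * indicator ?B y \<partial>lborel)"
  proof (rule nn_integral_mono)
    fix y
    show "ennreal ((3/2 * norm x) powr - ?N) * indicator ?B y \<le> ennreal (norm y powr - ?N) * indicator ?B y"
    proof (cases "y \<in> ?B")
      case True
      then have d: "norm (x - y) < r * norm x" by (simp add: dist_norm)
      have "r * norm x \<le> 1/2 * norm x" using assms by (intro mult_right_mono) auto
      then have "norm (x - y) < 1/2 * norm x" using d by linarith
      then have "0 < norm y" "norm y \<le> 3/2 * norm x"
        using norm_triangle_ineq2[of x y] norm_triangle_ineq3[of x y] assms(1)
        by (auto simp: abs_le_iff)
      then have "(3/2 * norm x) powr - ?N \<le> norm y powr - ?N"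
        by (intro powr_mono2') auto
      then show ?thesis using True by (simp add: ennreal_leI)
    qed simp
  qed
  also have "\<dots> = emeasure mu ?B"
    unfolding mu_def by (subst emeasure_density) auto
  finally show ?thesis .
qed

text \<open>On the ball \<open>norm y >= norm x / 2\<close> while the distance is below
  \<open>r * norm x\<close>; all powers of \<open>norm x\<close> then cancel.\<close>

lemma kap_ball_ge:
  fixes x y :: "real^'n::finite"
  assumes "x \<noteq> 0" "0 < r" "r \<le> 1/2" "y \<in> ball x (r * norm x)" "x \<noteq> y" "0 < s"
  shows "(1/2) powr ((real CARD('n) + 2 * s) / 2) * r powr - (real CARD('n) + 2 * s) \<le> kap s x y"
proof -
  let ?m = "real CARD('n) + 2 * s"
  have d: "norm (x - y) < r * norm x" using assms by (simp add: dist_norm)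
  have "r * norm x \<le> 1/2 * norm x" using assms by (intro mult_right_mono) auto
  then have y: "1/2 * norm x \<le> norm y"
    using d norm_triangle_ineq2[of x y] by auto
  have "norm x * (1/2 * norm x) \<le> norm x * norm y"
    using y by (intro mult_left_mono) auto
  then have "(1/2 * (norm x)\<^sup>2) powr (?m/2) \<le> (norm x * norm y) powr (?m/2)"
    using assms by (intro powr_mono2) (auto simp: power2_eq_square)
  moreover have "(1/2 * (norm x)\<^sup>2) powr (?m/2) = (1/2) powr (?m/2) * norm x powr ?m"
  proof -
    have "((norm x)\<^sup>2) powr (?m/2) = norm x powr ?m"
      using assms by (intro power2_powr_half) auto
    then show ?thesis by (simp only: powr_mult)
  qed
  moreover have "norm (x - y) powr ?m \<le> (r * norm x) powr ?m"
    using d assms by (intro powr_mono2) auto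
  ultimately have "(1/2) powr (?m/2) * norm x powr ?m / (r * norm x) powr ?m \<le> kap s x y"
    unfolding kap_def using assms by (intro frac_le) auto
  moreover have cancel: "(1/2) powr k * norm x powr m / (r * norm x) powr m = (1/2) powr k * r powr - m"
    for k m :: real
    using assms by (simp add: powr_mult powr_minus field_simps)
  have "(1/2) powr (?m/2) * norm x powr ?m / (r * norm x) powr ?m = (1/2) powr (?m/2) * r powr - ?m"
    by (rule cancel)
  ultimately show ?thesis by simp
qed

lemma abs_powr_eq: "\<bar>a\<bar> powr (2 * q) = (a\<^sup>2) powr (q :: real)"
proof (cases "a = 0")
  case False
  then have "(\<bar>a\<bar>\<^sup>2) powr (2 * q / 2) = \<bar>a\<bar> powr (2 * q)"
    by (intro power2_powr_half) auto
  then show ?thesis by simp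
qed simp

text \<open>The comparison \<open>(h x)^2 / 2 <= (h x - h y)^2 + (h y)^2\<close> is averaged over a
  small ball around \<open>x\<close>: the kernel is large there, and \<open>L2sq h <= 1\<close>
  controls the last term. Optimising the radius separately at each \<open>x\<close> and then
  integrating gains integrability beyond the exponent 2.\<close>

lemma nash_inequality:
  assumes s: "0 < s"
  shows "\<exists>C>0. \<forall>h :: real^'n::finite \<Rightarrow> real. h \<in> borel_measurable borel \<longrightarrow> L2sq h \<le> 1 \<longrightarrow>
    (\<integral>\<^sup>+x. ennreal (\<bar>h x\<bar> powr (2 * (1 + 2 * s / real CARD('n)))) \<partial>mu)
      \<le> ennreal C * (L2sq h + Qform 0 (kap s) h)"
proof -
  define N where "N = real CARD('n)"
  define c1 where "c1 = (1/2 :: real) powr ((N + 2 * s) / 2)"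
  define c2 where "c2 = (2/3) powr N * unit_ball_vol N"
  define C where "C = (4 * 2 powr N / c2) powr (2 * s / N) + (4 / c2) powr (1 + 2 * s / N) / c1"
  have N: "0 < N" by (simp add: N_def)
  have c: "0 < c1" "0 < c2" using N by (auto simp: c1_def c2_def intro!: mult_pos_pos)
  have C: "0 < C" using c N unfolding C_def by (intro add_pos_pos divide_pos_pos) auto
  interpret kap: invariant_kernel "kap s :: real^'n \<Rightarrow> _" by (rule invariant_kernel_kap)
  show ?thesis
  proof (intro exI[of _ C] conjI allI impI C)
    fix h :: "real^'n \<Rightarrow> real" assume h [measurable]: "h \<in> borel_measurable borel" and L2: "L2sq h \<le> 1"
    let ?a = "\<lambda>x. \<integral>\<^sup>+y. ennreal ((h x - h y)\<^sup>2 * kap s x y) \<partial>mu"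
    have pt: "ennreal (\<bar>h x\<bar> powr (2 * (1 + 2 * s / N))) \<le> ennreal C * (ennreal ((h x)\<^sup>2) + ?a x)"
      if x: "x \<noteq> 0" for x
    proof (cases "?a x")
      case top
      then show ?thesis using C by (simp add: ennreal_mult_top)
    next
      case (real A)
      have "((h x)\<^sup>2) powr (1 + 2 * s / N) \<le> C * ((h x)\<^sup>2 + A)"
        unfolding C_def
      proof (rule nash_real[OF N s c])
        fix r :: real assume r: "0 < r" "r \<le> 1/2"
        let ?B = "ball x (r * norm x)"
        have w: "0 \<le> r powr (N + 2 * s) / c1" using c by simp
        have "ennreal ((h x)\<^sup>2 / 2) * ennreal (c2 * r powr N) \<le> ennreal ((h x)\<^sup>2 / 2) * emeasure mu ?B"
          using mu_ball_ge[OF x r] by (intro mult_left_mono) (auto simp: c2_def N_def)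
        also have "\<dots> = (\<integral>\<^sup>+y. ennreal ((h x)\<^sup>2 / 2) * indicator ?B y \<partial>mu)"
          by (subst nn_integral_cmult_indicator) auto
        also have "\<dots> \<le> (\<integral>\<^sup>+y. ennreal (r powr (N + 2 * s) / c1) * ennreal ((h x - h y)\<^sup>2 * kap s x y)
            + ennreal ((h y)\<^sup>2) \<partial>mu)"
        proof (rule nn_integral_mono_AE, use AE_mu_neq[of x] in eventually_elim)
          case (elim y)
          show ?case
          proof (cases "y \<in> ?B")
            case True
            have "c1 * r powr - (N + 2 * s) \<le> kap s x y"
              using kap_ball_ge[OF x r True _ s] elim by (auto simp: c1_def N_def)
            then have "c1 / r powr (N + 2 * s) \<le> kap s x y"
              by (simp only: powr_minus_divide times_divide_eq_right mult_1_right)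
            then have "1 \<le> r powr (N + 2 * s) / c1 * kap s x y"
              using c r by (simp add: field_simps)
            then have "(h x - h y)\<^sup>2 * 1 \<le> (h x - h y)\<^sup>2 * (r powr (N + 2 * s) / c1 * kap s x y)"
              by (intro mult_left_mono) auto
            moreover have "(h x)\<^sup>2 / 2 \<le> (h x - h y)\<^sup>2 + (h y)\<^sup>2"
            proof -
              have "0 \<le> (h x - 2 * h y)\<^sup>2" by simp
              then show ?thesis by (simp add: power2_eq_square algebra_simps)
            qed
            ultimately have "(h x)\<^sup>2 / 2 \<le> r powr (N + 2 * s) / c1 * ((h x - h y)\<^sup>2 * kap s x y) + (h y)\<^sup>2"
              by (simp add: mult_ac)
            then have "ennreal ((h x)\<^sup>2 / 2) \<le> ennreal (r powr (N + 2 * s) / c1 * ((h x - h y)\<^sup>2 * kap s x y) + (h y)\<^sup>2)"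
              by (rule ennreal_leI)
            also have "\<dots> = ennreal (r powr (N + 2 * s) / c1) * ennreal ((h x - h y)\<^sup>2 * kap s x y) + ennreal ((h y)\<^sup>2)"
              by (simp only: ennreal_plus[OF mult_nonneg_nonneg[OF w mult_nonneg_nonneg[OF zero_le_power2 kap.nonneg]] zero_le_power2]
                  ennreal_mult'[OF w])
            finally show ?thesis using True by simp
          qed simp
        qed
        also have "\<dots> = ennreal (r powr (N + 2 * s) / c1) * ennreal A + L2sq h"
          unfolding L2sq_def real(2)[symmetric]
          by (subst nn_integral_add) (auto simp: nn_integral_cmult)
        also have "\<dots> \<le> ennreal (r powr (N + 2 * s) / c1) * ennreal A + 1"
          using L2 by (intro add_left_mono)
        also have "\<dots> = ennreal (r powr (N + 2 * s) / c1 * A + 1)"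
          by (simp only: ennreal_plus[OF mult_nonneg_nonneg[OF w real(1)] zero_le_one] ennreal_mult'[OF w] ennreal_1)
        finally have "ennreal ((h x)\<^sup>2 / 2) * ennreal (c2 * r powr N) \<le> ennreal (r powr (N + 2 * s) / c1 * A + 1)" .
        moreover have "ennreal ((h x)\<^sup>2 / 2 * (c2 * r powr N)) = ennreal ((h x)\<^sup>2 / 2) * ennreal (c2 * r powr N)"
          by (rule ennreal_mult') simp
        moreover have "0 \<le> r powr (N + 2 * s) / c1 * A + 1"
          by (intro add_nonneg_nonneg mult_nonneg_nonneg w real(1)) simp
        ultimately have "(h x)\<^sup>2 / 2 * (c2 * r powr N) \<le> r powr (N + 2 * s) / c1 * A + 1"
          by (metis ennreal_le_iff)
        then show "c2 * (h x)\<^sup>2 * r powr N \<le> 2 + 2 * A * r powr (N + 2 * s) / c1"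
          by (simp add: mult_ac)
      qed (use real in auto)
      then have "ennreal (\<bar>h x\<bar> powr (2 * (1 + 2 * s / N))) \<le> ennreal (C * ((h x)\<^sup>2 + A))"
        unfolding abs_powr_eq by (rule ennreal_leI)
      also have "\<dots> = ennreal C * (ennreal ((h x)\<^sup>2) + ?a x)"
        using C real by (simp add: ennreal_mult')
      finally show ?thesis .
    qed
    have "(\<integral>\<^sup>+x. ennreal (\<bar>h x\<bar> powr (2 * (1 + 2 * s / N))) \<partial>mu) \<le> (\<integral>\<^sup>+x. ennreal C * (ennreal ((h x)\<^sup>2) + ?a x) \<partial>mu)"
      by (rule nn_integral_mono_AE, use AE_mu_nonzero in eventually_elim) (rule pt)
    also have "\<dots> = ennreal C * (L2sq h + Qform 0 (kap s) h)"
      unfolding L2sq_def Qform_zero by (simp add: nn_integral_cmult nn_integral_add)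
    finally show "(\<integral>\<^sup>+x. ennreal (\<bar>h x\<bar> powr (2 * (1 + 2 * s / real CARD('n)))) \<partial>mu)
      \<le> ennreal C * (L2sq h + Qform 0 (kap s) h)"
      by (simp add: N_def)
  qed
qed

definition Lpp :: "real \<Rightarrow> (real^'n::finite \<Rightarrow> real) \<Rightarrow> ennreal" where
  "Lpp p h = (\<integral>\<^sup>+x. ennreal (\<bar>h x\<bar> powr p) \<partial>mu)"

text \<open>Weighted AM-GM for \<open>abs a powr (p - 2)\<close>, a fractional power of
  \<open>abs a powr (q - 2)\<close>. The point is a coefficient that vanishes linearly at
  \<open>p = 2\<close>.\<close>

lemma abs_powr_interpolate:
  fixes a p q :: real
  assumes "2 \<le> p" "p \<le> q" "2 < q"
  shows "\<bar>a\<bar> powr p \<le> a\<^sup>2 + (p - 2) / (q - 2) * \<bar>a\<bar> powr q"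
proof (cases "a = 0")
  case False
  let ?t = "(p - 2) / (q - 2)"
  have t: "0 \<le> ?t" "?t \<le> 1" using assms by (auto simp: field_simps)
  have 2: "\<bar>a\<bar> powr 2 = a\<^sup>2" using False by (simp add: powr_numeral)
  have "\<bar>a\<bar> powr p = \<bar>a\<bar> powr (2 + (q - 2) * ?t)"
    using assms by simp
  also have "\<dots> = a\<^sup>2 * (\<bar>a\<bar> powr (q - 2)) powr ?t"
    by (simp only: powr_add powr_powr 2)
  also have "\<dots> \<le> a\<^sup>2 * ((1 - ?t) + ?t * \<bar>a\<bar> powr (q - 2))"
    using False t by (intro mult_left_mono powr_le_interpolate) auto
  also have "\<dots> \<le> a\<^sup>2 * (1 + ?t * \<bar>a\<bar> powr (q - 2))"
    using t by (intro mult_left_mono add_right_mono) auto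
  also have "\<dots> = a\<^sup>2 + ?t * (\<bar>a\<bar> powr (q - 2) * \<bar>a\<bar> powr 2)"
    unfolding 2 by (simp add: algebra_simps)
  also have "\<bar>a\<bar> powr (q - 2) * \<bar>a\<bar> powr 2 = \<bar>a\<bar> powr q"
    by (simp only: powr_add[symmetric]) simp
  finally show ?thesis .
qed simp

lemma Lpp_near_two:
  assumes s: "0 < s"
  shows "\<exists>C>0. \<exists>q>2. \<forall>p. \<forall>h :: real^'n::finite \<Rightarrow> real. 2 \<le> p \<longrightarrow> p \<le> q \<longrightarrow>
    h \<in> borel_measurable borel \<longrightarrow> L2sq h \<le> 1 \<longrightarrow>
    Lpp p h \<le> L2sq h + ennreal (C * (p - 2)) * (L2sq h + Qform 0 (kap s) h)"
proof -
  obtain C where C: "0 < C" and nash: "\<And>h :: real^'n::finite \<Rightarrow> real. h \<in> borel_measurable borel \<Longrightarrow> L2sq h \<le> 1 \<Longrightarrow>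
    Lpp (2 * (1 + 2 * s / real CARD('n))) h \<le> ennreal C * (L2sq h + Qform 0 (kap s) h)"
    using nash_inequality[OF s, where 'n = 'n] unfolding Lpp_def by blast
  define q where "q = 2 * (1 + 2 * s / real CARD('n))"
  have q: "2 < q" using s by (simp add: q_def)
  show ?thesis
  proof (rule exI[of _ "C / (q - 2)"], rule conjI[rotated], rule exI[of _ q], intro conjI allI impI)
    fix p and h :: "real^'n \<Rightarrow> real"
    assume p: "2 \<le> p" "p \<le> q" and [measurable]: "h \<in> borel_measurable borel" and L2: "L2sq h \<le> 1"
    define t where "t = (p - 2) / (q - 2)"
    have t: "0 \<le> t" using p q by (simp add: t_def)
    have "Lpp p h \<le> (\<integral>\<^sup>+x. ennreal ((h x)\<^sup>2) + ennreal t * ennreal (\<bar>h x\<bar> powr q) \<partial>mu)"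
      unfolding Lpp_def
    proof (rule nn_integral_mono)
      fix x
      have "ennreal (\<bar>h x\<bar> powr p) \<le> ennreal ((h x)\<^sup>2 + t * \<bar>h x\<bar> powr q)"
        unfolding t_def by (intro ennreal_leI abs_powr_interpolate p q)
      also have "\<dots> = ennreal ((h x)\<^sup>2) + ennreal t * ennreal (\<bar>h x\<bar> powr q)"
        using t by (subst ennreal_plus) (auto simp: ennreal_mult')
      finally show "ennreal (\<bar>h x\<bar> powr p) \<le> ennreal ((h x)\<^sup>2) + ennreal t * ennreal (\<bar>h x\<bar> powr q)" .
    qed
    also have "\<dots> = L2sq h + ennreal t * Lpp q h"
      unfolding L2sq_def Lpp_def by (simp add: nn_integral_add nn_integral_cmult)
    also have "\<dots> \<le> L2sq h + ennreal t * (ennreal C * (L2sq h + Qform 0 (kap s) h))"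
      using nash[of h] L2 by (intro add_left_mono mult_left_mono) (auto simp: q_def)
    also have "ennreal t * (ennreal C * (L2sq h + Qform 0 (kap s) h)) =
      ennreal (C / (q - 2) * (p - 2)) * (L2sq h + Qform 0 (kap s) h)"
      using t by (simp add: mult.assoc[symmetric] ennreal_mult'[symmetric]) (simp add: t_def mult.commute)
    finally show "Lpp p h \<le> L2sq h + ennreal (C / (q - 2) * (p - 2)) * (L2sq h + Qform 0 (kap s) h)" .
  qed (use C q in auto)
qed

subsection \<open>Uniform smoothness of the Lebesgue spaces\<close>

text \<open>\<open>F\<close> is the difference of the two sides and \<open>p * G\<close> its
  derivative. \<open>G\<close> increases because a power with exponent \<open>p - 2\<close> in
  [0, 1] is concave; this is where \<open>p <= 3\<close> enters.\<close>

lemma two_point_aux: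
  fixes p x :: real
  assumes p: "2 \<le> p" "p \<le> 3" and x: "0 \<le> x" "x \<le> 1"
  shows "(1 + x) powr p + (1 - x) powr p \<le> 2 + p * (p - 1) * x\<^sup>2"
proof -
  define G where "G x = 2 * (p - 1) * x - (1 + x) powr (p - 1) + (1 - x) powr (p - 1)" for x
  define F where "F x = 2 + p * (p - 1) * x\<^sup>2 - (1 + x) powr p - (1 - x) powr p" for x
  have G: "0 \<le> G y" if y: "0 \<le> y" "y < 1" for y
  proof -
    have "G 0 \<le> G y"
    proof (rule DERIV_nonneg_imp_nondecreasing[OF y(1)])
      fix z assume z: "0 \<le> z" "z \<le> y"
      have "(G has_real_derivative (2 * (p - 1) - (p - 1) * (1 + z) powr (p - 1 - 1) - (p - 1) * (1 - z) powr (p - 1 - 1))) (at z)"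
        unfolding G_def using z y
        by (auto intro!: derivative_eq_intros DERIV_fun_powr[THEN DERIV_cong])
      moreover have "0 \<le> 2 * (p - 1) - (p - 1) * (1 + z) powr (p - 1 - 1) - (p - 1) * (1 - z) powr (p - 1 - 1)"
      proof -
        have "(1 + z) powr (p - 2) \<le> (1 - (p - 2)) + (p - 2) * (1 + z)"
          "(1 - z) powr (p - 2) \<le> (1 - (p - 2)) + (p - 2) * (1 - z)"
          using powr_le_interpolate[of "1 + z" "p - 2"] powr_le_interpolate[of "1 - z" "p - 2"] p z y
          by auto
        then have "0 \<le> 2 - (1 + z) powr (p - 2) - (1 - z) powr (p - 2)"
          by (simp add: algebra_simps)
        then have "0 \<le> (p - 1) * (2 - (1 + z) powr (p - 2) - (1 - z) powr (p - 2))"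
          using p by simp
        then show ?thesis by (simp add: algebra_simps)
      qed
      ultimately show "\<exists>d. (G has_real_derivative d) (at z) \<and> 0 \<le> d" by blast
    qed
    then show ?thesis by (simp add: G_def)
  qed
  \<comment> \<open>At \<open>x = 1\<close> the base \<open>1 - x\<close> vanishes, so derivatives
    are taken inside the interval and continuity covers its ends.\<close>
  have "F 0 \<le> F x"
  proof (rule DERIV_nonneg_imp_increasing_open[OF x(1)])
    fix y assume y: "0 < y" "y < x"
    have "(F has_real_derivative p * G y) (at y)"
      unfolding F_def G_def using y x
      by (auto intro!: derivative_eq_intros DERIV_fun_powr[THEN DERIV_cong] simp: algebra_simps)
    moreover have "0 \<le> p * G y" using G[of y] y x p by auto
    ultimately show "\<exists>d. (F has_real_derivative d) (at y) \<and> 0 \<le> d" by blast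
  next
    show "continuous_on {0..x} F"
      unfolding F_def using x p by (intro continuous_intros continuous_on_powr') auto
  qed
  then show ?thesis by (simp add: F_def)
qed

text \<open>Bernoulli's inequality for real exponents, read off from AM-GM for
  \<open>(1 + y) powr r\<close> with exponent \<open>1 / r\<close>.\<close>

lemma one_plus_powr_ge:
  fixes r y :: real
  assumes "1 \<le> r" "0 \<le> y"
  shows "1 + r * y \<le> (1 + y) powr r"
proof -
  have "((1 + y) powr r) powr (1 / r) \<le> (1 - 1 / r) + 1 / r * (1 + y) powr r"
    using assms by (intro powr_le_interpolate) auto
  moreover have "((1 + y) powr r) powr (1 / r) = 1 + y"
    using assms by (simp add: powr_powr)
  ultimately have "r * y \<le> r * ((1 + y) powr r / r - 1 / r)"
    using assms by (intro mult_left_mono) auto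
  also have "\<dots> = (1 + y) powr r - 1"
    using assms by (simp add: right_diff_distrib)
  finally show ?thesis by simp
qed

lemma two_point_ordered:
  fixes a b p :: real
  assumes p: "2 \<le> p" "p \<le> 3" and ab: "0 \<le> b" "b \<le> a"
  shows "(a + b) powr p + (a - b) powr p \<le> 2 * (a\<^sup>2 + (p - 1) * b\<^sup>2) powr (p / 2)"
proof (cases "a = 0")
  case False
  define x where "x = b / a"
  have a: "0 < a" using ab False by auto
  have x: "0 \<le> x" "x \<le> 1" using a ab by (auto simp: x_def)
  have b: "b = a * x" using a by (simp add: x_def)
  have "(a + b) powr p + (a - b) powr p = a powr p * ((1 + x) powr p + (1 - x) powr p)"
  proof -
    have "a + b = a * (1 + x)" "a - b = a * (1 - x)" unfolding b by (auto simp: algebra_simps)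
    then show ?thesis by (simp only: powr_mult) (simp only: distrib_left)
  qed
  also have "\<dots> \<le> a powr p * (2 * (1 + p / 2 * ((p - 1) * x\<^sup>2)))"
    using two_point_aux[OF p x] by (intro mult_left_mono) (auto simp: algebra_simps)
  also have "\<dots> \<le> a powr p * (2 * (1 + (p - 1) * x\<^sup>2) powr (p / 2))"
    using p by (intro mult_left_mono one_plus_powr_ge) auto
  also have "\<dots> = 2 * (a\<^sup>2 + (p - 1) * b\<^sup>2) powr (p / 2)"
  proof -
    have "a\<^sup>2 + (p - 1) * b\<^sup>2 = a\<^sup>2 * (1 + (p - 1) * x\<^sup>2)"
      unfolding b by (simp add: algebra_simps)
    then have "(a\<^sup>2 + (p - 1) * b\<^sup>2) powr (p / 2) = (a\<^sup>2) powr (p / 2) * (1 + (p - 1) * x\<^sup>2) powr (p / 2)"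
      by (simp only: powr_mult)
    then show ?thesis using power2_powr_half[OF a, of p] by simp
  qed
  finally show ?thesis .
qed (use assms in simp)

text \<open>Both sides depend on absolute values only, which reduces to
  \<open>two_point_ordered\<close>. If \<open>b\<close> is the larger one, moving the factor
  \<open>p - 1 >= 1\<close> onto its square only increases the right side.\<close>

lemma two_point_inequality:
  fixes a b p :: real
  assumes p: "2 \<le> p" "p \<le> 3"
  shows "\<bar>a + b\<bar> powr p + \<bar>a - b\<bar> powr p \<le> 2 * (a\<^sup>2 + (p - 1) * b\<^sup>2) powr (p / 2)"
proof -
  have 1: "\<bar>a + b\<bar> powr p + \<bar>a - b\<bar> powr p = (\<bar>a\<bar> + \<bar>b\<bar>) powr p + \<bar>\<bar>a\<bar> - \<bar>b\<bar>\<bar> powr p"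
  proof (cases "0 \<le> a * b")
    case True
    then have "\<bar>a + b\<bar> = \<bar>a\<bar> + \<bar>b\<bar>" "\<bar>a - b\<bar> = \<bar>\<bar>a\<bar> - \<bar>b\<bar>\<bar>"
      by (auto simp: zero_le_mult_iff abs_if)
    then show ?thesis by simp
  next
    case False
    then have "\<bar>a - b\<bar> = \<bar>a\<bar> + \<bar>b\<bar>" "\<bar>a + b\<bar> = \<bar>\<bar>a\<bar> - \<bar>b\<bar>\<bar>"
      by (auto simp: not_le mult_less_0_iff abs_if)
    then show ?thesis by simp
  qed
  show ?thesis
  proof (cases "\<bar>b\<bar> \<le> \<bar>a\<bar>")
    case True
    then show ?thesis
      using two_point_ordered[OF p, of "\<bar>b\<bar>" "\<bar>a\<bar>"] unfolding 1 by simp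
  next
    case False
    then have "(\<bar>b\<bar> + \<bar>a\<bar>) powr p + (\<bar>b\<bar> - \<bar>a\<bar>) powr p \<le> 2 * (b\<^sup>2 + (p - 1) * a\<^sup>2) powr (p / 2)"
      using two_point_ordered[OF p, of "\<bar>a\<bar>" "\<bar>b\<bar>"] by simp
    also have "\<dots> \<le> 2 * (a\<^sup>2 + (p - 1) * b\<^sup>2) powr (p / 2)"
    proof -
      have "a\<^sup>2 \<le> b\<^sup>2" using False by (simp add: abs_le_square_iff[symmetric])
      then have "0 \<le> (p - 2) * (b\<^sup>2 - a\<^sup>2)" using p by simp
      then have "b\<^sup>2 + (p - 1) * a\<^sup>2 \<le> a\<^sup>2 + (p - 1) * b\<^sup>2" by (simp add: algebra_simps)
      then show ?thesis using p by (intro mult_left_mono powr_mono2) auto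
    qed
    finally show ?thesis using False unfolding 1 by (simp add: add.commute)
  qed
qed

text \<open>Convexity of the power at \<open>a + b = l * (a / l) + (1 - l) * (b / (1 - l))\<close>.
  The weight \<open>l\<close> stays free so that Minkowski's inequality can optimise it.\<close>

lemma powr_add_convex_bound:
  fixes a b r l :: real
  assumes r: "1 \<le> r" and ab: "0 \<le> a" "0 \<le> b" and l: "0 < l" "l < 1"
  shows "(a + b) powr r \<le> l powr (1 - r) * a powr r + (1 - l) powr (1 - r) * b powr r"
proof -
  have split: "l * (a / l) powr r = l powr (1 - r) * a powr r" if "0 < l" for a l :: real
    using that by (simp add: powr_divide powr_diff)
  have ge: "1 \<le> l powr (1 - r)" if "0 < l" "l < 1" for l :: real
    using powr_mono'[of "1 - r" 0 l] that r by simp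
  consider "a = 0" | "b = 0" | "0 < a" "0 < b" using ab by linarith
  then show ?thesis
  proof cases
    case 3
    have "((1 - (1 - l)) *\<^sub>R (a / l) + (1 - l) *\<^sub>R (b / (1 - l))) powr r \<le>
      (1 - (1 - l)) * (a / l) powr r + (1 - l) * (b / (1 - l)) powr r"
      using l 3 by (intro convex_onD[OF powr_convex[OF r]]) auto
    then show ?thesis using l split[of l a] split[of "1 - l" b] by simp
  next
    case 1
    then show ?thesis using ge[of "1 - l"] l mult_right_mono[of 1 "(1 - l) powr (1 - r)" "b powr r"] by simp
  next
    case 2
    then show ?thesis using ge[of l] l mult_right_mono[of 1 "l powr (1 - r)" "a powr r"] by simp
  qed
qed

lemma minkowski_powr:
  fixes f g :: "'a \<Rightarrow> real" and X Y r :: real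
  assumes [measurable]: "f \<in> borel_measurable M" "g \<in> borel_measurable M"
    and nn: "\<And>x. 0 \<le> f x" "\<And>x. 0 \<le> g x" and r: "1 \<le> r"
    and X: "(\<integral>\<^sup>+x. ennreal (f x powr r) \<partial>M) = ennreal X" "0 \<le> X"
    and Y: "(\<integral>\<^sup>+x. ennreal (g x powr r) \<partial>M) = ennreal Y" "0 \<le> Y"
  shows "(\<integral>\<^sup>+x. ennreal ((f x + g x) powr r) \<partial>M) \<le> ennreal ((X powr (1 / r) + Y powr (1 / r)) powr r)"
proof -
  have zero: "AE x in M. f x = 0" if "(\<integral>\<^sup>+x. ennreal (f x powr r) \<partial>M) = 0" "f \<in> borel_measurable M" for f :: "'a \<Rightarrow> real"
  proof -
    note that(2) [measurable]
    have "AE x in M. ennreal (f x powr r) = 0"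
      using that(1) by (subst (asm) nn_integral_0_iff_AE) auto
    then show ?thesis by eventually_elim (simp add: ennreal_eq_0_iff)
  qed
  have XX: "(X powr (1 / r)) powr r = X" "(Y powr (1 / r)) powr r = Y"
    using r X Y by (simp_all add: powr_powr)
  consider "X = 0" | "Y = 0" | "0 < X" "0 < Y" using X Y by linarith
  then show ?thesis
  proof cases
    case 1
    then have "AE x in M. f x = 0" using X by (intro zero) auto
    then have "(\<integral>\<^sup>+x. ennreal ((f x + g x) powr r) \<partial>M) = (\<integral>\<^sup>+x. ennreal (g x powr r) \<partial>M)"
      by (intro nn_integral_cong_AE) (auto elim!: eventually_mono)
    then show ?thesis using 1 Y XX by simp
  next
    case 2
    then have "AE x in M. g x = 0" using Y by (intro zero) auto
    then have "(\<integral>\<^sup>+x. ennreal ((f x + g x) powr r) \<partial>M) = (\<integral>\<^sup>+x. ennreal (f x powr r) \<partial>M)"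
      by (intro nn_integral_cong_AE) (auto elim!: eventually_mono)
    then show ?thesis using 2 X XX by simp
  next
    case 3
    define A B where "A = X powr (1 / r)" and "B = Y powr (1 / r)"
    have AB: "0 < A" "0 < B" using 3 by (auto simp: A_def B_def)
    have XA: "X = A powr r" and YB: "Y = B powr r" using XX by (simp_all add: A_def B_def)
    have scale: "(u / v) powr (1 - r) * u powr r = v powr (r - 1) * u" if "0 < u" "0 < v" for u v :: real
      using that by (simp add: powr_divide powr_diff field_simps)
    \<comment> \<open>The optimal weight: both terms turn into \<open>(A + B) powr (r - 1)\<close>
      times \<open>A\<close> or \<open>B\<close>, and their sum is an exact power.\<close>
    define l where "l = A / (A + B)"
    have l: "0 < l" "l < 1" "1 - l = B / (A + B)" using AB by (auto simp: l_def field_simps)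
    have "(\<integral>\<^sup>+x. ennreal ((f x + g x) powr r) \<partial>M) \<le>
      (\<integral>\<^sup>+x. ennreal (l powr (1 - r)) * ennreal (f x powr r) + ennreal ((1 - l) powr (1 - r)) * ennreal (g x powr r) \<partial>M)"
    proof (rule nn_integral_mono)
      fix x
      have "ennreal ((f x + g x) powr r) \<le> ennreal (l powr (1 - r) * f x powr r + (1 - l) powr (1 - r) * g x powr r)"
        by (intro ennreal_leI powr_add_convex_bound r nn l)
      then show "ennreal ((f x + g x) powr r) \<le> ennreal (l powr (1 - r)) * ennreal (f x powr r) + ennreal ((1 - l) powr (1 - r)) * ennreal (g x powr r)"
        by (simp add: ennreal_mult')
    qed
    also have "\<dots> = ennreal (l powr (1 - r)) * ennreal X + ennreal ((1 - l) powr (1 - r)) * ennreal Y"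
      unfolding X(1)[symmetric] Y(1)[symmetric] by (simp add: nn_integral_add nn_integral_cmult)
    also have "\<dots> = ennreal (l powr (1 - r) * X + (1 - l) powr (1 - r) * Y)"
      using X Y by (simp add: ennreal_mult')
    also have "l powr (1 - r) * X = (A + B) powr (r - 1) * A"
      unfolding l_def XA by (rule scale) (use AB in auto)
    also have "(1 - l) powr (1 - r) * Y = (A + B) powr (r - 1) * B"
      unfolding l(3) YB by (rule scale) (use AB in auto)
    also have "(A + B) powr (r - 1) * A + (A + B) powr (r - 1) * B = (A + B) powr r"
      using AB powr_add[of "A + B" "r - 1" 1] by (simp add: distrib_left)
    finally show ?thesis by (simp add: A_def B_def)
  qed
qed

text \<open>A two-point inequality combined with Minkowski's inequality in \<open>L\<^sup>p\<^sup>/\<^sup>2\<close>, after Ball, Carlen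
  and Lieb.\<close>

lemma Lp_uniform_smoothness:
  fixes m d :: "'a \<Rightarrow> real" and X Y Z p :: real
  assumes [measurable]: "m \<in> borel_measurable M" "d \<in> borel_measurable M" and p: "2 \<le> p" "p \<le> 3"
    and X: "(\<integral>\<^sup>+x. ennreal (\<bar>m x + d x\<bar> powr p) \<partial>M) = ennreal X"
      "(\<integral>\<^sup>+x. ennreal (\<bar>m x - d x\<bar> powr p) \<partial>M) = ennreal X" "0 \<le> X"
    and Y: "(\<integral>\<^sup>+x. ennreal (\<bar>m x\<bar> powr p) \<partial>M) = ennreal Y" "0 \<le> Y"
    and Z: "(\<integral>\<^sup>+x. ennreal (\<bar>d x\<bar> powr p) \<partial>M) = ennreal Z" "0 \<le> Z"
  shows "X powr (2 / p) \<le> Y powr (2 / p) + (p - 1) * Z powr (2 / p)"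
proof -
  have p0: "0 < p" using p by simp
  have eq: "2 * (p / 2) = p" by simp
  have "ennreal (2 * X) = ennreal X + ennreal X"
    using X by (simp flip: ennreal_plus)
  also have "\<dots> = (\<integral>\<^sup>+x. ennreal (\<bar>m x + d x\<bar> powr p) + ennreal (\<bar>m x - d x\<bar> powr p) \<partial>M)"
    by (subst nn_integral_add) (simp_all add: X(1,2))
  also have "\<dots> \<le> (\<integral>\<^sup>+x. ennreal 2 * ennreal (((m x)\<^sup>2 + (p - 1) * (d x)\<^sup>2) powr (p / 2)) \<partial>M)"
  proof (rule nn_integral_mono)
    fix x
    have "ennreal (\<bar>m x + d x\<bar> powr p + \<bar>m x - d x\<bar> powr p) \<le> ennreal (2 * ((m x)\<^sup>2 + (p - 1) * (d x)\<^sup>2) powr (p / 2))"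
      by (intro ennreal_leI two_point_inequality p)
    then show "ennreal (\<bar>m x + d x\<bar> powr p) + ennreal (\<bar>m x - d x\<bar> powr p) \<le> ennreal 2 * ennreal (((m x)\<^sup>2 + (p - 1) * (d x)\<^sup>2) powr (p / 2))"
      by (subst ennreal_mult'[symmetric]) simp_all
  qed
  also have "\<dots> = ennreal 2 * (\<integral>\<^sup>+x. ennreal (((m x)\<^sup>2 + (p - 1) * (d x)\<^sup>2) powr (p / 2)) \<partial>M)"
    by (rule nn_integral_cmult) measurable
  also have "\<dots> \<le> ennreal 2 * ennreal ((Y powr (1 / (p / 2)) + ((p - 1) powr (p / 2) * Z) powr (1 / (p / 2))) powr (p / 2))"
  proof (intro mult_left_mono minkowski_powr)
    show "(\<integral>\<^sup>+x. ennreal ((m x)\<^sup>2 powr (p / 2)) \<partial>M) = ennreal Y"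
      using Y(1) by (simp only: abs_powr_eq[symmetric] eq)
    have "(\<integral>\<^sup>+x. ennreal (((p - 1) * (d x)\<^sup>2) powr (p / 2)) \<partial>M) =
       (\<integral>\<^sup>+x. ennreal ((p - 1) powr (p / 2)) * ennreal (\<bar>d x\<bar> powr p) \<partial>M)"
    proof (rule nn_integral_cong)
      fix x
      have "((p - 1) * (d x)\<^sup>2) powr (p / 2) = (p - 1) powr (p / 2) * \<bar>d x\<bar> powr p"
        using abs_powr_eq[of "d x" "p / 2"] by (simp add: powr_mult)
      then show "ennreal (((p - 1) * (d x)\<^sup>2) powr (p / 2)) = ennreal ((p - 1) powr (p / 2)) * ennreal (\<bar>d x\<bar> powr p)"
        by (simp add: ennreal_mult')
    qed
    also have "\<dots> = ennreal ((p - 1) powr (p / 2)) * ennreal Z"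
      unfolding Z(1)[symmetric] by (rule nn_integral_cmult) measurable
    finally show "(\<integral>\<^sup>+x. ennreal (((p - 1) * (d x)\<^sup>2) powr (p / 2)) \<partial>M) = ennreal ((p - 1) powr (p / 2) * Z)"
      using Z by (simp add: ennreal_mult')
  qed (use p Y Z in auto)
  also have "\<dots> = ennreal (2 * (Y powr (2 / p) + ((p - 1) powr (p / 2) * Z) powr (2 / p)) powr (p / 2))"
    by (subst ennreal_mult'[symmetric]) simp_all
  finally have "2 * X \<le> 2 * (Y powr (2 / p) + ((p - 1) powr (p / 2) * Z) powr (2 / p)) powr (p / 2)"
    by (subst (asm) ennreal_le_iff) simp_all
  then have "X powr (2 / p) \<le> ((Y powr (2 / p) + ((p - 1) powr (p / 2) * Z) powr (2 / p)) powr (p / 2)) powr (2 / p)"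
    using X p by (intro powr_mono2) auto
  also have "\<dots> = Y powr (2 / p) + ((p - 1) powr (p / 2) * Z) powr (2 / p)"
    using p by (simp add: powr_powr)
  also have "((p - 1) powr (p / 2) * Z) powr (2 / p) = (p - 1) * Z powr (2 / p)"
    using p by (simp add: powr_mult powr_powr)
  finally show ?thesis .
qed

subsection \<open>Test functions\<close>

lemma C_k_SucI:
  assumes "\<And>x. (f has_derivative F x) (at x)" "\<And>v. C_k k (\<lambda>x. F x v)"
  shows "C_k (Suc k) f"
proof -
  have "frechet_derivative f (at x) = F x" for x
    using frechet_derivative_at[OF assms(1)] by simp
  then show ?thesis using assms by (auto simp: differentiable_def)
qed

lemma C_k_SucD:
  assumes "C_k (Suc k) f"
  shows "(f has_derivative frechet_derivative f (at x)) (at x)"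
    and "C_k k (\<lambda>x. frechet_derivative f (at x) v)"
  using assms by (auto simp: frechet_derivative_works)

lemma C_k_add: "C_k k f \<Longrightarrow> C_k k g \<Longrightarrow> C_k k (\<lambda>x. f x + g x)"
proof (induction k arbitrary: f g)
  case 0
  then show ?case by (simp add: continuous_on_add)
next
  case (Suc k)
  show ?case
    by (rule C_k_SucI[OF has_derivative_add[OF C_k_SucD(1)[OF Suc.prems(1)] C_k_SucD(1)[OF Suc.prems(2)]]])
       (intro Suc.IH C_k_SucD(2)[OF Suc.prems(1)] C_k_SucD(2)[OF Suc.prems(2)])
qed

lemma C_k_cmult: "C_k k f \<Longrightarrow> C_k k (\<lambda>x. c * f x)"
proof (induction k arbitrary: f)
  case 0
  then show ?case by (simp add: continuous_on_mult)
next
  case (Suc k)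
  show ?case
    by (rule C_k_SucI[OF has_derivative_mult_right[OF C_k_SucD(1)[OF Suc.prems]]])
       (intro Suc.IH C_k_SucD(2)[OF Suc.prems])
qed

lemma C_k_compose_linear:
  assumes L: "linear L"
  shows "C_k k f \<Longrightarrow> C_k k (\<lambda>x. f (L x))"
proof (induction k arbitrary: f)
  case 0
  have "continuous_on UNIV L" using L by (simp add: linear_continuous_on linear_linear)
  then show ?case
    using 0 continuous_on_compose2[of UNIV f UNIV L] by simp
next
  case (Suc k)
  have "(L has_derivative L) (at x)" for x
    using L by (simp add: linear_imp_has_derivative)
  then have "((\<lambda>x. f (L x)) has_derivative (\<lambda>v. frechet_derivative f (at (L x)) (L v))) (at x)" for x
    by (rule has_derivative_compose[OF _ C_k_SucD(1)[OF Suc.prems]])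
  then show ?case
    by (rule C_k_SucI) (rule Suc.IH, rule C_k_SucD(2)[OF Suc.prems])
qed

lemma test_functionsD:
  assumes "f \<in> test_functions"
  shows "continuous_on UNIV f" "\<exists>B. \<forall>x. f x \<noteq> 0 \<longrightarrow> norm x \<le> B" "f \<in> borel_measurable borel"
    "\<exists>M. \<forall>x. \<bar>f x\<bar> \<le> M"
proof -
  show c: "continuous_on UNIV f"
    using assms by (auto simp: test_functions_def dest: spec[of _ 0])
  then show "f \<in> borel_measurable borel" by (rule borel_measurable_continuous_onI)
  have "bounded {x. f x \<noteq> 0}" using assms by (simp add: test_functions_def compact_closure)
  then show "\<exists>B. \<forall>x. f x \<noteq> 0 \<longrightarrow> norm x \<le> B" by (auto simp: bounded_iff)
  have "compact (f ` closure {x. f x \<noteq> 0})"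
    using assms by (intro compact_continuous_image[OF continuous_on_subset[OF c]]) (auto simp: test_functions_def)
  from compact_imp_bounded[OF this] have "\<exists>M. \<forall>y \<in> f ` closure {x. f x \<noteq> 0}. norm y \<le> M"
    by (simp only: bounded_iff)
  then obtain M where M: "\<forall>y \<in> f ` closure {x. f x \<noteq> 0}. norm y \<le> M" ..
  have "\<bar>f x\<bar> \<le> max M 0" for x
  proof (cases "f x = 0")
    case False
    then have "x \<in> closure {x. f x \<noteq> 0}" by (intro closure_subset[THEN subsetD]) simp
    then have "norm (f x) \<le> M" by (intro M[rule_format] imageI)
    then show ?thesis by simp
  qed simp
  then show "\<exists>M. \<forall>x. \<bar>f x\<bar> \<le> M" by blast
qed

lemma test_functionsI:
  assumes "\<And>k. C_k k f" "\<And>x. f x \<noteq> 0 \<Longrightarrow> norm x \<le> B"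
  shows "f \<in> test_functions"
  using assms by (auto simp: test_functions_def compact_closure bounded_iff)

lemma test_functions_add:
  assumes "f \<in> test_functions" "g \<in> test_functions"
  shows "(\<lambda>x. f x + g x) \<in> test_functions"
proof -
  obtain B B' where "\<forall>x. f x \<noteq> 0 \<longrightarrow> norm x \<le> B" "\<forall>x. g x \<noteq> 0 \<longrightarrow> norm x \<le> B'"
    using assms by (meson test_functionsD(2))
  then have "norm x \<le> max B B'" if "f x + g x \<noteq> 0" for x
    using that by (cases "f x = 0") (auto intro: max.coboundedI1 max.coboundedI2)
  moreover have "C_k k (\<lambda>x. f x + g x)" for k
    using assms by (intro C_k_add) (auto simp: test_functions_def)
  ultimately show ?thesis by (intro test_functionsI)
qed

lemma test_functions_cmult:
  assumes "f \<in> test_functions"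
  shows "(\<lambda>x. c * f x) \<in> test_functions"
proof -
  obtain B where B: "\<forall>x. f x \<noteq> 0 \<longrightarrow> norm x \<le> B"
    using test_functionsD(2)[OF assms] by blast
  then have "norm x \<le> B" if "c * f x \<noteq> 0" for x
    using that by simp
  moreover have "C_k k (\<lambda>x. c * f x)" for k
    using assms by (intro C_k_cmult) (auto simp: test_functions_def)
  ultimately show ?thesis by (intro test_functionsI)
qed

lemma test_functions_diff:
  assumes "f \<in> test_functions" "g \<in> test_functions"
  shows "(\<lambda>x. f x - g x) \<in> test_functions"
  using test_functions_add[OF assms(1) test_functions_cmult[OF assms(2), of "-1"]] by simp

lemma test_functions_reflection:
  assumes "f \<in> test_functions"
  shows "(\<lambda>x. f (reflection a x)) \<in> test_functions"
proof -
  obtain B where B: "\<forall>x. f x \<noteq> 0 \<longrightarrow> norm x \<le> B"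
    using test_functionsD(2)[OF assms] by blast
  have "norm x \<le> B" if "f (reflection a x) \<noteq> 0" for x
    using B[rule_format, OF that] by simp
  moreover have "C_k k (\<lambda>x. f (reflection a x))" for k
    using assms by (intro C_k_compose_linear[OF linear_reflection]) (auto simp: test_functions_def)
  ultimately show ?thesis by (intro test_functionsI)
qed

section \<open>A smooth cutoff in the variable ln |x|\<close>

definition bump :: "nat \<Rightarrow> real \<Rightarrow> real" where
  "bump m t = (if 0 < t then (1 / t) ^ m * exp (- (1 / t)) else 0)"

lemma power_le_exp: "0 \<le> y \<Longrightarrow> (y::real) ^ k \<le> real k ^ k * exp y"
proof (cases "k = 0")
  case False
  assume y: "0 \<le> y"
  have "y / real k \<le> exp (y / real k)"
    using exp_ge_add_one_self[of "y / real k"] by linarith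
  then have "(y / real k) ^ k \<le> exp (y / real k) ^ k"
    using y by (intro power_mono) auto
  also have "\<dots> = exp y" using False by (simp flip: exp_of_nat_mult)
  finally show ?thesis using False by (simp add: power_divide field_simps)
qed simp

text \<open>\<open>bump 0\<close> is the usual \<open>exp (- 1 / t)\<close>, and the powers of
  \<open>1 / t\<close> arise from its derivatives. The difference quotient of \<open>bump m\<close>
  at 0 is \<open>bump (Suc m)\<close>; this bound, obtained from \<open>power_le_exp\<close> with
  one spare power of \<open>1 / t\<close>, sends it to 0.\<close>

lemma bump_le: "\<bar>bump (Suc m) t\<bar> \<le> real (m + 2) ^ (m + 2) * \<bar>t\<bar>"
proof (cases "0 < t")
  case True
  have "(1 / t) ^ (m + 2) \<le> real (m + 2) ^ (m + 2) * exp (1 / t)"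
    using True by (intro power_le_exp) auto
  then have "(1 / t) ^ (m + 2) * exp (- (1 / t)) \<le> real (m + 2) ^ (m + 2)"
    by (simp only: exp_minus divide_inverse[symmetric] pos_divide_le_eq[OF exp_gt_zero])
  then have "t * ((1 / t) ^ (m + 2) * exp (- (1 / t))) \<le> t * (real (m + 2) ^ (m + 2))"
    using True by (intro mult_left_mono) auto
  moreover have "t * ((1 / t) ^ (m + 2) * exp (- (1 / t))) = bump (Suc m) t"
    using True by (simp add: bump_def)
  moreover have "0 \<le> bump (Suc m) t" by (simp add: bump_def)
  ultimately show ?thesis using True by (simp add: mult.commute)
next
  case False
  then have "\<bar>bump (Suc m) t\<bar> = 0" by (simp add: bump_def)
  then show ?thesis
    by (simp only:) (intro mult_nonneg_nonneg zero_le_power abs_ge_zero of_nat_0_le_iff)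
qed

lemma DERIV_bump: "(bump m has_real_derivative (- real m * bump (m + 1) t + bump (m + 2) t)) (at t)"
proof -
  consider "0 < t" | "t < 0" | "t = 0" by linarith
  then show ?thesis
  proof cases
    case 1
    have "((\<lambda>t. (1 / t) ^ m * exp (- (1 / t))) has_real_derivative
       (- real m * bump (m + 1) t + bump (m + 2) t)) (at t)"
    proof -
      have i: "((\<lambda>t. 1 / t) has_real_derivative - ((1 / t)\<^sup>2)) (at t)"
        using 1 by (auto intro!: derivative_eq_intros simp: power2_eq_square)
      define a where "a = 1 / t"
      have *: "bump k t = a ^ k * exp (- a)" for k using 1 by (simp add: bump_def a_def)
      show ?thesis
        by (rule DERIV_cong[OF DERIV_mult[OF DERIV_power[OF i] DERIV_chain2[OF DERIV_exp DERIV_minus[OF i]]]])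
           (unfold * a_def[symmetric], cases m, simp_all add: algebra_simps power2_eq_square)
    qed
    then show ?thesis
      by (rule has_field_derivative_transform_within_open[of _ _ _ "{0<..}"]) (use 1 in \<open>auto simp: bump_def\<close>)
  next
    case 2
    have "((\<lambda>t. 0) has_real_derivative (- real m * bump (m + 1) t + bump (m + 2) t)) (at t)"
      using 2 by (simp add: bump_def)
    then show ?thesis
      by (rule has_field_derivative_transform_within_open[of _ _ _ "{..<0}"]) (use 2 in \<open>auto simp: bump_def\<close>)
  next
    case 3
    have "((\<lambda>h. bump (Suc m) h) \<longlongrightarrow> 0) (at 0)"
    proof (rule Lim_null_comparison)
      show "((\<lambda>h. real (m + 2) ^ (m + 2) * \<bar>h\<bar>) \<longlongrightarrow> 0) (at 0)"
        by (auto intro!: tendsto_eq_intros)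
      show "\<forall>\<^sub>F h in at 0. norm (bump (Suc m) h) \<le> real (m + 2) ^ (m + 2) * \<bar>h\<bar>"
        using bump_le by (intro always_eventually) auto
    qed
    moreover have "(bump m (0 + h) - bump m 0) / h = bump (Suc m) h" for h
      by (auto simp: bump_def)
    ultimately have "(bump m has_real_derivative 0) (at 0)"
      by (simp add: DERIV_def)
    then show ?thesis using 3 by (simp add: bump_def)
  qed
qed

text \<open>The building blocks of \<open>|x|\<^sup>c \<chi>(ln |x|)\<close> generate a class that is closed under directional
  derivatives away from the origin.\<close>

inductive radial_smooth :: "(real^'n::finite \<Rightarrow> real) \<Rightarrow> bool" where
  const: "radial_smooth (\<lambda>x. c)"
| inner: "radial_smooth (\<lambda>x. x \<bullet> v)"
| power: "radial_smooth (\<lambda>x. (x \<bullet> x) powr c)"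
| bump: "radial_smooth (\<lambda>x. bump m (a + d * ln (x \<bullet> x)))"
| add: "radial_smooth f \<Longrightarrow> radial_smooth g \<Longrightarrow> radial_smooth (\<lambda>x. f x + g x)"
| mult: "radial_smooth f \<Longrightarrow> radial_smooth g \<Longrightarrow> radial_smooth (\<lambda>x. f x * g x)"

lemma has_derivative_inner_self:
  "((\<lambda>x. x \<bullet> x) has_derivative (\<lambda>v. 2 * (x \<bullet> v))) (at (x::'a::real_inner))"
  by (auto intro!: derivative_eq_intros simp: inner_commute)

lemma radial_smooth_derivative:
  "radial_smooth f \<Longrightarrow> \<exists>F. (\<forall>x. x \<noteq> 0 \<longrightarrow> (f has_derivative F x) (at x)) \<and> (\<forall>v. radial_smooth (\<lambda>x. F x v))"
proof (induction rule: radial_smooth.induct)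
  case (const c)
  show ?case
    by (rule exI[of _ "\<lambda>x v. 0"]) (auto intro: radial_smooth.const)
next
  case (inner w)
  show ?case
    by (rule exI[of _ "\<lambda>x v. v \<bullet> w"]) (auto intro!: radial_smooth.const derivative_eq_intros)
next
  case (power c)
  have "((\<lambda>x. (x \<bullet> x) powr c) has_derivative (\<lambda>v. c * (x \<bullet> x) powr (c - 1) * (2 * (x \<bullet> v)))) (at x)"
    if "x \<noteq> 0" for x :: "real^'n"
    using DERIV_compose_FDERIV[OF has_real_derivative_powr has_derivative_inner_self, of x c] that
    by (simp add: mult_ac)
  then show ?case
    by (intro exI[of _ "\<lambda>x v. c * (x \<bullet> x) powr (c - 1) * (2 * (x \<bullet> v))"] conjI allI impI)
       (auto intro!: radial_smooth.intros)
next
  case (bump m a d)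
  let ?D = "\<lambda>x. - real m * bump (m + 1) (a + d * ln (x \<bullet> x)) + bump (m + 2) (a + d * ln (x \<bullet> x))"
  have "((\<lambda>x. bump m (a + d * ln (x \<bullet> x))) has_derivative (\<lambda>v. ?D x * (d * ((x \<bullet> x) powr (-1) * (2 * (x \<bullet> v)))))) (at x)"
    if "x \<noteq> 0" for x :: "real^'n"
  proof -
    have "((\<lambda>t. a + d * ln t) has_real_derivative d * (x \<bullet> x) powr (-1)) (at (x \<bullet> x))"
      using that by (auto intro!: derivative_eq_intros simp: powr_minus divide_inverse)
    from DERIV_compose_FDERIV[OF DERIV_chain2[OF DERIV_bump this] has_derivative_inner_self]
    show ?thesis by (simp add: mult_ac)
  qed
  moreover have "radial_smooth (\<lambda>x. ?D x * (d * ((x \<bullet> x) powr (-1) * (2 * (x \<bullet> v)))))" for v :: "real^'n"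
    by (intro radial_smooth.intros)
  ultimately show ?case
    by (intro exI[of _ "\<lambda>x v. ?D x * (d * ((x \<bullet> x) powr (-1) * (2 * (x \<bullet> v))))"]) blast
next
  case (add f g)
  then obtain F G where "\<And>x. x \<noteq> 0 \<Longrightarrow> (f has_derivative F x) (at x)" "\<And>v. radial_smooth (\<lambda>x. F x v)"
    "\<And>x. x \<noteq> 0 \<Longrightarrow> (g has_derivative G x) (at x)" "\<And>v. radial_smooth (\<lambda>x. G x v)" by blast
  then show ?case
    by (intro exI[of _ "\<lambda>x v. F x v + G x v"] conjI allI impI has_derivative_add radial_smooth.add) auto
next
  case (mult f g)
  then obtain F G where "\<And>x. x \<noteq> 0 \<Longrightarrow> (f has_derivative F x) (at x)" "\<And>v. radial_smooth (\<lambda>x. F x v)"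
    "\<And>x. x \<noteq> 0 \<Longrightarrow> (g has_derivative G x) (at x)" "\<And>v. radial_smooth (\<lambda>x. G x v)" by blast
  then show ?case
    by (intro exI[of _ "\<lambda>x v. f x * G x v + F x v * g x"] conjI allI impI has_derivative_mult
         radial_smooth.add radial_smooth.mult mult) auto
qed

text \<open>The class \<open>radial_smooth\<close> controls derivatives off the origin only;
  vanishing near the origin bridges the gap. Both properties pass to directional derivatives, so the
  induction on \<open>k\<close> closes.\<close>

lemma C_k_radial_smooth:
  assumes "0 < r"
  shows "radial_smooth h \<Longrightarrow> (\<And>x. x \<noteq> 0 \<Longrightarrow> f x = h x) \<Longrightarrow> (\<And>x. norm x < r \<Longrightarrow> f x = 0) \<Longrightarrow> C_k k f"
proof (induction k arbitrary: f h)
  case (0 f h)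
  obtain F where F: "\<And>x. x \<noteq> 0 \<Longrightarrow> (h has_derivative F x) (at x)"
    using radial_smooth_derivative[OF 0(1)] by blast
  have "isCont f x" for x
  proof (cases "x = 0")
    case True
    have "isCont (\<lambda>x. 0 :: real) x" by simp
    moreover have "\<forall>\<^sub>F y in nhds x. f y = 0"
      unfolding eventually_nhds using True 0(3) assms by (intro exI[of _ "ball 0 r"]) auto
    ultimately show ?thesis using isCont_cong by fastforce
  next
    case False
    have "isCont h x" using F[OF False] has_derivative_continuous by blast
    moreover have "\<forall>\<^sub>F y in nhds x. f y = h y"
      unfolding eventually_nhds using False 0(2) by (intro exI[of _ "- {0}"]) auto
    ultimately show ?thesis using isCont_cong by fastforce
  qed
  then show ?case by (simp add: continuous_at_imp_continuous_on)
next
  case (Suc k)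
  obtain F where F: "\<And>x. x \<noteq> 0 \<Longrightarrow> (h has_derivative F x) (at x)" and FS: "\<And>v. radial_smooth (\<lambda>x. F x v)"
    using radial_smooth_derivative[OF Suc.prems(1)] by blast
  define G where "G x = (if x = 0 then (\<lambda>v. 0) else F x)" for x
  have near: "(f has_derivative (\<lambda>v. 0)) (at x)" if "norm x < r" for x
    by (rule has_derivative_transform_within_open[of "\<lambda>x. 0" _ _ _ "ball 0 r"])
       (use that Suc.prems(3) in auto)
  have away: "(f has_derivative F x) (at x)" if "x \<noteq> 0" for x
    by (rule has_derivative_transform_within_open[OF F[OF that], of "- {0}"])
       (use that Suc.prems(2) in auto)
  have G: "(f has_derivative G x) (at x)" for x
    using near[of x] away[of x] assms by (auto simp: G_def)
  show ?case
  proof (rule C_k_SucI[OF G])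
    fix v
    show "C_k k (\<lambda>x. G x v)"
    proof (rule Suc.IH[OF FS[of v]])
      show "G x v = F x v" if "x \<noteq> 0" for x using that by (simp add: G_def)
      show "G x v = 0" if "norm x < r" for x
        using has_derivative_unique[OF G near[OF that]] by simp
    qed
  qed
qed

text \<open>A bump in \<open>ln |x| / T\<close> supported on [-1, 1], hence slowly varying for large
  \<open>T\<close>. Writing \<open>ln (x \<bullet> x) / 2\<close> for \<open>ln |x|\<close> builds
  it literally from generators of \<open>radial_smooth\<close>.\<close>

definition cutoff :: "real \<Rightarrow> real^'n::finite \<Rightarrow> real" where
  "cutoff T x = bump 0 (1 + 1 / (2 * T) * ln (x \<bullet> x)) * bump 0 (1 + - 1 / (2 * T) * ln (x \<bullet> x))"

lemma ln_inner_self: "x \<noteq> 0 \<Longrightarrow> ln (x \<bullet> x) = 2 * ln (norm x)"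
  by (simp add: dot_square_norm ln_realpow)

lemma cutoff_eq:
  assumes "x \<noteq> 0" "0 < T"
  shows "cutoff T x = bump 0 (1 + ln (norm x) / T) * bump 0 (1 - ln (norm x) / T)"
  using assms by (simp add: cutoff_def ln_inner_self)

lemma cutoff_support:
  assumes "x \<noteq> 0" "0 < T" "cutoff T x \<noteq> 0"
  shows "exp (- T) < norm x" "norm x < exp T"
proof -
  have "\<bar>ln (norm x)\<bar> < T"
    using assms by (auto simp: cutoff_eq bump_def abs_less_iff field_simps split: if_splits)
  then have "- T < ln (norm x)" "ln (norm x) < T" by auto
  then show "exp (- T) < norm x" "norm x < exp T"
    using assms by (metis exp_less_mono exp_ln zero_less_norm_iff)+
qed

lemma power_cutoff_test_function:
  assumes T: "0 < T"
  shows "(\<lambda>x::real^'n::finite. norm x powr (- g) * cutoff T x) \<in> test_functions"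
proof (rule test_functionsI)
  fix k
  let ?h = "\<lambda>x::real^'n. (x \<bullet> x) powr (- g / 2) * cutoff T x"
  have "radial_smooth ?h"
    unfolding cutoff_def by (intro radial_smooth.intros)
  then show "C_k k (\<lambda>x::real^'n. norm x powr (- g) * cutoff T x)"
  proof (rule C_k_radial_smooth[rotated])
    show "0 < exp (- T)" by simp
    fix x :: "real^'n"
    show "norm x powr (- g) * cutoff T x = ?h x" if "x \<noteq> 0"
      using that power2_powr_half[of "norm x" "- g"] by (simp add: dot_square_norm)
    \<comment> \<open>At the origin itself the product is 0 because
      \<open>0 powr a = 0\<close>.\<close>
    show "norm x powr (- g) * cutoff T x = 0" if "norm x < exp (- T)"
      using cutoff_support(1)[OF _ T, of x] that by (cases "x = 0") auto
  qed
next
  fix x :: "real^'n" assume "norm x powr (- g) * cutoff T x \<noteq> 0"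
  then show "norm x \<le> exp T"
    using cutoff_support(2)[OF _ T, of x] by (cases "x = 0") auto
qed

lemma bump_0_bounds: "0 \<le> bump 0 t" "bump 0 t \<le> 1"
  by (auto simp: bump_def)

lemma exp_ge_two_mult: "2 * y \<le> exp (y::real)"
proof -
  have "1 + (y - 1) \<le> exp (y - 1)" by (rule exp_ge_add_one_self)
  moreover have "2 \<le> exp (1::real)" using exp_ge_add_one_self[of 1] by simp
  moreover have "exp y = exp 1 * exp (y - 1)" by (simp flip: exp_add)
  moreover have "2 * exp (y - 1) \<le> exp 1 * exp (y - 1)"
    using calculation by (intro mult_right_mono) auto
  ultimately show ?thesis by linarith
qed

text \<open>Mean value theorem: the derivative of \<open>bump 0\<close> is \<open>bump 2\<close>,
  which is at most 1 because \<open>y^2 <= exp y\<close> at \<open>y = 1 / z\<close>, the square of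
  \<open>y <= exp (y / 2)\<close>.\<close>

lemma bump_0_lipschitz: "\<bar>bump 0 a - bump 0 b\<bar> \<le> \<bar>a - b\<bar>"
proof -
  have *: "\<bar>bump 0 a - bump 0 b\<bar> \<le> b - a" if ab: "a < b" for a b
  proof -
    obtain z where z: "bump 0 b - bump 0 a = (b - a) * (- real 0 * bump (0 + 1) z + bump (0 + 2) z)"
      using MVT2[OF ab, of "bump 0" "\<lambda>z. - real 0 * bump (0 + 1) z + bump (0 + 2) z"] DERIV_bump[of 0] by blast
    have "0 \<le> bump 2 z" "bump 2 z \<le> 1"
    proof -
      show "0 \<le> bump 2 z" by (simp add: bump_def)
      show "bump 2 z \<le> 1"
      proof (cases "0 < z")
        case True
        have "(1 / z)\<^sup>2 \<le> exp (1 / z)"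
        proof -
          have "2 * (1 / (2 * z)) \<le> exp (1 / (2 * z))"
            using exp_ge_two_mult[of "1 / (2 * z)"] by simp
          then have "(1 / z)\<^sup>2 \<le> (exp (1 / (2 * z)))\<^sup>2"
            using True by (intro power_mono) auto
          also have "\<dots> = exp (1 / z)" by (simp flip: exp_double)
          finally show ?thesis .
        qed
        then have "(1 / z)\<^sup>2 * exp (- (1 / z)) \<le> 1"
          by (simp only: exp_minus divide_inverse[symmetric] pos_divide_le_eq[OF exp_gt_zero] mult_1_left)
        then show ?thesis using True by (simp add: bump_def)
      qed (simp add: bump_def)
    qed
    then have "\<bar>bump 0 b - bump 0 a\<bar> \<le> (b - a) * 1"
      unfolding z abs_mult using ab by (intro mult_mono) (auto simp: numeral_2_eq_2)
    then show ?thesis by (simp add: abs_minus_commute)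
  qed
  show ?thesis using *[of a b] *[of b a] by (cases a b rule: linorder_cases) (auto simp: abs_minus_commute)
qed

subsection \<open>Removing the power weights\<close>

definition lift :: "real \<Rightarrow> (real^'n::finite \<Rightarrow> real) \<Rightarrow> real^'n \<Rightarrow> real" where
  "lift g u x = norm x powr g * u x"

lemma measurable_lift [measurable]:
  assumes [measurable]: "u \<in> borel_measurable borel"
  shows "lift g u \<in> borel_measurable borel"
  unfolding lift_def[abs_def] by measurable

lemma D_norm_sq_eq_Qform:
  fixes u :: "real^'n::finite \<Rightarrow> real"
  assumes [measurable]: "u \<in> borel_measurable borel"
    and g: "g = (real CARD('n) - 2 * s) / 2 - \<alpha>"
  shows "D_norm_sq s \<alpha> u = Qform g (kap s) (lift g u)"
proof -
  let ?N = "real CARD('n)" and ?h = "lift g u"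
  let ?F = "\<lambda>x y. ennreal ((u x - u y)\<^sup>2 / (norm x powr \<alpha> * norm (x - y) powr (?N + 2 * s) * norm y powr \<alpha>))"
  let ?G = "\<lambda>x y. ennreal ((tdiff g ?h x y)\<^sup>2 * kap s x y)"
  note invariant_kernel.meas[OF invariant_kernel_kap, measurable]
  have pt: "?F x y = ennreal (norm x powr - ?N) * (ennreal (norm y powr - ?N) * ?G x y)"
    if xy: "x \<noteq> 0" "y \<noteq> 0" for x y :: "real^'n"
  proof -
    let ?a = "norm x" and ?b = "norm y" and ?d = "norm (x - y) powr (?N + 2 * s)"
    have pos: "0 < ?a" "0 < ?b" using xy by auto
    have 1: "?h x * (?b / ?a) powr (g / 2) = u x * (?a * ?b) powr (g / 2)"
    proof -
      have "?a powr g * (?b / ?a) powr (g / 2) = (?a powr (g / 2) * ?a powr (g / 2)) * (?b powr (g / 2) / ?a powr (g / 2))"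
        by (simp only: powr_divide powr_add[symmetric]) simp
      also have "\<dots> = (?a * ?b) powr (g / 2)"
        using pos by (simp add: powr_mult)
      finally show ?thesis by (simp add: lift_def mult_ac)
    qed
    have 2: "?h y * (?a / ?b) powr (g / 2) = u y * (?a * ?b) powr (g / 2)"
    proof -
      have "?b powr g * (?a / ?b) powr (g / 2) = (?b powr (g / 2) * ?b powr (g / 2)) * (?a powr (g / 2) / ?b powr (g / 2))"
        by (simp only: powr_divide powr_add[symmetric]) simp
      also have "\<dots> = (?a * ?b) powr (g / 2)"
        using pos by (simp add: powr_mult)
      finally show ?thesis by (simp add: lift_def mult_ac)
    qed
    have sq: "(?h x * (?b / ?a) powr (g / 2) - ?h y * (?a / ?b) powr (g / 2))\<^sup>2 = (u x - u y)\<^sup>2 * (?a * ?b) powr g"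
    proof -
      have "((?a * ?b) powr (g / 2))\<^sup>2 = (?a * ?b) powr g"
        by (simp add: power2_eq_square flip: powr_add)
      then show ?thesis unfolding 1 2 left_diff_distrib[symmetric] power_mult_distrib by simp
    qed
    \<comment> \<open>The exponents must satisfy \<open>- n + g + (n + 2s) / 2 = - alpha\<close>;
      this equation determines \<open>g\<close>.\<close>
    have e: "(?a * ?b) powr - ?N * (?a * ?b) powr g * (?a * ?b) powr ((?N + 2 * s) / 2) = (?a * ?b) powr - \<alpha>"
      unfolding powr_add[symmetric] by (rule arg_cong[of _ _ "\<lambda>t. (?a * ?b) powr t"]) (simp add: g field_simps)
    have "(u x - u y)\<^sup>2 / (?a powr \<alpha> * ?d * ?b powr \<alpha>) = (u x - u y)\<^sup>2 * (?a * ?b) powr - \<alpha> / ?d"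
      by (simp add: powr_minus powr_mult field_simps)
    also have "\<dots> = (?a * ?b) powr - ?N * ((u x - u y)\<^sup>2 * (?a * ?b) powr g * kap s x y)"
      unfolding e[symmetric] kap_def by simp
    also have "\<dots> = ?a powr - ?N * (?b powr - ?N * ((u x - u y)\<^sup>2 * (?a * ?b) powr g * kap s x y))"
      by (simp add: powr_mult)
    finally show ?thesis
      unfolding sq by (simp only: ennreal_mult'[OF powr_ge_zero])
  qed
  have "D_norm_sq s \<alpha> u = (\<integral>\<^sup>+x. (\<integral>\<^sup>+y. ?F x y \<partial>lborel) \<partial>lborel)"
    unfolding D_norm_sq_def nn_integral_completion ..
  also have "\<dots> = (\<integral>\<^sup>+x. ennreal (norm x powr - ?N) * (\<integral>\<^sup>+y. ?G x y \<partial>mu) \<partial>lborel)"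
  proof (rule nn_integral_cong_AE)
    show "AE x in lborel. (\<integral>\<^sup>+y. ?F x y \<partial>lborel) = ennreal (norm x powr - ?N) * (\<integral>\<^sup>+y. ?G x y \<partial>mu)"
      using AE_lborel_singleton[of "0 :: real^'n"]
    proof eventually_elim
      case (elim x)
      have "(\<integral>\<^sup>+y. ?F x y \<partial>lborel) = (\<integral>\<^sup>+y. ennreal (norm x powr - ?N) * (ennreal (norm y powr - ?N) * ?G x y) \<partial>lborel)"
        by (rule nn_integral_cong_AE, use AE_lborel_singleton[of "0 :: real^'n"] in eventually_elim) (rule pt[OF elim])
      also have "\<dots> = ennreal (norm x powr - ?N) * (\<integral>\<^sup>+y. ennreal (norm y powr - ?N) * ?G x y \<partial>lborel)"
        by (rule nn_integral_cmult) measurable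
      also have "(\<integral>\<^sup>+y. ennreal (norm y powr - ?N) * ?G x y \<partial>lborel) = (\<integral>\<^sup>+y. ?G x y \<partial>mu)"
        by (rule nn_integral_mu[symmetric]) measurable
      finally show ?case .
    qed
  qed
  also have "\<dots> = Qform g (kap s) ?h"
    unfolding Qform_def by (rule nn_integral_mu[symmetric]) measurable
  finally show ?thesis .
qed

lemma CKN_rhs_eq_Lpp:
  fixes u :: "real^'n::finite \<Rightarrow> real"
  assumes [measurable]: "u \<in> borel_measurable borel" and p: "0 < p" and g: "g + \<beta> = real CARD('n) / p"
  shows "CKN_rhs p \<beta> u = (if Lpp p (lift g u) = \<infinity> then \<infinity>
     else ennreal ((enn2real (Lpp p (lift g u)) powr (1 / p))\<^sup>2))"
proof -
  let ?N = "real CARD('n)"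
  have "(\<integral>\<^sup>+x. ennreal (\<bar>u x * norm x powr (- \<beta>)\<bar> powr p) \<partial>lebesgue) =
    (\<integral>\<^sup>+x. ennreal (norm x powr - ?N) * ennreal (\<bar>lift g u x\<bar> powr p) \<partial>lborel)"
    unfolding nn_integral_completion
  proof (rule nn_integral_cong_AE, use AE_lborel_singleton[of "0 :: real^'n"] in eventually_elim)
    case (elim x)
    have e: "- \<beta> * p = - ?N + g * p" using g p by (simp add: field_simps)
    have "\<bar>u x * norm x powr (- \<beta>)\<bar> powr p = \<bar>u x\<bar> powr p * norm x powr (- \<beta> * p)"
      by (simp add: abs_mult powr_mult powr_powr)
    also have "\<dots> = norm x powr - ?N * \<bar>lift g u x\<bar> powr p"
      unfolding e powr_add by (simp add: lift_def abs_mult powr_mult powr_powr)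
    finally show ?case by (simp only: ennreal_mult'[OF powr_ge_zero])
  qed
  also have "\<dots> = Lpp p (lift g u)"
    unfolding Lpp_def by (rule nn_integral_mu[symmetric]) measurable
  finally have *: "(\<integral>\<^sup>+x. ennreal (\<bar>u x * norm x powr (- \<beta>)\<bar> powr p) \<partial>lebesgue) = Lpp p (lift g u)" .
  show ?thesis
    unfolding CKN_rhs_def Lp_norm_def * by (simp add: Let_def ennreal_power)
qed

lemma D_norm_sq_cong_AE:
  assumes "AE x in lebesgue. u x = v x"
  shows "D_norm_sq s \<alpha> u = D_norm_sq s \<alpha> v"
  unfolding D_norm_sq_def
proof (rule nn_integral_cong_AE, use assms in eventually_elim)
  case (elim x)
  show ?case
    by (rule nn_integral_cong_AE, use assms in eventually_elim) (use elim in auto)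
qed

lemma CKN_rhs_cong_AE:
  assumes "AE x in lebesgue. u x = v x"
  shows "CKN_rhs p \<beta> u = CKN_rhs p \<beta> v"
proof -
  have "(\<integral>\<^sup>+x. ennreal (\<bar>u x * norm x powr - \<beta>\<bar> powr p) \<partial>lebesgue) = (\<integral>\<^sup>+x. ennreal (\<bar>v x * norm x powr - \<beta>\<bar> powr p) \<partial>lebesgue)"
    by (rule nn_integral_cong_AE, use assms in eventually_elim) simp
  then show ?thesis by (simp add: CKN_rhs_def Lp_norm_def)
qed

lemma AE_lebesgue_iff: "(AE x in lebesgue. P x) \<longleftrightarrow> (AE x in lborel. P x)"
  by (rule AE_completion_iff)

lemma D_space_cong_AE:
  assumes "u \<in> D_space s \<alpha>" "AE x in lebesgue. u x = v x" "v \<in> borel_measurable lebesgue"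
  shows "v \<in> D_space s \<alpha>"
proof -
  obtain \<phi> where \<phi>: "\<And>k. \<phi> k \<in> test_functions"
    "(\<lambda>k. D_norm_sq s \<alpha> (\<lambda>x. u x - \<phi> k x)) \<longlonglongrightarrow> 0" "AE x in lebesgue. (\<lambda>k. \<phi> k x) \<longlonglongrightarrow> u x"
    using assms(1) unfolding D_space_def by blast
  have "D_norm_sq s \<alpha> (\<lambda>x. u x - \<phi> k x) = D_norm_sq s \<alpha> (\<lambda>x. v x - \<phi> k x)" for k
    by (rule D_norm_sq_cong_AE) (use assms(2) in eventually_elim, simp)
  then have "(\<lambda>k. D_norm_sq s \<alpha> (\<lambda>x. v x - \<phi> k x)) \<longlonglongrightarrow> 0" using \<phi>(2) by simp
  moreover have "AE x in lebesgue. (\<lambda>k. \<phi> k x) \<longlonglongrightarrow> v x"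
    using assms(2) \<phi>(3) by eventually_elim simp
  ultimately show ?thesis
    unfolding D_space_def using \<phi>(1) assms(3) by blast
qed

lemma borel_representative:
  fixes u :: "real^'n::finite \<Rightarrow> real"
  assumes "u \<in> borel_measurable lebesgue"
  obtains v where "v \<in> borel_measurable borel" "AE x in lebesgue. u x = v x"
  using completion_ex_borel_measurable_real[OF assms] by (auto simp: AE_completion)

lemma borel_measurable_lebesgueI: "v \<in> borel_measurable borel \<Longrightarrow> v \<in> borel_measurable lebesgue"
  by (simp add: measurable_completion)

lemma test_function_D_space:
  assumes "f \<in> test_functions"
  shows "f \<in> D_space s \<alpha>"
proof -
  have "D_norm_sq s \<alpha> (\<lambda>x. f x - f x) = 0"
    by (simp add: D_norm_sq_def)
  then show ?thesis
    unfolding D_space_def using assms test_functionsD(3)[OF assms]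
    by (auto intro!: exI[of _ "\<lambda>k. f"] borel_measurable_lebesgueI)
qed

text \<open>Multiplication in \<open>ennreal\<close> commutes with suprema, so the supremum of the
  admissible constants is itself admissible, even before it is known to be finite.\<close>

lemma CKN_const_le:
  fixes u :: "real^'n::finite \<Rightarrow> real"
  assumes "u \<in> D_space s \<alpha>"
  shows "CKN_const TYPE('n) s p \<alpha> \<beta> * CKN_rhs p \<beta> u \<le> D_norm_sq s \<alpha> u"
proof -
  let ?S = "{C. \<forall>u \<in> (D_space s \<alpha> :: (real^'n \<Rightarrow> real) set). D_norm_sq s \<alpha> u \<ge> C * CKN_rhs p \<beta> u}"
  have "0 \<in> ?S" by simp
  then have "?S \<noteq> {}" by blast
  have "CKN_const TYPE('n) s p \<alpha> \<beta> * CKN_rhs p \<beta> u = (SUP C\<in>?S. C * CKN_rhs p \<beta> u)"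
    unfolding CKN_const_def by (simp add: SUP_mult_right_ennreal[symmetric])
  also have "\<dots> \<le> D_norm_sq s \<alpha> u"
    using assms by (intro SUP_least) auto
  finally show ?thesis .
qed

lemma AE_lborel_reflection:
  assumes "AE x in lborel. P (x::'a::euclidean_space)"
  shows "AE x in lborel. P (reflection a x)"
proof -
  have "AE x in distr lborel borel (reflection a). P x"
    unfolding distr_reflection by (rule assms)
  then show ?thesis by (rule AE_distrD[rotated]) simp
qed

lemma ennreal_add_eq_2_add:
  assumes "A + B = 2 * (C + D)" "0 \<le> A" "0 \<le> B" "0 \<le> C" "0 \<le> D"
  shows "ennreal A + ennreal B = 2 * (ennreal C + ennreal D)"
proof -
  have "ennreal A + ennreal B = ennreal (2 * (C + D))"
    using assms by (simp flip: ennreal_plus)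
  also have "\<dots> = 2 * ennreal (C + D)"
    by (subst ennreal_mult') simp_all
  finally show ?thesis using assms by simp
qed

section \<open>Reflection symmetry and the parallelogram law\<close>

context invariant_kernel
begin

lemma Qform_reflection:
  assumes [measurable]: "h \<in> borel_measurable borel"
  shows "Qform g K (\<lambda>x. h (reflection a x)) = Qform g K h"
proof -
  let ?F = "\<lambda>x y. ennreal ((tdiff g h x y)\<^sup>2 * K x y)"
  have "Qform g K (\<lambda>x. h (reflection a x)) = (\<integral>\<^sup>+x. (\<integral>\<^sup>+y. ?F (reflection a x) (reflection a y) \<partial>mu) \<partial>mu)"
    unfolding Qform_def by (simp add: refl)
  also have "\<dots> = (\<integral>\<^sup>+x. (\<integral>\<^sup>+y. ?F (reflection a x) y \<partial>mu) \<partial>mu)"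
    by (intro nn_integral_cong nn_integral_mu_reflection) measurable
  also have "\<dots> = (\<integral>\<^sup>+x. (\<integral>\<^sup>+y. ?F x y \<partial>mu) \<partial>mu)"
    by (rule nn_integral_mu_reflection) measurable
  finally show ?thesis unfolding Qform_def .
qed

lemma Qform_parallelogram:
  assumes [measurable]: "m \<in> borel_measurable borel" "d \<in> borel_measurable borel"
  shows "Qform g K (\<lambda>x. m x + d x) + Qform g K (\<lambda>x. m x - d x) = 2 * (Qform g K m + Qform g K d)"
proof -
  let ?D = "\<lambda>h x y. (tdiff g h x y)\<^sup>2 * K x y"
  have "Qform g K (\<lambda>x. m x + d x) + Qform g K (\<lambda>x. m x - d x) =
     (\<integral>\<^sup>+x. (\<integral>\<^sup>+y. ennreal (?D (\<lambda>x. m x + d x) x y) + ennreal (?D (\<lambda>x. m x - d x) x y) \<partial>mu) \<partial>mu)"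
    unfolding Qform_def by (subst nn_integral2_mu_add[symmetric]) auto
  also have "\<dots> = (\<integral>\<^sup>+x. (\<integral>\<^sup>+y. 2 * (ennreal (?D m x y) + ennreal (?D d x y)) \<partial>mu) \<partial>mu)"
  proof (intro nn_integral_cong)
    fix x y
    have nn: "0 \<le> (a - b)\<^sup>2 * K x y" for a b by (simp add: nonneg)
    have "((m1 + d1) * r - (m2 + d2) * t)\<^sup>2 * k + ((m1 - d1) * r - (m2 - d2) * t)\<^sup>2 * k =
      2 * ((m1 * r - m2 * t)\<^sup>2 * k + (d1 * r - d2 * t)\<^sup>2 * k)" for m1 m2 d1 d2 r t k :: real
      by (simp add: power2_eq_square algebra_simps)
    then show "ennreal (?D (\<lambda>x. m x + d x) x y) + ennreal (?D (\<lambda>x. m x - d x) x y) = 2 * (ennreal (?D m x y) + ennreal (?D d x y))"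
      by (intro ennreal_add_eq_2_add nn)
  qed
  also have "\<dots> = 2 * (\<integral>\<^sup>+x. (\<integral>\<^sup>+y. ennreal (?D m x y) + ennreal (?D d x y) \<partial>mu) \<partial>mu)"
    by (rule nn_integral2_mu_cmult) measurable
  also have "\<dots> = 2 * (Qform g K m + Qform g K d)"
    unfolding Qform_def by (subst nn_integral2_mu_add) auto
  finally show ?thesis .
qed

lemma Qform_diff_le:
  assumes [measurable]: "f \<in> borel_measurable borel" "h \<in> borel_measurable borel"
  shows "Qform g K (\<lambda>x. f x - h x) \<le> 2 * (Qform g K f + Qform g K h)"
  unfolding Qform_parallelogram[OF assms, symmetric] by simp

text \<open>Even and odd parts are orthogonal for the form: the parallelogram law and mirror
  invariance give the energy of \<open>h\<close> as the sum of the energies of \<open>?m\<close> and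
  \<open>?d\<close>.\<close>

lemma Qform_midpoint_le:
  assumes [measurable]: "h \<in> borel_measurable borel"
  shows "Qform g K (\<lambda>x. (h x + h (reflection a x)) / 2) \<le> Qform g K h"
proof -
  let ?m = "\<lambda>x. (h x + h (reflection a x)) / 2" and ?d = "\<lambda>x. (h x - h (reflection a x)) / 2"
  have "?m x + ?d x = h x" "?m x - ?d x = h (reflection a x)" for x
    by (simp_all add: field_simps)
  then have "2 * Qform g K h = 2 * (Qform g K ?m + Qform g K ?d)"
    using Qform_parallelogram[of ?m ?d g] Qform_reflection[OF assms, of g a] by (simp add: mult_2)
  then have "Qform g K h = Qform g K ?m + Qform g K ?d"
    by (subst (asm) ennreal_mult_cancel_left) auto
  then show ?thesis by simp
qed

end

lemma lift_diff: "lift g (\<lambda>x. u x - v x) = (\<lambda>x. lift g u x - lift g v x)"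
  by (simp add: lift_def fun_eq_iff right_diff_distrib)

text \<open>Symmetrising contracts the energy and preserves test functions, so the symmetrised
  approximants still converge. This makes the even part of a minimizer an admissible
  competitor.\<close>

lemma D_space_midpoint:
  fixes u :: "real^'n::finite \<Rightarrow> real"
  assumes u: "u \<in> D_space s \<alpha>" and [measurable]: "u \<in> borel_measurable borel"
  shows "(\<lambda>x. (u x + u (reflection a x)) / 2) \<in> D_space s \<alpha>"
proof -
  let ?M = "\<lambda>(f :: real^'n \<Rightarrow> real) x. (f x + f (reflection a x)) / 2"
  obtain \<phi> where \<phi>: "\<And>k. \<phi> k \<in> test_functions"
    "(\<lambda>k. D_norm_sq s \<alpha> (\<lambda>x. u x - \<phi> k x)) \<longlonglongrightarrow> 0" "AE x in lebesgue. (\<lambda>k. \<phi> k x) \<longlonglongrightarrow> u x"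
    using u unfolding D_space_def by blast
  have [measurable]: "\<phi> k \<in> borel_measurable borel" for k
    using \<phi>(1) by (rule test_functionsD)
  define g where "g = (real CARD('n) - 2 * s) / 2 - \<alpha>"
  have D: "D_norm_sq s \<alpha> v = Qform g (kap s) (lift g v)" if "v \<in> borel_measurable borel" for v :: "real^'n \<Rightarrow> real"
    by (rule D_norm_sq_eq_Qform[OF that g_def])
  have M: "?M (\<phi> k) \<in> test_functions" for k
    using test_functions_cmult[OF test_functions_add[OF \<phi>(1) test_functions_reflection[OF \<phi>(1)]], of "1/2" k k a] by simp
  have le: "D_norm_sq s \<alpha> (\<lambda>x. ?M u x - ?M (\<phi> k) x) \<le> D_norm_sq s \<alpha> (\<lambda>x. u x - \<phi> k x)" for k
  proof -
    let ?w = "\<lambda>x. u x - \<phi> k x"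
    have "lift g (\<lambda>x. ?M u x - ?M (\<phi> k) x) = ?M (lift g ?w)"
      by (simp add: lift_def fun_eq_iff field_simps)
    then show ?thesis
      using invariant_kernel.Qform_midpoint_le[OF invariant_kernel_kap, of "lift g ?w" g s a]
      by (simp add: D)
  qed
  have "(\<lambda>k. D_norm_sq s \<alpha> (\<lambda>x. ?M u x - ?M (\<phi> k) x)) \<longlonglongrightarrow> 0"
    by (rule tendsto_sandwich[OF _ _ tendsto_const \<phi>(2)]) (auto intro!: always_eventually le)
  moreover have "AE x in lebesgue. (\<lambda>k. ?M (\<phi> k) x) \<longlonglongrightarrow> ?M u x"
  proof -
    have 1: "AE x in lborel. (\<lambda>k. \<phi> k x) \<longlonglongrightarrow> u x" using \<phi>(3) by (simp add: AE_lebesgue_iff)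
    show ?thesis
      unfolding AE_lebesgue_iff using 1 AE_lborel_reflection[OF 1, of a]
      by eventually_elim (intro tendsto_intros, auto)
  qed
  moreover have "?M u \<in> borel_measurable lebesgue"
    by (intro borel_measurable_lebesgueI) measurable
  ultimately show ?thesis
    unfolding D_space_def using M by (auto intro!: exI[of _ "\<lambda>k. ?M (\<phi> k)"])
qed

subsection \<open>A Hardy inequality\<close>

text \<open>The shells on which \<open>t^k * norm x\<close> lies in [1, 2] are dilates of one
  another and have equal measure, so the bounds \<open>M * q^k\<close> sum as a geometric series.
  The choice \<open>t = 2\<close> treats the origin, \<open>t = 1/2\<close> infinity.\<close>

lemma nn_integral_mu_dyadic:
  fixes f :: "real^'n::finite \<Rightarrow> ennreal"
  assumes [measurable]: "f \<in> borel_measurable borel"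
    and t: "0 < t" and q: "0 \<le> q" "q < 1" and M: "0 \<le> M"
    and bound: "\<And>x. x \<noteq> 0 \<Longrightarrow> f x \<noteq> 0 \<Longrightarrow> \<exists>k::nat. 1 \<le> t ^ k * norm x \<and> t ^ k * norm x \<le> 2 \<and> f x \<le> ennreal (M * q ^ k)"
  shows "(\<integral>\<^sup>+x. f x \<partial>mu) < \<infinity>"
proof -
  let ?A = "{x::real^'n. 1 \<le> norm x \<and> norm x \<le> 2}"
  obtain V where V: "emeasure mu ?A = ennreal V" "0 \<le> V"
    using emeasure_annulus_finite[of 1 2, where 'n = 'n] by (cases "emeasure mu ?A") auto
  have scale: "(\<integral>\<^sup>+x. indicator ?A (t ^ k *\<^sub>R x) \<partial>mu) = emeasure mu ?A" for k
    using t by (subst nn_integral_mu_scale) auto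
  have "(\<integral>\<^sup>+x. f x \<partial>mu) \<le> (\<integral>\<^sup>+x. (\<Sum>k. ennreal (M * q ^ k) * indicator ?A (t ^ k *\<^sub>R x)) \<partial>mu)"
  proof (rule nn_integral_mono_AE, use AE_mu_nonzero in eventually_elim)
    case (elim x)
    show ?case
    proof (cases "f x = 0")
      case False
      obtain k where k: "1 \<le> t ^ k * norm x" "t ^ k * norm x \<le> 2" "f x \<le> ennreal (M * q ^ k)"
        using bound[OF elim False] by blast
      define F :: "nat \<Rightarrow> ennreal" where "F k = ennreal (M * q ^ k) * indicator ?A (t ^ k *\<^sub>R x)" for k
      have "f x \<le> F k"
        using k t by (simp add: F_def)
      also have "\<dots> = (\<Sum>j\<in>{k}. F j)" by simp
      also have "\<dots> \<le> (\<Sum>k. F k)"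
        by (rule sum_le_suminf) auto
      finally show ?thesis by (simp only: F_def)
    qed simp
  qed
  also have "\<dots> = (\<Sum>k. \<integral>\<^sup>+x. ennreal (M * q ^ k) * indicator ?A (t ^ k *\<^sub>R x) \<partial>mu)"
    by (rule nn_integral_suminf) measurable
  also have "\<dots> = (\<Sum>k. ennreal (M * q ^ k) * ennreal V)"
    by (subst nn_integral_cmult) (auto simp: scale V(1))
  also have "\<dots> = (\<Sum>k. ennreal (M * q ^ k * V))"
    using V M q by (simp add: ennreal_mult)
  also have "\<dots> < \<infinity>"
  proof -
    have "summable (\<lambda>k. M * V * q ^ k)" using q by (intro summable_mult summable_geometric) auto
    then have "summable (\<lambda>k. M * q ^ k * V)" by (simp add: mult_ac)
    then show ?thesis using V M q by (simp add: suminf_ennreal2)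
  qed
  finally show ?thesis .
qed

lemma dyadic_scale_up: "0 < r \<Longrightarrow> r \<le> 2 \<Longrightarrow> \<exists>k::nat. 1 \<le> 2 ^ k * r \<and> 2 ^ k * r \<le> (2::real)"
proof -
  assume r: "0 < r" "r \<le> 2"
  have ex: "\<exists>k::nat. 1 \<le> 2 ^ k * r"
  proof -
    obtain k :: nat where "1 / r < 2 ^ k" using real_arch_pow[of 2 "1 / r"] by auto
    then show ?thesis using r by (intro exI[of _ k]) (simp add: field_simps)
  qed
  define k where "k = (LEAST k::nat. 1 \<le> 2 ^ k * r)"
  have k: "1 \<le> 2 ^ k * r" unfolding k_def by (rule LeastI_ex[OF ex])
  have "2 ^ k * r \<le> 2"
  proof (cases k)
    case (Suc j)
    then have "\<not> 1 \<le> 2 ^ j * r" using not_less_Least[of j "\<lambda>k. 1 \<le> 2 ^ k * r"] by (simp add: k_def)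
    then show ?thesis using Suc by simp
  qed (use r in simp)
  with k show ?thesis by blast
qed

lemma nn_integral_mu_power_near_0:
  assumes c: "0 < c"
  shows "(\<integral>\<^sup>+x. ennreal (norm x powr c) * indicator {x::real^'n::finite. norm x \<le> 2} x \<partial>mu) < \<infinity>"
proof (rule nn_integral_mu_dyadic[where t = 2 and M = "2 powr c" and q = "2 powr (- c)"])
  show "2 powr - c < 1" using powr_less_mono[of "- c" 0 2] c by simp
  fix x :: "real^'n" assume x: "x \<noteq> 0" "ennreal (norm x powr c) * indicator {x. norm x \<le> 2} x \<noteq> 0"
  then have "norm x \<le> 2" by (auto simp: indicator_def split: if_splits)
  then obtain k :: nat where k: "1 \<le> 2 ^ k * norm x" "2 ^ k * norm x \<le> 2"
    using dyadic_scale_up[of "norm x"] x by auto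
  have "norm x powr c \<le> (2 * 2 powr - real k) powr c"
    using k c by (intro powr_mono2) (auto simp: powr_minus powr_realpow field_simps)
  also have "\<dots> = 2 powr c * (2 powr - c) ^ k"
    by (simp add: powr_mult powr_powr powr_realpow[symmetric] mult.commute)
  finally show "\<exists>k. 1 \<le> 2 ^ k * norm x \<and> 2 ^ k * norm x \<le> 2 \<and>
      ennreal (norm x powr c) * indicator {x. norm x \<le> 2} x \<le> ennreal (2 powr c * (2 powr - c) ^ k)"
    using k by (intro exI[of _ k]) (auto simp: indicator_def ennreal_leI)
qed auto

lemma nn_integral_mu_power_ball:
  assumes c: "0 < c"
  shows "(\<integral>\<^sup>+x. ennreal (norm x powr c) * indicator {x::real^'n::finite. norm x \<le> R} x \<partial>mu) < \<infinity>"
proof -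
  define l where "l = 2 / max 1 R"
  have l: "0 < l" by (simp add: l_def)
  have R: "l * r \<le> 2" if "r \<le> R" for r
    using that by (auto simp: l_def field_simps)
  have "(\<integral>\<^sup>+x. ennreal (norm x powr c) * indicator {x::real^'n. norm x \<le> R} x \<partial>mu) \<le>
     (\<integral>\<^sup>+x. ennreal (l powr - c) * (ennreal (norm (l *\<^sub>R x) powr c) * indicator {x::real^'n. norm x \<le> 2} (l *\<^sub>R x)) \<partial>mu)"
  proof (rule nn_integral_mono)
    fix x :: "real^'n"
    have "l powr - c * (l * norm x) powr c = norm x powr c"
      using l by (simp add: powr_mult powr_minus)
    then show "ennreal (norm x powr c) * indicator {x. norm x \<le> R} x \<le>
      ennreal (l powr - c) * (ennreal (norm (l *\<^sub>R x) powr c) * indicator {x::real^'n. norm x \<le> 2} (l *\<^sub>R x))"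
      using R[of "norm x"] l by (auto simp: indicator_def ennreal_mult'[symmetric])
  qed
  also have "\<dots> = ennreal (l powr - c) * (\<integral>\<^sup>+x. ennreal (norm (l *\<^sub>R x) powr c) * indicator {x::real^'n. norm x \<le> 2} (l *\<^sub>R x) \<partial>mu)"
    by (rule nn_integral_cmult) measurable
  also have "(\<integral>\<^sup>+x. ennreal (norm (l *\<^sub>R x) powr c) * indicator {x::real^'n. norm x \<le> 2} (l *\<^sub>R x) \<partial>mu) =
     (\<integral>\<^sup>+x. ennreal (norm x powr c) * indicator {x::real^'n. norm x \<le> 2} x \<partial>mu)"
    by (rule nn_integral_mu_scale[OF _ l]) measurable
  also have "ennreal (l powr - c) * \<dots> < \<infinity>"
    using nn_integral_mu_power_near_0[OF c, where 'n = 'n] by (simp add: ennreal_mult_less_top)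
  finally show ?thesis .
qed

lemma nn_integral_mu_power_at_top:
  assumes c: "0 < c"
  shows "(\<integral>\<^sup>+x. ennreal (norm x powr - c) * indicator {x::real^'n::finite. 1 \<le> norm x} x \<partial>mu) < \<infinity>"
proof (rule nn_integral_mu_dyadic[where t = "1/2" and M = "1" and q = "2 powr (- c)"])
  show "2 powr - c < 1" using powr_less_mono[of "- c" 0 2] c by simp
  fix x :: "real^'n" assume x: "x \<noteq> 0" "ennreal (norm x powr - c) * indicator {x. 1 \<le> norm x} x \<noteq> 0"
  then have "1 \<le> norm x" by (auto simp: indicator_def split: if_splits)
  then have "0 < 2 / norm x" "2 / norm x \<le> 2" using x by (auto simp: field_simps)
  from dyadic_scale_up[OF this]
  obtain k :: nat where k: "1 \<le> 2 ^ k * (2 / norm x)" "2 ^ k * (2 / norm x) \<le> 2" by blast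
  have k': "1 \<le> (1/2) ^ k * norm x" "(1/2) ^ k * norm x \<le> 2"
    using k x by (auto simp: field_simps power_divide)
  have "2 powr real k \<le> norm x" using k' by (simp add: powr_realpow power_divide field_simps)
  then have "norm x powr - c \<le> (2 powr real k) powr - c"
    using c by (intro powr_mono2') auto
  also have "\<dots> = 1 * (2 powr - c) ^ k"
    by (simp add: powr_powr powr_realpow[symmetric] mult.commute)
  finally show "\<exists>k. 1 \<le> (1/2) ^ k * norm x \<and> (1/2) ^ k * norm x \<le> 2 \<and>
      ennreal (norm x powr - c) * indicator {x. 1 \<le> norm x} x \<le> ennreal (1 * (2 powr - c) ^ k)"
    using k' by (intro exI[of _ k]) (auto simp: indicator_def ennreal_leI)
qed auto

text \<open>For the kernel \<open>far b\<close> both weights can be compared directly: a large ratio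
  of norms raised to the power \<open>g\<close> outweighs the two shells counted by
  \<open>weight 0\<close>. A non-sharp constant is enough, since the purpose is to place the energy
  space in L^2(mu).\<close>

lemma hardy_inequality:
  assumes s: "0 < s" and g: "0 < g"
  shows "\<exists>C>0. \<forall>h :: real^'n::finite \<Rightarrow> real. h \<in> borel_measurable borel \<longrightarrow> L2sq h < \<infinity> \<longrightarrow>
    ennreal C * L2sq h \<le> Qform g (kap s) h"
proof -
  \<comment> \<open>With \<open>b powr g >= 3\<close> the outer shell alone gives
    \<open>weight g >= 3 * W\<close>, against \<open>weight 0 <= 2 * W\<close> from both
    shells.\<close>
  define b where "b = max 2 (3 powr (1 / g))"
  have b: "2 \<le> b" "0 < b" by (auto simp: b_def)
  have bg: "3 \<le> b powr g"
  proof -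
    have "(3 powr (1 / g)) powr g \<le> b powr g"
      using g by (intro powr_mono2) (auto simp: b_def)
    then show ?thesis using g by (simp add: powr_powr)
  qed
  define n where "n = norm (1::real^'n)"
  have n: "0 < n" by (simp add: n_def)
  interpret far: invariant_kernel "far b :: real^'n \<Rightarrow> _" by (rule invariant_kernel_far)
  let ?A = "{y::real^'n. n \<le> norm y \<and> norm y \<le> 2 * n}"
  obtain W where W: "emeasure mu ?A = ennreal W" "0 \<le> W"
    using emeasure_annulus_finite[OF n, of "2 * n", where 'n = 'n] by (cases "emeasure mu ?A") auto
  have W0: "0 < W"
  proof (rule ccontr)
    assume "\<not> 0 < W"
    then have "emeasure mu ?A = 0" using W by simp
    then have "AE y in mu. y \<notin> ?A"
      using AE_iff_null_sets[of ?A mu] by auto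
    then have ae: "AE y in lborel. y \<notin> ?A" unfolding AE_mu_iff .
    have U: "open ({y::real^'n. n < norm y} \<inter> {y. norm y < 2 * n})"
      by (intro open_Int open_Collect_less continuous_intros)
    have "(3/2) *\<^sub>R (1::real^'n) \<in> {y::real^'n. n < norm y} \<inter> {y. norm y < 2 * n}"
      using n by (auto simp: n_def)
    then show False
      by (rule not_AE_lborel_notin_open[OF U], intro eventually_mono[OF ae]) auto
  qed
  have scale: "(\<integral>\<^sup>+y. indicator ?A (c *\<^sub>R y) \<partial>mu) = ennreal W" if "0 < c" for c
    using that by (subst nn_integral_mu_scale) (auto simp: W(1))
  have w0: "weight 0 (far b :: real^'n \<Rightarrow> _) \<le> ennreal (2 * W)"
  proof -
    have "weight 0 (far b :: real^'n \<Rightarrow> _) \<le> (\<integral>\<^sup>+y. indicator ?A ((1 / b) *\<^sub>R y) + indicator ?A ((2 * b) *\<^sub>R y) \<partial>mu)"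
      unfolding weight_def
      by (rule nn_integral_mono)
         (use b n in \<open>auto simp: far_def n_def[symmetric] indicator_def field_simps split: if_splits\<close>)
    also have "\<dots> = ennreal W + ennreal W"
      using b by (subst nn_integral_add) (auto simp: scale)
    finally show ?thesis using W by (simp flip: ennreal_plus)
  qed
  have wg: "ennreal (3 * W) \<le> weight g (far b :: real^'n \<Rightarrow> _)"
  proof -
    have "ennreal (3 * W) = (\<integral>\<^sup>+y. ennreal 3 * indicator ?A ((1 / b) *\<^sub>R y) \<partial>mu)"
      using b W by (subst nn_integral_cmult) (auto simp: scale ennreal_mult)
    also have "\<dots> \<le> weight g (far b :: real^'n \<Rightarrow> _)"
      unfolding weight_def
    proof (rule nn_integral_mono)
      fix y :: "real^'n"
      show "ennreal 3 * indicator ?A ((1 / b) *\<^sub>R y) \<le> ennreal ((norm y / norm (1::real^'n)) powr g * far b 1 y)"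
      proof (cases "(1 / b) *\<^sub>R y \<in> ?A")
        case True
        then have y: "b * n \<le> norm y" "norm y \<le> 2 * b * n" using b by (auto simp: field_simps)
        moreover have "0 < b * n" using b n by simp
        ultimately have "y \<noteq> 0" by auto
        then have "far b 1 y = 1" using y by (auto simp: far_def n_def)
        moreover have "b powr g \<le> (norm y / n) powr g"
          using y b n g by (intro powr_mono2) (auto simp: field_simps)
        ultimately show ?thesis using True bg by (simp add: n_def[symmetric] ennreal_leI)
      qed simp
    qed
    finally show ?thesis .
  qed
  define c where "c = (1 / (8 * b)) powr ((real CARD('n) + 2 * s) / 2)"
  have c: "0 < c" using b by (simp add: c_def)
  show ?thesis
  proof (intro exI[of _ "c * (2 * W)"] conjI allI impI)
    fix h :: "real^'n \<Rightarrow> real" assume h [measurable]: "h \<in> borel_measurable borel" and "L2sq h < \<infinity>"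
    then obtain L where L: "L2sq h = ennreal L" "0 \<le> L" by (cases "L2sq h") auto
    have two: "2 * ennreal a = ennreal (2 * a)" for a
      using ennreal_mult'[of 2 a] by simp
    have "ennreal (6 * W * L) = 2 * ennreal (3 * W) * L2sq h"
      using L by (simp add: two ennreal_mult''[symmetric])
    also have "\<dots> \<le> 2 * weight g (far b :: real^'n \<Rightarrow> _) * L2sq h"
      by (intro mult_right_mono mult_left_mono wg) auto
    also have "\<dots> \<le> Qform g (far b) h + 2 * weight 0 (far b :: real^'n \<Rightarrow> _) * L2sq h"
      unfolding far.Qform_add_weight[OF h] by simp
    also have "\<dots> \<le> Qform g (far b) h + 2 * ennreal (2 * W) * L2sq h"
      by (intro add_left_mono mult_right_mono mult_left_mono w0) auto
    also have "2 * ennreal (2 * W) * L2sq h = ennreal (4 * W * L)"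
      using L by (simp add: two ennreal_mult''[symmetric])
    finally have "ennreal (6 * W * L) \<le> Qform g (far b) h + ennreal (4 * W * L)" .
    \<comment> \<open>Subtracting \<open>4 * W * L\<close> is legitimate because it is finite, which
      rests on \<open>L2sq h\<close> being finite.\<close>
    then have "ennreal (2 * W * L) \<le> Qform g (far b) h"
      using W L by (cases "Qform g (far b) h") (auto simp: ennreal_le_iff mult_ac simp flip: ennreal_plus)
    then have "ennreal c * ennreal (2 * W * L) \<le> ennreal c * Qform g (far b) h"
      by (intro mult_left_mono) auto
    also have "\<dots> \<le> Qform g (kap s) h"
      by (rule Qform_mono_kernel[OF h invariant_kernel_far]) (use c kap_far_ge[OF _ s b(1)] in \<open>auto simp: c_def\<close>)
    finally show "ennreal (c * (2 * W)) * L2sq h \<le> Qform g (kap s) h"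
      using c W L by (simp add: ennreal_mult mult.assoc)
  qed (use c W0 in auto)
qed

subsection \<open>A slowly varying competitor\<close>

text \<open>It bounds squared differences of functions that are Lipschitz in \<open>ln |x|\<close>,
  weighted by both powers of the ratio of norms. The squared logarithm vanishes to second order at
  the diagonal and tames the singularity of \<open>kap\<close> when \<open>s < 1\<close>.\<close>

definition log_kernel :: "real \<Rightarrow> real \<Rightarrow> real^'n::finite \<Rightarrow> real^'n \<Rightarrow> real" where
  "log_kernel g s x y = (ln (norm y / norm x))\<^sup>2 *
     ((norm y / norm x) powr g + (norm x / norm y) powr g) * kap s x y"

lemma invariant_kernel_log_kernel: "invariant_kernel (log_kernel g s :: real^'n::finite \<Rightarrow> _)"
proof -
  interpret kap: invariant_kernel "kap s :: real^'n \<Rightarrow> _" by (rule invariant_kernel_kap)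
  show ?thesis
  proof
    show "case_prod (log_kernel g s) \<in> borel_measurable (borel \<Otimes>\<^sub>M (borel :: (real^'n) measure))"
      unfolding log_kernel_def[abs_def] by measurable
    fix x y :: "real^'n"
    show "0 \<le> log_kernel g s x y" by (simp add: log_kernel_def kap.nonneg)
    have "(ln (norm y / norm x))\<^sup>2 = (ln (norm x / norm y))\<^sup>2"
    proof (cases "x = 0 \<or> y = 0")
      case False
      then have "ln (norm y / norm x) = - ln (norm x / norm y)" by (simp add: ln_div)
      then show ?thesis by simp
    qed auto
    then show "log_kernel g s x y = log_kernel g s y x"
      by (simp add: log_kernel_def kap.sym[of x y] add.commute)
    show "log_kernel g s (c *\<^sub>R x) (c *\<^sub>R y) = log_kernel g s x y" if "0 < c" for c
      using that by (simp add: log_kernel_def kap.scale)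
    show "log_kernel g s (reflection a x) (reflection a y) = log_kernel g s x y" for a
      by (simp add: log_kernel_def kap.refl)
    show "log_kernel g s x 0 = 0" by (simp add: log_kernel_def)
  qed
qed

lemma ln_square_le:
  fixes e M :: real
  assumes "0 < e" "1 \<le> M"
  shows "(ln M)\<^sup>2 \<le> (2 / e)\<^sup>2 * M powr e"
proof -
  have "ln (M powr (e / 2)) \<le> M powr (e / 2)" using assms by (intro order.strict_implies_order ln_less_self) auto
  then have "ln M \<le> 2 / e * M powr (e / 2)" using assms by (simp add: ln_powr field_simps)
  then have "(ln M)\<^sup>2 \<le> (2 / e * M powr (e / 2))\<^sup>2" using assms by (intro power_mono) auto
  also have "\<dots> = (2 / e)\<^sup>2 * M powr e"
    unfolding power_mult_distrib by (simp add: power2_eq_square powr_add[symmetric])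
  finally show ?thesis .
qed

text \<open>Near a unit vector \<open>abs (ln (norm y)) <= 2 * norm (e - y)\<close>, so the squared
  logarithm removes two powers of the distance. The remaining exponent
  \<open>2 - m = - n + (2 - 2 * s)\<close> is integrable for \<open>s < 1\<close>.\<close>

lemma log_kernel_near:
  fixes e y :: "real^'n::finite"
  assumes e: "norm e = 1" and y: "norm (e - y) \<le> 1/2" "y \<noteq> e" and s: "0 < s" and g: "0 \<le> g"
  defines "m \<equiv> real CARD('n) + 2 * s"
  shows "log_kernel g s e y \<le> 8 * 2 powr g * 2 powr (m / 2) * norm (e - y) powr (2 - m)"
    and "1/2 \<le> norm y"
proof -
  let ?r = "norm y" and ?d = "norm (e - y)"
  have r: "1/2 \<le> ?r" "?r \<le> 3/2" "\<bar>?r - 1\<bar> \<le> ?d"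
    using norm_triangle_ineq3[of y e] y e by (auto simp: norm_minus_commute abs_le_iff)
  show "1/2 \<le> norm y" by (rule r)
  then have r0: "?r \<noteq> 0" by auto
  have d: "0 < ?d" using y by simp
  have m: "0 < m" using s by (simp add: m_def)
  have "\<bar>ln ?r\<bar> \<le> 2 * \<bar>?r - 1\<bar>"
  proof (cases "1 \<le> ?r")
    case True
    then have "ln ?r \<le> ?r - 1" "0 \<le> ln ?r" using r by (auto intro!: ln_le_minus_one)
    moreover have "?r - 1 \<le> 2 * (?r - 1)" using True by simp
    ultimately have "ln ?r \<le> 2 * (?r - 1)" by (meson order_trans)
    then show ?thesis using True \<open>0 \<le> ln ?r\<close> by simp
  next
    case False
    have "ln (1 / ?r) \<le> 1 / ?r - 1" using r by (intro ln_le_minus_one) auto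
    also have "\<dots> = (1 - ?r) / ?r" using r0 by (simp add: diff_divide_distrib)
    also have "\<dots> \<le> (1 - ?r) / (1/2)" using False r by (intro divide_left_mono) auto
    finally have "- ln ?r \<le> 2 * (1 - ?r)" using r0 by (simp add: ln_div split: if_splits)
    moreover have "ln ?r \<le> 0"
      using ln_le_minus_one[of ?r] r0 False by simp
    ultimately show ?thesis using False by simp
  qed
  then have "\<bar>ln ?r\<bar> \<le> 2 * ?d" by (rule order_trans[OF _ mult_left_mono[OF r(3)]]) simp
  then have "(ln ?r)\<^sup>2 \<le> (2 * ?d)\<^sup>2" by (rule abs_le_square_iff[THEN iffD1, OF order_trans]) auto
  then have l: "(ln ?r)\<^sup>2 \<le> 4 * ?d powr 2" using d by (simp add: power_mult_distrib)
  have "0 < ?r" using r0 by simp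
  then have inv: "1 / ?r \<le> 2" using r(1) by (simp add: pos_divide_le_eq)
  have p: "?r powr g \<le> 2 powr g" "(1 / ?r) powr g \<le> 2 powr g" "?r powr (m / 2) \<le> 2 powr (m / 2)"
    using r g m inv by (auto intro!: powr_mono2)
  have "log_kernel g s e y = (ln ?r)\<^sup>2 * (?r powr g + (1 / ?r) powr g) * (?r powr (m / 2) * ?d powr - m)"
    by (simp only: powr_minus_divide) (simp add: e log_kernel_def kap_def m_def)
  also have "\<dots> \<le> (4 * ?d powr 2) * (2 powr g + 2 powr g) * (2 powr (m / 2) * ?d powr - m)"
    using l p by (intro mult_mono add_mono) auto
  also have "\<dots> = 8 * 2 powr g * 2 powr (m / 2) * (?d powr 2 * ?d powr - m)" by simp
  also have "?d powr 2 * ?d powr - m = ?d powr (2 - m)" by (simp only: powr_add[symmetric]) simp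
  finally show "log_kernel g s e y \<le> 8 * 2 powr g * 2 powr (m / 2) * ?d powr (2 - m)" .
qed

text \<open>With \<open>M\<close> the larger of \<open>norm y\<close> and its inverse,
  \<open>kap\<close> decays like \<open>M powr (- m / 2)\<close>, the weights grow like
  \<open>M powr g\<close>, and the logarithm costs an arbitrarily small power
  \<open>h\<close>.\<close>

lemma log_kernel_away:
  fixes e y :: "real^'n::finite"
  assumes e: "norm e = 1" and y: "1/2 < norm (e - y)" "y \<noteq> 0" and s: "0 < s" and g: "0 \<le> g"
    and h: "0 < h"
  defines "m \<equiv> real CARD('n) + 2 * s" and "M \<equiv> max (norm y) (1 / norm y)"
  shows "log_kernel g s e y \<le> (2 / h)\<^sup>2 * 2 * 4 powr m * M powr (g + h - m / 2)"
proof -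
  let ?r = "norm y" and ?d = "norm (e - y)"
  have r: "0 < ?r" using y by simp
  have m: "0 < m" using s by (simp add: m_def)
  have M: "1 \<le> M" "?r \<le> M" "1 / ?r \<le> M"
    using r by (auto simp: M_def le_max_iff_disj)
  have "\<bar>ln ?r\<bar> = ln M"
  proof (cases "1 \<le> ?r")
    case True
    then have "1 / ?r \<le> ?r" using r by (smt (verit) divide_le_eq_1_pos)
    then show ?thesis using True by (simp add: M_def max_def)
  next
    case False
    then have "?r \<le> 1 / ?r" using r by (smt (verit) le_divide_eq_1_pos)
    then show ?thesis using False r by (auto simp: M_def max_def ln_div)
  qed
  then have "(ln ?r)\<^sup>2 = (ln M)\<^sup>2" by (metis power2_abs)
  then have l: "(ln ?r)\<^sup>2 \<le> (2 / h)\<^sup>2 * M powr h" using ln_square_le[OF h M(1)] by simp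
  have p: "?r powr g + (1 / ?r) powr g \<le> 2 * M powr g"
    using powr_mono2[OF g _ M(2)] powr_mono2[OF g _ M(3)] r by simp
  have k: "?r powr (m / 2) / ?d powr m \<le> 4 powr m * M powr - (m / 2)"
  proof -
    have tri: "?r - 1 \<le> ?d" using norm_triangle_ineq2[of y e] e by (simp add: norm_minus_commute)
    \<comment> \<open>One inequality for both ends: for \<open>norm y >= 1\<close> the distance is
      at least \<open>norm y / 4\<close>, and for \<open>norm y < 1\<close> it is bounded below by a
      constant.\<close>
    have q: "?r \<le> 16 * M powr -1 * ?d\<^sup>2"
    proof (cases "1 \<le> ?r")
      case True
      then have "1 / ?r \<le> ?r" using r by (smt (verit) divide_le_eq_1_pos)
      then have MM: "M = ?r" by (simp add: M_def)
      have "?r / 4 \<le> ?d" using tri y True by linarith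
      then have "(?r / 4)\<^sup>2 \<le> ?d\<^sup>2" using r by (intro power_mono) auto
      then have "?r * ?r \<le> 16 * ?d\<^sup>2" by (simp add: power2_eq_square)
      then show ?thesis using r by (simp add: MM powr_minus field_simps)
    next
      case False
      then have "?r \<le> 1 / ?r" using r by (smt (verit) le_divide_eq_1_pos)
      then have MM: "M = 1 / ?r" by (simp add: M_def)
      have "(1/4)\<^sup>2 \<le> ?d\<^sup>2" using y by (intro power_mono) auto
      then have "?r * 1 \<le> ?r * (16 * ?d\<^sup>2)" using r by (intro mult_left_mono) (auto simp: power2_eq_square)
      then show ?thesis using r by (simp add: MM powr_minus field_simps)
    qed
    have "?r powr (m / 2) \<le> (16 * M powr -1 * ?d\<^sup>2) powr (m / 2)"
      using q r m by (intro powr_mono2) auto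
    also have "\<dots> = 4 powr m * M powr - (m / 2) * ?d powr m"
    proof -
      have "(16::real) powr (m / 2) = 4 powr m"
        using power2_powr_half[of 4 m] by simp
      moreover have "(?d\<^sup>2) powr (m / 2) = ?d powr m"
        using y by (intro power2_powr_half) auto
      ultimately show ?thesis by (simp only: powr_mult powr_powr) simp
    qed
    finally show ?thesis using y by (simp add: divide_le_eq)
  qed
  have "log_kernel g s e y = (ln ?r)\<^sup>2 * (?r powr g + (1 / ?r) powr g) * (?r powr (m / 2) / ?d powr m)"
    using e by (simp add: log_kernel_def kap_def m_def)
  also have "\<dots> \<le> ((2 / h)\<^sup>2 * M powr h) * (2 * M powr g) * (4 powr m * M powr - (m / 2))"
    using l p k by (intro mult_mono) auto
  also have "\<dots> = (2 / h)\<^sup>2 * 2 * 4 powr m * (M powr g * M powr h * M powr - (m / 2))" by simp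
  also have "M powr g * M powr h * M powr - (m / 2) = M powr (g + h - m / 2)"
    by (simp add: powr_add[symmetric])
  finally show ?thesis .
qed

text \<open>The condition \<open>s < 1\<close> guards the diagonal, and
  \<open>g < (n + 2s) / 2\<close> guards the origin and infinity. The latter is
  \<open>- 2s < alpha\<close> in disguise.\<close>

lemma weight_log_kernel_finite:
  assumes s: "0 < s" "s < 1" and g: "0 \<le> g" "g < (real CARD('n) + 2 * s) / 2"
  shows "weight 0 (log_kernel g s :: real^'n::finite \<Rightarrow> _) < \<infinity>"
proof -
  define N where "N = real CARD('n)"
  define m where "m = N + 2 * s"
  \<comment> \<open>Half of the decay \<open>m / 2 - g\<close> pays for the logarithm; the other
    half is the exponent \<open>c\<close> left for integrability.\<close>
  define h where "h = ((m / 2) - g) / 2"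
  have h: "0 < h" using g by (simp add: h_def m_def N_def)
  define c where "c = m / 2 - g - h"
  have hh: "m / 2 - g = 2 * h" by (simp add: h_def)
  have c: "0 < c" using h unfolding c_def hh by simp
  define e where "e = (1 / norm (1::real^'n)) *\<^sub>R (1::real^'n)"
  have e: "norm e = 1" by (simp add: e_def)
  then have e0: "e \<noteq> 0" by auto
  interpret invariant_kernel "log_kernel g s :: real^'n \<Rightarrow> _" by (rule invariant_kernel_log_kernel)
  define C1 where "C1 = 2 powr N * (8 * 2 powr g * 2 powr (m / 2))"
  define C2 where "C2 = (2 / h)\<^sup>2 * 2 * 4 powr m"
  have C: "0 \<le> C1" "0 \<le> C2" by (auto simp: C1_def C2_def)
  \<comment> \<open>The singularity sits at \<open>e\<close>, where the density of \<open>mu\<close>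
    is harmless. Writing the bound with the density centred at \<open>e\<close> turns it into a
    \<open>mu\<close>-integral near 0 after a translation.\<close>
  let ?near = "\<lambda>y::real^'n. ennreal (norm (y - e) powr - N) * (ennreal (norm (y - e) powr (2 - 2 * s)) * indicator {z. norm z \<le> 1/2} (y - e))"
  let ?B = "\<lambda>y::real^'n. ennreal (norm y powr c) * indicator {x. norm x \<le> 1} y"
  let ?T = "\<lambda>y::real^'n. ennreal (norm y powr - c) * indicator {x. 1 \<le> norm x} y"
  have nonneg_ln: "0 \<le> log_kernel g s e y" for y by (rule nonneg)
  have pt: "ennreal (norm y powr - N) * ennreal ((norm y / norm e) powr 0 * log_kernel g s e y) \<le>
     ennreal C1 * ?near y + ennreal (norm y powr - N) * (ennreal C2 * (?B y + ?T y))"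
    if y: "y \<noteq> 0" "y \<noteq> e" for y :: "real^'n"
  proof (cases "norm (e - y) \<le> 1/2")
    case True
    have near: "log_kernel g s e y \<le> 8 * 2 powr g * 2 powr (m / 2) * norm (e - y) powr (2 - m)" "1/2 \<le> norm y"
      using log_kernel_near[OF e True y(2) s(1) g(1)] by (auto simp: m_def N_def)
    have "norm y powr - N \<le> (1/2) powr - N" using near by (intro powr_mono2') (auto simp: N_def)
    also have "(1/2) powr - N = 2 powr N" by (simp add: powr_minus powr_divide)
    finally have "norm y powr - N * log_kernel g s e y \<le> 2 powr N * (8 * 2 powr g * 2 powr (m / 2) * norm (e - y) powr (2 - m))"
      using near nonneg_ln by (intro mult_mono) auto
    also have "\<dots> = C1 * (norm (y - e) powr - N * norm (y - e) powr (2 - 2 * s))"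
    proof -
      have "2 - m = - N + (2 - 2 * s)" by (simp add: m_def)
      then show ?thesis by (simp only: powr_add) (simp add: C1_def norm_minus_commute)
    qed
    finally have "ennreal (norm y powr - N * log_kernel g s e y) \<le> ennreal (C1 * (norm (y - e) powr - N * norm (y - e) powr (2 - 2 * s)))"
      by (rule ennreal_leI)
    also have "\<dots> = ennreal C1 * ?near y"
      using True C by (simp add: ennreal_mult norm_minus_commute)
    finally have "ennreal (norm y powr - N * log_kernel g s e y) \<le> ennreal C1 * ?near y + ennreal (norm y powr - N) * (ennreal C2 * (?B y + ?T y))"
      by (rule order_trans) simp
    then show ?thesis using y e by (simp add: ennreal_mult')
  next
    case False
    have "log_kernel g s e y \<le> C2 * max (norm y) (1 / norm y) powr (g + h - m / 2)"
      using log_kernel_away[OF e _ y(1) s(1) g(1) h] False by (auto simp: C2_def m_def N_def)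
    also have "g + h - m / 2 = - c" by (simp add: c_def)
    finally have "ennreal (log_kernel g s e y) \<le> ennreal (C2 * max (norm y) (1 / norm y) powr - c)"
      by (rule ennreal_leI)
    also have "\<dots> \<le> ennreal C2 * (?B y + ?T y)"
    proof (cases "1 \<le> norm y")
      case True
      then have "1 / norm y \<le> norm y" using y by (smt (verit) divide_le_eq_1_pos)
      then show ?thesis using True C by (simp add: ennreal_mult mult_left_mono)
    next
      case False
      then have "norm y \<le> 1 / norm y" using y by (smt (verit) le_divide_eq_1_pos zero_less_norm_iff)
      moreover have "(1 / norm y) powr - c = norm y powr c" using y by (simp add: powr_divide powr_minus)
      ultimately show ?thesis using False C by (simp add: ennreal_mult)
    qed
    finally have "ennreal (norm y powr - N) * ennreal (log_kernel g s e y) \<le> ennreal (norm y powr - N) * (ennreal C2 * (?B y + ?T y))"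
      by (intro mult_left_mono) auto
    then have "ennreal (norm y powr - N) * ennreal (log_kernel g s e y) \<le> ennreal C1 * ?near y + ennreal (norm y powr - N) * (ennreal C2 * (?B y + ?T y))"
      by (rule order_trans) simp
    then show ?thesis using y e by simp
  qed
  have "weight 0 (log_kernel g s :: real^'n \<Rightarrow> _) = (\<integral>\<^sup>+y. ennreal ((norm y / norm e) powr 0 * log_kernel g s e y) \<partial>mu)"
    by (rule weight_eq[OF e0, symmetric])
  also have "\<dots> = (\<integral>\<^sup>+y. ennreal (norm y powr - N) * ennreal ((norm y / norm e) powr 0 * log_kernel g s e y) \<partial>lborel)"
    unfolding N_def by (rule nn_integral_mu) measurable
  also have "\<dots> \<le> (\<integral>\<^sup>+y. ennreal C1 * ?near y + ennreal (norm y powr - N) * (ennreal C2 * (?B y + ?T y)) \<partial>lborel)"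
    by (rule nn_integral_mono_AE, use AE_lborel_singleton[of "0::real^'n"] AE_lborel_singleton[of e] in eventually_elim) (rule pt)
  also have "\<dots> = ennreal C1 * (\<integral>\<^sup>+y. ?near y \<partial>lborel) + (\<integral>\<^sup>+y. ennreal (norm y powr - N) * (ennreal C2 * (?B y + ?T y)) \<partial>lborel)"
    by (subst nn_integral_add) (auto simp: nn_integral_cmult)
  also have "(\<integral>\<^sup>+y. ?near y \<partial>lborel) = (\<integral>\<^sup>+z. ennreal (norm z powr - N) * (ennreal (norm z powr (2 - 2 * s)) * indicator {z::real^'n. norm z \<le> 1/2} z) \<partial>lborel)"
    using nn_integral_lborel_shift[of "\<lambda>z::real^'n. ennreal (norm z powr - N) * (ennreal (norm z powr (2 - 2 * s)) * indicator {z. norm z \<le> 1/2} z)" "- e"]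
    by simp
  also have "\<dots> = (\<integral>\<^sup>+z. ennreal (norm z powr (2 - 2 * s)) * indicator {z::real^'n. norm z \<le> 1/2} z \<partial>mu)"
    unfolding N_def by (rule nn_integral_mu[symmetric]) measurable
  also have "(\<integral>\<^sup>+y. ennreal (norm y powr - N) * (ennreal C2 * (?B y + ?T y)) \<partial>lborel) = (\<integral>\<^sup>+y. ennreal C2 * (?B y + ?T y) \<partial>mu)"
    unfolding N_def by (rule nn_integral_mu[symmetric]) measurable
  also have "\<dots> = ennreal C2 * ((\<integral>\<^sup>+y. ?B y \<partial>mu) + (\<integral>\<^sup>+y. ?T y \<partial>mu))"
    by (subst nn_integral_cmult, measurable, subst nn_integral_add) auto
  also have "ennreal C1 * (\<integral>\<^sup>+z. ennreal (norm z powr (2 - 2 * s)) * indicator {z::real^'n. norm z \<le> 1/2} z \<partial>mu)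
     + ennreal C2 * ((\<integral>\<^sup>+y. ?B y \<partial>mu) + (\<integral>\<^sup>+y. ?T y \<partial>mu)) < \<infinity>"
    using nn_integral_mu_power_ball[of "2 - 2 * s" "1/2", where 'n = 'n] nn_integral_mu_power_ball[OF c, of 1, where 'n = 'n]
      nn_integral_mu_power_at_top[OF c, where 'n = 'n] s by (simp add: ennreal_mult_less_top)
  finally show ?thesis .
qed

text \<open>The square expands into two powers of the ratio with exponents \<open>g\<close> and
  \<open>- g\<close> and a mixed term free of \<open>g\<close>, so it is convex in \<open>g\<close>.
  The energy of the cutoff is thus bounded for all alpha in the range by its values at the exponents
  0 and \<open>k\<close>.\<close>

lemma Qform_convex:
  assumes "invariant_kernel K" and [measurable]: "f \<in> borel_measurable borel" and g: "0 \<le> g" "g \<le> k"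
  shows "Qform g K f \<le> Qform 0 K f + Qform k K f"
proof (cases "k = 0")
  case False
  interpret invariant_kernel K by fact
  let ?D = "\<lambda>g x y. (tdiff g f x y)\<^sup>2"
  define t where "t = g / k"
  have t: "0 \<le> t" "t \<le> 1" "g = k * t" using g False by (auto simp: t_def)
  have "Qform g K f \<le> (\<integral>\<^sup>+x. (\<integral>\<^sup>+y. ennreal (?D 0 x y * K x y) + ennreal (?D k x y * K x y) \<partial>mu) \<partial>mu)"
    unfolding Qform_def
  proof (rule nn_integral2_mu_mono)
    fix x y :: "real^'a" assume xy: "x \<noteq> 0" "y \<noteq> 0"
    let ?r = "norm y / norm x" and ?q = "norm x / norm y"
    have expand: "?D g x y = (f x)\<^sup>2 * ?r powr g + (f y)\<^sup>2 * ?q powr g - 2 * f x * f y" for g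
    proof -
      have "?r powr g = (?r powr (g/2))\<^sup>2" "?q powr g = (?q powr (g/2))\<^sup>2"
        by (simp_all add: power2_eq_square flip: powr_add)
      moreover have "?r powr (g/2) * ?q powr (g/2) = 1"
        using xy by (simp add: powr_mult[symmetric])
      ultimately show ?thesis by (simp add: power2_eq_square) algebra
    qed
    have "?r powr g \<le> (1 - t) + t * ?r powr k" "?q powr g \<le> (1 - t) + t * ?q powr k"
      unfolding t(3) powr_powr[symmetric] using xy t by (auto intro!: powr_le_interpolate)
    then have "(f x)\<^sup>2 * ?r powr g + (f y)\<^sup>2 * ?q powr g \<le> (f x)\<^sup>2 * ((1 - t) + t * ?r powr k) + (f y)\<^sup>2 * ((1 - t) + t * ?q powr k)"
      by (intro add_mono mult_left_mono) auto
    moreover have d0: "?D 0 x y = (f x)\<^sup>2 + (f y)\<^sup>2 - 2 * f x * f y"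
      unfolding expand using xy by simp
    ultimately have "?D g x y \<le> (1 - t) * ?D 0 x y + t * ?D k x y"
      unfolding expand[of g] expand[of k] d0 by (simp add: algebra_simps)
    also have "\<dots> \<le> 1 * ?D 0 x y + 1 * ?D k x y"
      using t by (intro add_mono mult_right_mono) auto
    finally have "?D g x y * K x y \<le> (?D 0 x y + ?D k x y) * K x y"
      by (intro mult_right_mono nonneg) simp
    then have "ennreal (?D g x y * K x y) \<le> ennreal (?D 0 x y * K x y + ?D k x y * K x y)"
      unfolding distrib_right by (rule ennreal_leI)
    also have "\<dots> = ennreal (?D 0 x y * K x y) + ennreal (?D k x y * K x y)"
      by (rule ennreal_plus) (simp_all add: nonneg)
    finally show "ennreal (?D g x y * K x y) \<le> ennreal (?D 0 x y * K x y) + ennreal (?D k x y * K x y)" .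
  qed
  also have "\<dots> = Qform 0 K f + Qform k K f"
    unfolding Qform_def by (rule nn_integral2_mu_add) measurable
  finally show ?thesis .
qed (use g in auto)

section \<open>Energy and mass of the logarithmic cutoff\<close>

definition annulus :: "real \<Rightarrow> (real^'n::finite) set" where
  "annulus T = {x. exp (- T) \<le> norm x \<and> norm x \<le> exp T}"

lemma annulus_measurable [measurable]: "annulus T \<in> sets borel"
  unfolding annulus_def by measurable

lemma measurable_cutoff [measurable]: "cutoff T \<in> borel_measurable (borel :: (real^'n::finite) measure)"
proof -
  have [measurable]: "bump 0 \<in> borel_measurable borel"
    unfolding bump_def[abs_def] by measurable
  show ?thesis unfolding cutoff_def[abs_def] by measurable
qed

lemma cutoff_bounds: "0 \<le> cutoff T x" "cutoff T x \<le> 1"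
  unfolding cutoff_def using bump_0_bounds by (auto intro!: mult_le_one mult_nonneg_nonneg)

lemma cutoff_le_indicator: "x \<noteq> 0 \<Longrightarrow> 0 < T \<Longrightarrow> cutoff T x \<le> indicator (annulus T) x"
  using cutoff_support[of x T] cutoff_bounds[of T x] by (cases "cutoff T x = 0") (auto simp: annulus_def indicator_def)

lemma emeasure_annulus: "emeasure mu (annulus T :: (real^'n::finite) set) < \<infinity>"
  unfolding annulus_def by (rule emeasure_annulus_finite) simp

lemma cutoff_diff_le:
  fixes x y :: "real^'n::finite"
  assumes "x \<noteq> 0" "y \<noteq> 0" and T: "0 < T"
  shows "\<bar>cutoff T x - cutoff T y\<bar> \<le> 2 / T * \<bar>ln (norm y / norm x)\<bar>"
proof -
  let ?t = "ln (norm x) / T" and ?q = "ln (norm y) / T"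
  have tq: "\<bar>?t - ?q\<bar> = \<bar>ln (norm y / norm x)\<bar> / T"
    using assms by (simp add: ln_div diff_divide_distrib[symmetric] abs_divide abs_minus_commute)
  have "cutoff T x - cutoff T y = bump 0 (1 + ?t) * (bump 0 (1 - ?t) - bump 0 (1 - ?q))
    + (bump 0 (1 + ?t) - bump 0 (1 + ?q)) * bump 0 (1 - ?q)"
    using assms by (simp add: cutoff_eq algebra_simps)
  also have "\<bar>\<dots>\<bar> \<le> \<bar>bump 0 (1 + ?t)\<bar> * \<bar>bump 0 (1 - ?t) - bump 0 (1 - ?q)\<bar>
    + \<bar>bump 0 (1 + ?t) - bump 0 (1 + ?q)\<bar> * \<bar>bump 0 (1 - ?q)\<bar>"
    by (rule order_trans[OF abs_triangle_ineq]) (simp only: abs_mult order_refl)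
  also have "\<dots> \<le> 1 * \<bar>?t - ?q\<bar> + \<bar>?t - ?q\<bar> * 1"
  proof -
    have "\<bar>bump 0 t\<bar> \<le> 1" for t using bump_0_bounds[of t] by simp
    moreover have "\<bar>(1 - ?t) - (1 - ?q)\<bar> = \<bar>?t - ?q\<bar>" "\<bar>(1 + ?t) - (1 + ?q)\<bar> = \<bar>?t - ?q\<bar>" by auto
    ultimately show ?thesis
      using bump_0_lipschitz[of "1 - ?t" "1 - ?q"] bump_0_lipschitz[of "1 + ?t" "1 + ?q"]
      by (intro add_mono mult_mono) simp_all
  qed
  also have "\<dots> = 2 / T * \<bar>ln (norm y / norm x)\<bar>" by (simp add: tq)
  finally show ?thesis .
qed

lemma abs_exp_diff_le: "\<bar>exp u - exp (- u)\<bar> \<le> 2 * \<bar>u\<bar> * exp \<bar>u::real\<bar>"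
proof -
  have *: "exp u - exp (- u) \<le> 2 * u * exp u" for u :: real
  proof -
    have "1 + - (2 * u) \<le> exp (- (2 * u))" by (rule exp_ge_add_one_self)
    then have "exp u * (1 - exp (- (2 * u))) \<le> exp u * (2 * u)" by (intro mult_left_mono) auto
    moreover have "exp u * exp (- (2 * u)) = exp (- u)" by (simp flip: exp_add)
    ultimately show ?thesis by (simp add: algebra_simps)
  qed
  show ?thesis
  proof (cases "0 \<le> u")
    case True
    then have "exp (- u) \<le> exp u" by simp
    then show ?thesis using *[of u] True by simp
  next
    case False
    then have "exp u \<le> exp (- u)" by simp
    then show ?thesis using *[of "- u"] False by simp
  qed
qed

text \<open>With \<open>r\<close> the ratio of norms, \<open>tdiff\<close> splits into
  \<open>(f x - f y) * r powr (g / 2)\<close>, governed by the Lipschitz constant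
  \<open>2 / T\<close>, and \<open>f y * (r powr (g / 2) - r powr (- g / 2))\<close>, governed by
  \<open>g * ln r\<close>. For \<open>g = 0\<close> only the order \<open>1 / T^2\<close>
  remains.\<close>

lemma Qform_cutoff_le:
  fixes T g s :: real
  assumes T: "0 < T" and g: "0 \<le> g"
  shows "Qform g (kap s) (cutoff T :: real^'n::finite \<Rightarrow> real) \<le>
    ennreal (8 / T\<^sup>2 + 2 * g\<^sup>2) * (2 * weight 0 (log_kernel g s :: real^'n \<Rightarrow> _) * emeasure mu (annulus T :: (real^'n) set))"
proof -
  let ?f = "cutoff T :: real^'n \<Rightarrow> real" and ?c = "8 / T\<^sup>2 + 2 * g\<^sup>2"
  let ?i = "indicator (annulus T) :: real^'n \<Rightarrow> real"
  interpret kap: invariant_kernel "kap s :: real^'n \<Rightarrow> _" by (rule invariant_kernel_kap)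
  interpret L: invariant_kernel "log_kernel g s :: real^'n \<Rightarrow> _" by (rule invariant_kernel_log_kernel)
  have c: "0 \<le> ?c" by simp
  have "Qform g (kap s) ?f \<le> (\<integral>\<^sup>+x. (\<integral>\<^sup>+y. ennreal ?c * ennreal (((?i x)\<^sup>2 * (norm y / norm x) powr 0
      + (?i y)\<^sup>2 * (norm x / norm y) powr 0) * log_kernel g s x y) \<partial>mu) \<partial>mu)"
    unfolding Qform_def
  proof (rule nn_integral2_mu_mono)
    fix x y :: "real^'n" assume xy: "x \<noteq> 0" "y \<noteq> 0"
    let ?r = "norm y / norm x" and ?q = "norm x / norm y"
    let ?D = "?f x * ?r powr (g / 2) - ?f y * ?q powr (g / 2)"
    define l where "l = ln ?r"
    have r: "0 < ?r" using xy by simp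
    have q: "?q = exp (- l)" "?r = exp l"
      using xy by (simp_all add: l_def exp_minus)
    have P: "?r powr a = exp (a * l)" "?q powr a = exp (- (a * l))" for a
      unfolding q by (simp_all add: powr_def)
    define S where "S = ?r powr g + ?q powr g"
    have S: "?r powr g \<le> S" "0 \<le> S" by (simp_all add: S_def)
    have "(exp (g * l / 2) - exp (- (g * l / 2)))\<^sup>2 \<le> (2 * \<bar>g * l / 2\<bar> * exp \<bar>g * l / 2\<bar>)\<^sup>2"
      using abs_exp_diff_le[of "g * l / 2"] by (intro abs_le_square_iff[THEN iffD1]) auto
    also have "\<dots> = g\<^sup>2 * l\<^sup>2 * exp \<bar>g * l\<bar>"
      by (simp add: power_mult_distrib power2_eq_square exp_add[symmetric] abs_mult mult_ac)
    also have "\<dots> \<le> g\<^sup>2 * l\<^sup>2 * S"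
    proof -
      have "exp \<bar>g * l\<bar> \<le> S" unfolding S_def P by (cases "0 \<le> g * l") auto
      then show ?thesis by (intro mult_left_mono) auto
    qed
    finally have 1: "(exp (g * l / 2) - exp (- (g * l / 2)))\<^sup>2 \<le> g\<^sup>2 * l\<^sup>2 * S" .
    have f: "0 \<le> ?f x" "?f x \<le> ?i x" "0 \<le> ?f y" "?f y \<le> ?i y"
      using cutoff_bounds cutoff_le_indicator xy T by auto
    have "(?f y)\<^sup>2 \<le> (?i y)\<^sup>2" using f by (intro power_mono) auto
    also have "\<dots> \<le> (?i x)\<^sup>2 + (?i y)\<^sup>2" by simp
    finally have fy2: "(?f y)\<^sup>2 \<le> (?i x)\<^sup>2 + (?i y)\<^sup>2" .
    have fd: "(?f x - ?f y)\<^sup>2 \<le> (4 / T\<^sup>2) * l\<^sup>2 * ((?i x)\<^sup>2 + (?i y)\<^sup>2)"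
    proof (cases "x \<in> annulus T \<or> y \<in> annulus T")
      case True
      have "(?f x - ?f y)\<^sup>2 \<le> (2 / T * \<bar>l\<bar>)\<^sup>2"
        using cutoff_diff_le[OF xy T] T unfolding l_def by (intro abs_le_square_iff[THEN iffD1]) auto
      also have "\<dots> = (4 / T\<^sup>2) * l\<^sup>2 * 1" by (simp add: power_mult_distrib power_divide)
      also have "\<dots> \<le> (4 / T\<^sup>2) * l\<^sup>2 * ((?i x)\<^sup>2 + (?i y)\<^sup>2)"
        using True by (intro mult_left_mono) auto
      finally show ?thesis .
    next
      case False
      then show ?thesis using f by simp
    qed
    have "?D = (?f x - ?f y) * ?r powr (g / 2) + ?f y * (exp (g * l / 2) - exp (- (g * l / 2)))"
      unfolding P by (simp add: algebra_simps)
    also have "\<dots>\<^sup>2 \<le> 2 * ((?f x - ?f y) * ?r powr (g / 2))\<^sup>2 + 2 * (?f y * (exp (g * l / 2) - exp (- (g * l / 2))))\<^sup>2"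
    proof -
      have "(a + b)\<^sup>2 \<le> 2 * a\<^sup>2 + 2 * b\<^sup>2" for a b :: real
        using zero_le_power2[of "a - b"] by (simp add: power2_eq_square algebra_simps)
      then show ?thesis .
    qed
    also have "\<dots> = 2 * ((?f x - ?f y)\<^sup>2 * ?r powr g) + 2 * ((?f y)\<^sup>2 * (exp (g * l / 2) - exp (- (g * l / 2)))\<^sup>2)"
    proof -
      have "(?r powr (g / 2))\<^sup>2 = ?r powr g" by (simp add: power2_eq_square flip: powr_add)
      then show ?thesis by (simp only: power_mult_distrib)
    qed
    also have "\<dots> \<le> 2 * (((4 / T\<^sup>2) * l\<^sup>2 * ((?i x)\<^sup>2 + (?i y)\<^sup>2)) * S) + 2 * (((?i x)\<^sup>2 + (?i y)\<^sup>2) * (g\<^sup>2 * l\<^sup>2 * S))"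
      using fd S 1 fy2 by (intro add_mono mult_left_mono mult_mono) auto
    also have "\<dots> = ?c * (((?i x)\<^sup>2 + (?i y)\<^sup>2) * (l\<^sup>2 * S))"
      by (simp add: algebra_simps)
    finally have "?D\<^sup>2 \<le> ?c * (((?i x)\<^sup>2 + (?i y)\<^sup>2) * (l\<^sup>2 * S))" .
    then have "?D\<^sup>2 * kap s x y \<le> (?c * (((?i x)\<^sup>2 + (?i y)\<^sup>2) * (l\<^sup>2 * S))) * kap s x y"
      by (intro mult_right_mono kap.nonneg)
    also have "\<dots> = ?c * (((?i x)\<^sup>2 + (?i y)\<^sup>2) * log_kernel g s x y)"
      by (simp add: log_kernel_def l_def S_def)
    finally have "ennreal (?D\<^sup>2 * kap s x y) \<le> ennreal (?c * (((?i x)\<^sup>2 + (?i y)\<^sup>2) * log_kernel g s x y))"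
      by (rule ennreal_leI)
    also have "\<dots> = ennreal ?c * ennreal (((?i x)\<^sup>2 * ?r powr 0 + (?i y)\<^sup>2 * ?q powr 0) * log_kernel g s x y)"
      using xy by (simp only: ennreal_mult'[OF c]) simp
    finally show "ennreal (?D\<^sup>2 * kap s x y) \<le> ennreal ?c * ennreal (((?i x)\<^sup>2 * ?r powr 0 + (?i y)\<^sup>2 * ?q powr 0) * log_kernel g s x y)" .
  qed
  also have "\<dots> = ennreal ?c * (2 * weight 0 (log_kernel g s :: real^'n \<Rightarrow> _) * L2sq ?i)"
    by (subst nn_integral2_mu_cmult, measurable, subst L.weight_both) auto
  also have "L2sq ?i = emeasure mu (annulus T :: (real^'n) set)"
  proof -
    have "L2sq ?i = (\<integral>\<^sup>+x. indicator (annulus T :: (real^'n) set) x \<partial>mu)"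
      unfolding L2sq_def by (intro nn_integral_cong) (auto simp: indicator_def)
    then show ?thesis by simp
  qed
  finally show ?thesis .
qed

text \<open>Two dilates of the annulus of half the logarithmic width cover the full one, hence the
  factor 1/2. On the half annulus each of the two bump factors is at least \<open>exp (- 2)\<close>,
  so the square of their product is at least \<open>exp (- 8)\<close>.\<close>

lemma L2sq_cutoff_ge:
  assumes T: "0 < T"
  shows "ennreal (exp (- 8) / 2) * emeasure mu (annulus T :: (real^'n::finite) set) \<le> L2sq (cutoff T :: real^'n \<Rightarrow> real)"
proof -
  let ?H = "annulus (T / 2) :: (real^'n) set"
  have half: "emeasure mu (annulus T :: (real^'n) set) \<le> 2 * emeasure mu ?H"
  proof -
    have "emeasure mu (annulus T :: (real^'n) set) = (\<integral>\<^sup>+x. indicator (annulus T :: (real^'n) set) x \<partial>mu)" by simp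
    also have "\<dots> \<le> (\<integral>\<^sup>+x. indicator ?H (exp (T / 2) *\<^sub>R x) + indicator ?H (exp (- T / 2) *\<^sub>R x) \<partial>mu)"
    proof (rule nn_integral_mono)
      fix x :: "real^'n"
      have "exp (T / 2) *\<^sub>R x \<in> ?H \<or> exp (- T / 2) *\<^sub>R x \<in> ?H" if "x \<in> annulus T"
      proof (cases "norm x \<le> 1")
        case True
        have "exp (T / 2) * exp (- T) \<le> exp (T / 2) * norm x"
          using that by (intro mult_left_mono) (auto simp: annulus_def)
        moreover have "exp (T / 2) * exp (- T) = exp (- (T / 2))" by (simp flip: exp_add)
        ultimately show ?thesis using True by (simp add: annulus_def)
      next
        case False
        have "exp (- T / 2) * norm x \<le> exp (- T / 2) * exp T"
          using that by (intro mult_left_mono) (auto simp: annulus_def)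
        also have "exp (- T / 2) * exp T = exp (T / 2)" by (simp flip: exp_add)
        finally have "norm (exp (- T / 2) *\<^sub>R x) \<le> exp (T / 2)" by simp
        moreover have "exp (- T / 2) * 1 \<le> exp (- T / 2) * norm x"
          using False by (intro mult_left_mono) auto
        ultimately show ?thesis by (simp add: annulus_def)
      qed
      then show "indicator (annulus T) x \<le> indicator ?H (exp (T / 2) *\<^sub>R x) + (indicator ?H (exp (- T / 2) *\<^sub>R x) :: ennreal)"
        by (auto simp: indicator_def)
    qed
    also have "\<dots> = (\<integral>\<^sup>+x. indicator ?H (exp (T / 2) *\<^sub>R x) \<partial>mu) + (\<integral>\<^sup>+x. indicator ?H (exp (- T / 2) *\<^sub>R x) \<partial>mu)"
      by (rule nn_integral_add) measurable
    also have "\<dots> = emeasure mu ?H + emeasure mu ?H"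
      by (subst (1 2) nn_integral_mu_scale) auto
    finally show ?thesis by (simp add: mult_2)
  qed
  have "ennreal (exp (- 8) / 2) * emeasure mu (annulus T :: (real^'n) set) \<le> ennreal (exp (- 8) / 2) * (2 * emeasure mu ?H)"
    by (intro mult_left_mono half) simp
  also have "\<dots> = ennreal (exp (- 8)) * emeasure mu ?H"
    using ennreal_mult''[of 2 "exp (- 8) / 2"] by (simp add: mult.assoc[symmetric])
  also have "\<dots> = (\<integral>\<^sup>+x. ennreal (exp (- 8)) * indicator ?H x \<partial>mu)"
    by (subst nn_integral_cmult_indicator) auto
  also have "\<dots> \<le> L2sq (cutoff T :: real^'n \<Rightarrow> real)"
    unfolding L2sq_def
  proof (rule nn_integral_mono)
    fix x :: "real^'n"
    show "ennreal (exp (- 8)) * indicator ?H x \<le> ennreal ((cutoff T x)\<^sup>2)"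
    proof (cases "x \<in> ?H")
      case True
      have x: "x \<noteq> 0" using True by (auto simp: annulus_def)
      have "ln (exp (- (T / 2))) \<le> ln (norm x)" "ln (norm x) \<le> ln (exp (T / 2))"
        using True x by (auto simp: annulus_def simp del: ln_exp)
      then have "- (T / 2) \<le> ln (norm x)" "ln (norm x) \<le> T / 2" by simp_all
      define u where "u = ln (norm x) / T"
      have u: "1/2 \<le> 1 + u" "1/2 \<le> 1 - u"
        using T \<open>- (T / 2) \<le> ln (norm x)\<close> \<open>ln (norm x) \<le> T / 2\<close> by (auto simp: u_def field_simps)
      have ge: "exp (- 2) \<le> bump 0 t" if "1/2 \<le> t" for t
        using that by (auto simp: bump_def field_simps)
      have "exp (- 2) * exp (- 2) \<le> cutoff T x"
        unfolding cutoff_eq[OF x T] u_def[symmetric]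
        by (intro mult_mono ge u) (auto simp: bump_0_bounds)
      then have "(exp (- 2) * exp (- 2))\<^sup>2 \<le> (cutoff T x)\<^sup>2" by (intro power_mono) auto
      moreover have "(exp (- 2) * exp (- 2))\<^sup>2 = exp (- 8 :: real)"
        by (simp add: power2_eq_square flip: exp_add)
      ultimately show ?thesis using True by (simp add: ennreal_leI)
    qed simp
  qed
  finally show ?thesis .
qed

lemma emeasure_annulus_pos:
  assumes "0 < T"
  shows "0 < emeasure mu (annulus T :: (real^'n::finite) set)"
proof (rule ccontr)
  assume "\<not> 0 < emeasure mu (annulus T :: (real^'n) set)"
  then have "AE y::real^'n in mu. y \<notin> annulus T"
    using AE_iff_null_sets[of "annulus T :: (real^'n) set" mu] by auto
  then have ae: "AE y::real^'n in lborel. y \<notin> annulus T" unfolding AE_mu_iff .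
  have U: "open ({y::real^'n. exp (- T) < norm y} \<inter> {y. norm y < exp T})"
    by (intro open_Int open_Collect_less continuous_intros)
  have "(1 / norm (1::real^'n)) *\<^sub>R (1::real^'n) \<in> {y::real^'n. exp (- T) < norm y} \<inter> {y. norm y < exp T}"
    using assms by simp
  then show False
    by (rule not_AE_lborel_notin_open[OF U], intro eventually_mono[OF ae]) (auto simp: annulus_def)
qed

lemma L2sq_cutoff_le:
  assumes "0 < T"
  shows "L2sq (cutoff T :: real^'n::finite \<Rightarrow> real) \<le> emeasure mu (annulus T :: (real^'n) set)"
proof -
  have "L2sq (cutoff T :: real^'n \<Rightarrow> real) \<le> (\<integral>\<^sup>+x. indicator (annulus T :: (real^'n) set) x \<partial>mu)"
    unfolding L2sq_def
  proof (rule nn_integral_mono_AE, use AE_mu_nonzero in eventually_elim)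
    case (elim x)
    have "(cutoff T x)\<^sup>2 \<le> cutoff T x"
      using cutoff_bounds[of T x] by (simp add: power2_eq_square mult_left_le)
    also have "\<dots> \<le> indicator (annulus T) x" using cutoff_le_indicator[OF elim assms] .
    finally have "ennreal ((cutoff T x)\<^sup>2) \<le> ennreal (indicator (annulus T) x)" by (rule ennreal_leI)
    then show ?case by (simp add: ennreal_indicator)
  qed
  then show ?thesis by simp
qed

text \<open>The energy at \<open>g = 0\<close> is of order \<open>1 / T^2\<close> times the measure
  of the annulus and the mass is comparable to that measure. So the form has no spectral gap on
  radial functions, in contrast to \<open>odd_gain\<close>.\<close>

lemma competitor_exists:
  fixes s g e :: real
  assumes s: "0 < s" "s < 1" and g: "0 \<le> g" "g < (real CARD('n) + 2 * s) / 2" and e: "0 < e"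
  shows "\<exists>T>0. 0 < L2sq (cutoff T :: real^'n::finite \<Rightarrow> real) \<and> L2sq (cutoff T :: real^'n \<Rightarrow> real) < \<infinity> \<and>
    Qform 0 (kap s) (cutoff T :: real^'n \<Rightarrow> real) \<le> ennreal e * L2sq (cutoff T :: real^'n \<Rightarrow> real) \<and>
    Qform g (kap s) (cutoff T :: real^'n \<Rightarrow> real) < \<infinity>"
proof -
  have "weight 0 (log_kernel 0 s :: real^'n \<Rightarrow> _) < \<infinity>"
    by (rule weight_log_kernel_finite) (use s in auto)
  then obtain W where W: "weight 0 (log_kernel 0 s :: real^'n \<Rightarrow> _) = ennreal W" "0 \<le> W"
    by (cases "weight 0 (log_kernel 0 s :: real^'n \<Rightarrow> _)") auto
  \<comment> \<open>From \<open>8 / T^2 * (2 * W * V)\<close> and \<open>V <= 2 * exp 8 * L\<close>: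
    the factor is \<open>8 * 2 * 2 = 32\<close>, and \<open>T^2 >= B\<close> suffices.\<close>
  define B where "B = 32 * W * exp 8 / e"
  have B: "0 \<le> B" using W e by (simp add: B_def)
  define T where "T = B + 1"
  have T: "0 < T" "B \<le> T\<^sup>2"
  proof -
    show "0 < T" using B by (simp add: T_def)
    have "B * 1 \<le> T * T" using B by (intro mult_mono) (auto simp: T_def)
    then show "B \<le> T\<^sup>2" by (simp add: power2_eq_square)
  qed
  let ?f = "cutoff T :: real^'n \<Rightarrow> real" and ?S = "emeasure mu (annulus T :: (real^'n) set)"
  have Sfin: "?S < \<infinity>" by (rule emeasure_annulus)
  then obtain V where V: "?S = ennreal V" "0 \<le> V" by (cases ?S) auto
  have V0: "0 < V" using emeasure_annulus_pos[OF T(1), where 'n = 'n] V by simp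
  have fin: "L2sq ?f < \<infinity>" using L2sq_cutoff_le[OF T(1), where 'n = 'n] Sfin by (rule le_less_trans)
  then obtain L where L: "L2sq ?f = ennreal L" "0 \<le> L" by (cases "L2sq ?f") auto
  have LV: "exp (- 8) / 2 * V \<le> L"
    using L2sq_cutoff_ge[OF T(1), where 'n = 'n] L V by (simp add: ennreal_mult'[symmetric])
  have "0 < exp (- 8) / 2 * V" using V0 by simp
  then have L0: "0 < L" using LV by linarith
  have VL: "V \<le> 2 * exp 8 * L"
    using LV by (simp add: exp_minus field_simps)
  have "Qform 0 (kap s) ?f \<le> ennreal (8 / T\<^sup>2 + 2 * 0\<^sup>2) * (2 * ennreal W * ennreal V)"
    using Qform_cutoff_le[OF T(1), of 0 s, where 'n = 'n] W V by simp
  also have "\<dots> = ennreal (8 / T\<^sup>2 * (2 * W * V))"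
  proof -
    have "2 * ennreal W = ennreal (2 * W)" using ennreal_mult'[of 2 W] by simp
    then show ?thesis using V by (simp add: ennreal_mult''[symmetric] ennreal_mult'[symmetric])
  qed
  also have "\<dots> \<le> ennreal (e * L)"
  proof (rule ennreal_leI)
    have "8 / T\<^sup>2 * (2 * W * V) \<le> 8 / T\<^sup>2 * (2 * W * (2 * exp 8 * L))"
      using VL W by (intro mult_left_mono) auto
    also have "\<dots> = B * e * L / T\<^sup>2" using e by (simp add: B_def)
    also have "\<dots> \<le> T\<^sup>2 * e * L / T\<^sup>2"
      using T L e by (intro divide_right_mono mult_right_mono) auto
    also have "\<dots> = e * L" using T by simp
    finally show "8 / T\<^sup>2 * (2 * W * V) \<le> e * L" .
  qed
  also have "\<dots> = ennreal e * L2sq ?f" using L by (simp add: ennreal_mult'')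
  finally have Q0: "Qform 0 (kap s) ?f \<le> ennreal e * L2sq ?f" .
  have "weight 0 (log_kernel g s :: real^'n \<Rightarrow> _) < \<infinity>"
    by (rule weight_log_kernel_finite) (use s g in auto)
  then have "Qform g (kap s) ?f < \<infinity>"
    using Sfin by (intro le_less_trans[OF Qform_cutoff_le[OF T(1) g(1)]]) (auto simp: ennreal_mult_less_top)
  then show ?thesis using T(1) Q0 fin L L0 by (intro exI[of _ T]) auto
qed

text \<open>From \<open>f powr (p - 2) >= 1 + (p - 2) * ln f >= 1 - (p - 2) / f\<close> where
  \<open>f > 0\<close>; the factor \<open>f^2\<close> removes the pole. Passing from exponent 2 to
  \<open>p\<close> thus costs only a multiple of \<open>p - 2\<close>.\<close>

lemma Lpp_cutoff_ge:
  fixes p :: real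
  assumes "0 < T" "2 \<le> p"
  shows "L2sq (cutoff T :: real^'n::finite \<Rightarrow> real) \<le>
    Lpp p (cutoff T :: real^'n \<Rightarrow> real) + ennreal (p - 2) * emeasure mu (annulus T :: (real^'n) set)"
proof -
  let ?f = "cutoff T :: real^'n \<Rightarrow> real"
  have "L2sq ?f \<le> (\<integral>\<^sup>+x. ennreal (\<bar>?f x\<bar> powr p) + ennreal (p - 2) * indicator (annulus T :: (real^'n) set) x \<partial>mu)"
    unfolding L2sq_def
  proof (rule nn_integral_mono_AE, use AE_mu_nonzero in eventually_elim)
    case (elim x)
    have b: "0 \<le> ?f x" "?f x \<le> 1" by (rule cutoff_bounds)+
    have "(?f x)\<^sup>2 \<le> \<bar>?f x\<bar> powr p + (p - 2) * ?f x"
    proof (cases "?f x = 0")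
      case False
      then have f: "0 < ?f x" using b by simp
      have "ln (1 / ?f x) \<le> 1 / ?f x - 1" using f by (intro ln_le_minus_one) auto
      then have "- (1 / ?f x) \<le> ln (?f x)" using f by (simp add: ln_div)
      then have "(p - 2) * - (1 / ?f x) \<le> (p - 2) * ln (?f x)"
        using assms by (intro mult_left_mono) auto
      then have "1 - (p - 2) / ?f x \<le> 1 + (p - 2) * ln (?f x)" by simp
      also have "\<dots> \<le> exp ((p - 2) * ln (?f x))" by (rule exp_ge_add_one_self)
      also have "\<dots> = ?f x powr (p - 2)" using f by (simp add: powr_def)
      finally have "(?f x)\<^sup>2 * (1 - (p - 2) / ?f x) \<le> (?f x)\<^sup>2 * ?f x powr (p - 2)"
        by (intro mult_left_mono) auto
      moreover have "(?f x)\<^sup>2 * ?f x powr (p - 2) = ?f x powr p"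
        using f powr_add[of "?f x" 2 "p - 2"] by simp
      moreover have "(?f x)\<^sup>2 * (1 - (p - 2) / ?f x) = (?f x)\<^sup>2 - (p - 2) * ?f x"
        using f by (simp add: power2_eq_square field_simps)
      ultimately show ?thesis using f by simp
    qed simp
    also have "\<dots> \<le> \<bar>?f x\<bar> powr p + (p - 2) * indicator (annulus T) x"
      using assms cutoff_le_indicator[OF elim assms(1)] by (intro add_left_mono mult_left_mono) auto
    finally have "ennreal ((?f x)\<^sup>2) \<le> ennreal (\<bar>?f x\<bar> powr p + (p - 2) * indicator (annulus T) x)"
      by (rule ennreal_leI)
    also have "\<dots> = ennreal (\<bar>?f x\<bar> powr p) + ennreal ((p - 2) * indicator (annulus T) x)"
      using assms by (intro ennreal_plus) auto
    also have "ennreal ((p - 2) * indicator (annulus T) x) = ennreal (p - 2) * indicator (annulus T) x"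
      by (simp add: indicator_def)
    finally show ?case .
  qed
  also have "\<dots> = Lpp p ?f + ennreal (p - 2) * emeasure mu (annulus T :: (real^'n) set)"
    unfolding Lpp_def by (subst nn_integral_add) (auto simp: nn_integral_cmult_indicator)
  finally show ?thesis .
qed

subsection \<open>Integrability of functions in the energy space\<close>

lemma L2sq_eq_Lpp: "L2sq h = Lpp 2 h"
  unfolding L2sq_def Lpp_def by (simp add: powr_numeral)

text \<open>Test functions need not vanish at the origin; there the weight
  \<open>norm x powr (g * p)\<close> makes the integral converge because
  \<open>g > 0\<close>.\<close>

lemma Lpp_test_function_finite:
  fixes f :: "real^'n::finite \<Rightarrow> real"
  assumes f: "f \<in> test_functions" and "0 < g" "0 < p"
  shows "Lpp p (lift g f) < \<infinity>"
proof -
  obtain R where R: "\<And>x. f x \<noteq> 0 \<Longrightarrow> norm x \<le> R" using test_functionsD(2)[OF f] by blast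
  obtain M where M: "\<And>x. \<bar>f x\<bar> \<le> M" using test_functionsD(4)[OF f] by blast
  have "Lpp p (lift g f) \<le> (\<integral>\<^sup>+x. ennreal (M powr p) * (ennreal (norm x powr (g * p)) * indicator {x::real^'n. norm x \<le> R} x) \<partial>mu)"
    unfolding Lpp_def
  proof (rule nn_integral_mono)
    fix x :: "real^'n"
    show "ennreal (\<bar>lift g f x\<bar> powr p) \<le> ennreal (M powr p) * (ennreal (norm x powr (g * p)) * indicator {x. norm x \<le> R} x)"
    proof (cases "f x = 0")
      case False
      have "\<bar>lift g f x\<bar> powr p = \<bar>f x\<bar> powr p * norm x powr (g * p)"
        by (simp add: lift_def abs_mult powr_mult powr_powr mult.commute)
      also have "\<dots> \<le> M powr p * norm x powr (g * p)"
        using assms by (intro mult_right_mono powr_mono2 M) auto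
      finally show ?thesis using R[OF False] by (simp add: ennreal_mult'[symmetric] ennreal_leI)
    qed (simp add: lift_def)
  qed
  also have "\<dots> = ennreal (M powr p) * (\<integral>\<^sup>+x. ennreal (norm x powr (g * p)) * indicator {x::real^'n. norm x \<le> R} x \<partial>mu)"
    by (rule nn_integral_cmult) measurable
  also have "\<dots> < \<infinity>"
    using nn_integral_mu_power_ball[of "g * p" R, where 'n = 'n] assms by (simp add: ennreal_mult_less_top)
  finally show ?thesis .
qed

lemma Lpp_add_finite:
  fixes f h :: "real^'n::finite \<Rightarrow> real"
  assumes [measurable]: "f \<in> borel_measurable borel" "h \<in> borel_measurable borel"
    and p: "0 \<le> p" and fin: "Lpp p f < \<infinity>" "Lpp p h < \<infinity>"
  shows "Lpp p (\<lambda>x. f x + h x) < \<infinity>"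
proof -
  have "Lpp p (\<lambda>x. f x + h x) \<le> (\<integral>\<^sup>+x. ennreal (2 powr p) * (ennreal (\<bar>f x\<bar> powr p) + ennreal (\<bar>h x\<bar> powr p)) \<partial>mu)"
    unfolding Lpp_def
  proof (rule nn_integral_mono)
    fix x
    have "\<bar>f x + h x\<bar> powr p \<le> (2 * max \<bar>f x\<bar> \<bar>h x\<bar>) powr p"
      using p by (intro powr_mono2) auto
    also have "\<dots> = 2 powr p * max \<bar>f x\<bar> \<bar>h x\<bar> powr p" by (rule powr_mult)
    also have "\<dots> \<le> 2 powr p * (\<bar>f x\<bar> powr p + \<bar>h x\<bar> powr p)"
      by (intro mult_left_mono) (auto simp: max_def)
    finally have "ennreal (\<bar>f x + h x\<bar> powr p) \<le> ennreal (2 powr p * (\<bar>f x\<bar> powr p + \<bar>h x\<bar> powr p))"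
      by (rule ennreal_leI)
    then show "ennreal (\<bar>f x + h x\<bar> powr p) \<le> ennreal (2 powr p) * (ennreal (\<bar>f x\<bar> powr p) + ennreal (\<bar>h x\<bar> powr p))"
      by (simp add: ennreal_mult')
  qed
  also have "\<dots> = ennreal (2 powr p) * (Lpp p f + Lpp p h)"
    unfolding Lpp_def by (simp add: nn_integral_cmult nn_integral_add)
  also have "\<dots> < \<infinity>" using fin by (simp add: ennreal_mult_less_top)
  finally show ?thesis .
qed

lemma Lpp_scale: "Lpp p (\<lambda>x. c * h x) = ennreal (\<bar>c\<bar> powr p) * Lpp p h"
  if [measurable]: "h \<in> borel_measurable borel" for h :: "real^'n::finite \<Rightarrow> real"
  unfolding Lpp_def by (subst nn_integral_cmult[symmetric]) (auto simp: abs_mult powr_mult ennreal_mult')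

lemma L2sq_scale: "L2sq (\<lambda>x. c * h x) = ennreal (c\<^sup>2) * L2sq h"
  if [measurable]: "h \<in> borel_measurable borel" for h :: "real^'n::finite \<Rightarrow> real"
  unfolding L2sq_def by (subst nn_integral_cmult[symmetric]) (auto simp: power_mult_distrib ennreal_mult')

lemma (in invariant_kernel) Qform_scale:
  assumes [measurable]: "h \<in> borel_measurable borel"
  shows "Qform g K (\<lambda>x. c * h x) = ennreal (c\<^sup>2) * Qform g K h"
proof -
  have "(c * a * r - c * b * t)\<^sup>2 * k = c\<^sup>2 * ((a * r - b * t)\<^sup>2 * k)" for a b r t k :: real
    by (simp add: power2_eq_square algebra_simps)
  then have "Qform g K (\<lambda>x. c * h x) = (\<integral>\<^sup>+x. (\<integral>\<^sup>+y. ennreal (c\<^sup>2) * ennreal ((tdiff g h x y)\<^sup>2 * K x y) \<partial>mu) \<partial>mu)"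
    unfolding Qform_def by (simp only: ennreal_mult'[OF zero_le_power2])
  also have "\<dots> = ennreal (c\<^sup>2) * Qform g K h"
    unfolding Qform_def by (rule nn_integral2_mu_cmult) measurable
  finally show ?thesis .
qed

text \<open>The Hardy inequality cannot be applied to \<open>lift g u\<close>, whose
  \<open>L2sq\<close> is not yet known to be finite. It bounds differences of approximating test
  functions in L^2(mu), and Fatou's lemma carries this bound to the limit.\<close>

lemma D_space_decomposition:
  fixes u :: "real^'n::finite \<Rightarrow> real"
  assumes u: "u \<in> D_space s \<alpha>" and [measurable]: "u \<in> borel_measurable borel"
    and g: "g = (real CARD('n) - 2 * s) / 2 - \<alpha>" "0 < g" and s: "0 < s"
  shows "\<exists>f\<in>test_functions. Qform g (kap s) (\<lambda>x. lift g u x - lift g f x) < \<infinity> \<and>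
    L2sq (\<lambda>x. lift g u x - lift g f x) < \<infinity>"
proof -
  obtain \<phi> where \<phi>: "\<And>k. \<phi> k \<in> test_functions"
    "(\<lambda>k. D_norm_sq s \<alpha> (\<lambda>x. u x - \<phi> k x)) \<longlonglongrightarrow> 0" "AE x in lebesgue. (\<lambda>k. \<phi> k x) \<longlonglongrightarrow> u x"
    using u unfolding D_space_def by blast
  have [measurable]: "\<phi> k \<in> borel_measurable borel" for k
    using \<phi>(1) by (rule test_functionsD)
  let ?w = "\<lambda>k x. lift g u x - lift g (\<phi> k) x"
  have "D_norm_sq s \<alpha> (\<lambda>x. u x - \<phi> k x) = Qform g (kap s) (?w k)" for k
    by (subst D_norm_sq_eq_Qform[OF _ g(1)]) (auto simp: lift_diff)
  then have lim: "(\<lambda>k. Qform g (kap s) (?w k)) \<longlonglongrightarrow> 0" using \<phi>(2) by simp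
  then have "eventually (\<lambda>k. Qform g (kap s) (?w k) < 1) sequentially"
    by (rule order_tendstoD) simp
  then obtain l where l: "\<And>k. l \<le> k \<Longrightarrow> Qform g (kap s) (?w k) < 1"
    by (auto simp: eventually_sequentially)
  obtain C where C: "0 < C" and hardy: "\<And>h :: real^'n \<Rightarrow> real. h \<in> borel_measurable borel \<Longrightarrow> L2sq h < \<infinity> \<Longrightarrow>
    ennreal C * L2sq h \<le> Qform g (kap s) h"
    using hardy_inequality[OF s g(2), where 'n = 'n] by blast
  have bound: "L2sq (\<lambda>x. lift g (\<phi> k) x - lift g (\<phi> l) x) \<le> ennreal (4 / C)" if "l \<le> k" for k
  proof -
    let ?d = "\<lambda>x. lift g (\<phi> k) x - lift g (\<phi> l) x"
    have "?d = lift g (\<lambda>x. \<phi> k x - \<phi> l x)" by (simp add: lift_diff)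
    then have "L2sq ?d < \<infinity>"
      using Lpp_test_function_finite[OF test_functions_diff[OF \<phi>(1) \<phi>(1)] g(2), of 2 k l] by (simp add: L2sq_eq_Lpp)
    then have "ennreal C * L2sq ?d \<le> Qform g (kap s) ?d" by (intro hardy) measurable
    also have "?d = (\<lambda>x. ?w l x - ?w k x)" by (simp add: fun_eq_iff)
    also have "Qform g (kap s) \<dots> \<le> 2 * (Qform g (kap s) (?w l) + Qform g (kap s) (?w k))"
      by (rule invariant_kernel.Qform_diff_le[OF invariant_kernel_kap]) measurable
    also have "\<dots> \<le> 2 * (1 + 1)"
      using l[OF that] l[of l] by (intro mult_left_mono add_mono) auto
    finally have "ennreal C * L2sq ?d \<le> 4" by simp
    then have "ennreal (1 / C) * (ennreal C * L2sq ?d) \<le> ennreal (1 / C) * 4" by (intro mult_left_mono) auto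
    then show ?thesis
      using C ennreal_mult'[of "1 / C" C] ennreal_mult'[of "1 / C" 4] by (simp add: mult.assoc[symmetric])
  qed
  have ae: "AE x in mu. (\<lambda>k. \<phi> k x) \<longlonglongrightarrow> u x"
    using \<phi>(3) unfolding AE_mu_iff AE_lebesgue_iff .
  have "L2sq (?w l) = (\<integral>\<^sup>+x. liminf (\<lambda>k. ennreal ((lift g (\<phi> k) x - lift g (\<phi> l) x)\<^sup>2)) \<partial>mu)"
    unfolding L2sq_def
  proof (rule nn_integral_cong_AE, use ae in eventually_elim)
    case (elim x)
    have "(\<lambda>k. ennreal ((lift g (\<phi> k) x - lift g (\<phi> l) x)\<^sup>2)) \<longlonglongrightarrow> ennreal ((?w l x)\<^sup>2)"
      unfolding lift_def by (intro tendsto_ennrealI tendsto_intros elim)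
    then show ?case by (rule lim_imp_Liminf[OF sequentially_bot, symmetric])
  qed
  also have "\<dots> \<le> liminf (\<lambda>k. L2sq (\<lambda>x. lift g (\<phi> k) x - lift g (\<phi> l) x))"
    unfolding L2sq_def by (rule nn_integral_liminf) measurable
  also have "\<dots> \<le> liminf (\<lambda>k. ennreal (4 / C))"
    using bound by (intro Liminf_mono) (auto simp: eventually_sequentially)
  also have "\<dots> < \<infinity>" by (simp add: Liminf_const)
  finally have "L2sq (?w l) < \<infinity>" .
  moreover have "Qform g (kap s) (?w l) < \<infinity>" using l[of l] by (auto intro: less_trans)
  ultimately show ?thesis using \<phi>(1) by blast
qed

subsection \<open>Reflection invariance implies radial symmetry\<close>

text \<open>The singularity of the kernel lets the value \<open>h x\<close> be recovered from the behaviour of \<open>h\<close>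
  near \<open>x\<close>, modulo null sets.\<close>

lemma kap_not_integrable:
  fixes x :: "real^'n::finite"
  assumes x: "x \<noteq> 0" and s: "0 < s"
  shows "(\<integral>\<^sup>+y. ennreal (kap s x y) \<partial>mu) = \<infinity>"
proof -
  define N where "N = real CARD('n)"
  define c1 where "c1 = (1/2 :: real) powr ((N + 2 * s) / 2)"
  define c2 where "c2 = (2/3) powr N * unit_ball_vol N"
  have c: "0 < c1" "0 < c2" by (auto simp: c1_def c2_def N_def intro!: mult_pos_pos)
  have lower: "ennreal (c1 * c2 * r powr - (2 * s)) \<le> (\<integral>\<^sup>+y. ennreal (kap s x y) \<partial>mu)"
    if r: "0 < r" "r \<le> 1/2" for r
  proof -
    have "r powr - (N + 2 * s) * r powr N = r powr - (2 * s)"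
      by (simp only: powr_add[symmetric]) simp
    then have "ennreal (c1 * c2 * r powr - (2 * s)) = ennreal (c1 * r powr - (N + 2 * s)) * ennreal (c2 * r powr N)"
      using c by (simp add: ennreal_mult'[symmetric] mult_ac)
    also have "\<dots> \<le> ennreal (c1 * r powr - (N + 2 * s)) * emeasure mu (ball x (r * norm x))"
      using mu_ball_ge[OF x r] by (intro mult_left_mono) (auto simp: c2_def N_def)
    also have "\<dots> = (\<integral>\<^sup>+y. ennreal (c1 * r powr - (N + 2 * s)) * indicator (ball x (r * norm x)) y \<partial>mu)"
      by (subst nn_integral_cmult_indicator) auto
    also have "\<dots> \<le> (\<integral>\<^sup>+y. ennreal (kap s x y) \<partial>mu)"
    proof (rule nn_integral_mono_AE, use AE_mu_neq[of x] in eventually_elim)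
      case (elim y)
      show ?case
      proof (cases "y \<in> ball x (r * norm x)")
        case True
        then show ?thesis
          using kap_ball_ge[OF x r True _ s] elim by (simp add: c1_def N_def ennreal_leI)
      qed simp
    qed
    finally show ?thesis .
  qed
  show ?thesis
  proof (rule ccontr)
    assume "(\<integral>\<^sup>+y. ennreal (kap s x y) \<partial>mu) \<noteq> \<infinity>"
    then obtain I where I: "(\<integral>\<^sup>+y. ennreal (kap s x y) \<partial>mu) = ennreal I" "0 \<le> I"
      by (cases "\<integral>\<^sup>+y. ennreal (kap s x y) \<partial>mu") auto
    \<comment> \<open>The radius below solves \<open>r powr - (2 * s) = B\<close>: the first entry
      forces \<open>r <= 1/2\<close>, the second makes the lower bound exceed
      \<open>I\<close>.\<close>
    define B where "B = max (2 powr (2 * s)) ((I + 1) / (c1 * c2))"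
    have B: "0 < B" "2 powr (2 * s) \<le> B" "(I + 1) / (c1 * c2) \<le> B"
      by (auto simp: B_def less_max_iff_disj)
    define r where "r = B powr - (1 / (2 * s))"
    have r: "0 < r" using B by (simp add: r_def)
    have "r \<le> (2 powr (2 * s)) powr - (1 / (2 * s))"
      unfolding r_def using B s by (intro powr_mono2') auto
    then have "r \<le> 1/2" using s by (simp add: powr_powr powr_minus)
    from lower[OF r this] have "c1 * c2 * r powr - (2 * s) \<le> I"
      using I by simp
    moreover have "r powr - (2 * s) = B" using B s by (simp add: r_def powr_powr)
    moreover have "I + 1 \<le> c1 * c2 * B" using B c by (simp add: field_simps)
    ultimately show False by simp
  qed
qed

text \<open>Each mirror has its own null set and there are uncountably many mirrors, so a pointwise
  argument fails. The energy density \<open>J x c\<close> at \<open>x\<close> with trial value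
  \<open>c\<close> sees \<open>h\<close> only up to null sets, hence is exactly invariant under
  every mirror. It is finite for at most one \<open>c\<close>, and that value defines the radial
  profile.\<close>

lemma radial_of_reflection_invariant:
  fixes h :: "real^'n::finite \<Rightarrow> real"
  assumes [measurable]: "h \<in> borel_measurable borel" and s: "0 < s"
    and fin: "Qform 0 (kap s) h < \<infinity>"
    and inv: "\<And>a. AE x in lborel. h (reflection a x) = h x"
  shows "\<exists>f. AE x in lborel. h x = f (norm x)"
proof -
  interpret invariant_kernel "kap s :: real^'n \<Rightarrow> _" by (rule invariant_kernel_kap)
  define J where "J x c = (\<integral>\<^sup>+y. ennreal ((c - h y)\<^sup>2 * kap s x y) \<partial>mu)" for x c
  define e where "e = (1 / norm (1::real^'n)) *\<^sub>R (1::real^'n)"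
  have e: "norm e = 1" by (simp add: e_def)
  have J_refl: "J (reflection a x) c = J x c" for a x c
  proof -
    have "J (reflection a x) c = (\<integral>\<^sup>+y. ennreal ((c - h (reflection a y))\<^sup>2 * kap s (reflection a x) (reflection a y)) \<partial>mu)"
      unfolding J_def by (rule nn_integral_mu_reflection[symmetric]) measurable
    also have "\<dots> = J x c"
      unfolding J_def
      by (rule nn_integral_cong_AE, unfold AE_mu_iff, use inv[of a] in eventually_elim) (simp add: refl)
    finally show ?thesis .
  qed
  have J_unique: "c = c'" if "J x c < \<infinity>" "J x c' < \<infinity>" "x \<noteq> 0" for x c c'
  proof (rule ccontr)
    assume "c \<noteq> c'"
    have "ennreal ((c - c')\<^sup>2) * (\<integral>\<^sup>+y. ennreal (kap s x y) \<partial>mu) = (\<integral>\<^sup>+y. ennreal ((c - c')\<^sup>2) * ennreal (kap s x y) \<partial>mu)"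
      by (rule nn_integral_cmult[symmetric]) measurable
    also have "\<dots> \<le> (\<integral>\<^sup>+y. 2 * (ennreal ((c - h y)\<^sup>2 * kap s x y) + ennreal ((c' - h y)\<^sup>2 * kap s x y)) \<partial>mu)"
    proof (rule nn_integral_mono)
      fix y
      have "(c - c')\<^sup>2 \<le> 2 * ((c - h y)\<^sup>2 + (c' - h y)\<^sup>2)"
        using zero_le_power2[of "c + c' - 2 * h y"] by (simp add: power2_eq_square algebra_simps)
      then have "(c - c')\<^sup>2 * kap s x y \<le> 2 * ((c - h y)\<^sup>2 + (c' - h y)\<^sup>2) * kap s x y"
        by (intro mult_right_mono nonneg)
      then have "(c - c')\<^sup>2 * kap s x y \<le> 2 * ((c - h y)\<^sup>2 * kap s x y + (c' - h y)\<^sup>2 * kap s x y)"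
        by (simp only: distrib_right mult.assoc)
      then have "ennreal ((c - c')\<^sup>2 * kap s x y) \<le> 2 * ennreal ((c - h y)\<^sup>2 * kap s x y + (c' - h y)\<^sup>2 * kap s x y)"
        by (rule ennreal_le_2_mult)
      then show "ennreal ((c - c')\<^sup>2) * ennreal (kap s x y) \<le> 2 * (ennreal ((c - h y)\<^sup>2 * kap s x y) + ennreal ((c' - h y)\<^sup>2 * kap s x y))"
        by (simp add: ennreal_mult' nonneg)
    qed
    also have "\<dots> = 2 * (J x c + J x c')"
      unfolding J_def by (simp add: nn_integral_cmult nn_integral_add)
    also have "\<dots> < \<infinity>" using that by (simp add: ennreal_mult_less_top)
    finally show False
      using kap_not_integrable[OF that(3) s] \<open>c \<noteq> c'\<close> by (simp add: ennreal_mult_top)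
  qed
  have "AE x in mu. J x (h x) \<noteq> \<infinity>"
  proof (rule nn_integral_PInf_AE)
    show "(\<lambda>x. J x (h x)) \<in> borel_measurable mu" unfolding J_def by measurable
    show "(\<integral>\<^sup>+x. J x (h x) \<partial>mu) \<noteq> \<infinity>"
      using fin unfolding J_def Qform_zero by auto
  qed
  then have ae: "AE x in lborel. J x (h x) \<noteq> \<infinity>" unfolding AE_mu_iff .
  have "AE x in lborel. h x = (THE c. J (norm x *\<^sub>R e) c < \<infinity>)"
    using ae AE_lborel_singleton[of "0::real^'n"]
  proof eventually_elim
    case (elim x)
    have "reflection (x - norm x *\<^sub>R e) x = norm x *\<^sub>R e"
      using e by (intro reflection_maps_to) simp
    then have "J (norm x *\<^sub>R e) (h x) = J x (h x)" by (metis J_refl)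
    then have 1: "J (norm x *\<^sub>R e) (h x) < \<infinity>" using elim by (simp add: less_top)
    have 2: "norm x *\<^sub>R e \<noteq> 0" using e elim by auto
    show ?case
    proof (rule the_equality[symmetric])
      show "J (norm x *\<^sub>R e) (h x) < \<infinity>" by (rule 1)
      show "c = h x" if "J (norm x *\<^sub>R e) c < \<infinity>" for c
        by (rule J_unique[OF that 1 2])
    qed
  qed
  then show ?thesis by (intro exI[of _ "\<lambda>t. THE c. J (t *\<^sub>R e) c < \<infinity>"])
qed

subsection \<open>Minimizers\<close>

text \<open>In \<open>Qform_identity\<close> with a cutoff as the second function, the term
  containing the unknown form is bounded by the opposite side, which is finite.\<close>

lemma Qform_zero_finite:
  fixes h :: "real^'n::finite \<Rightarrow> real"
  assumes [measurable]: "h \<in> borel_measurable borel" and s: "0 < s" "s < 1"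
    and g: "0 \<le> g" "g < (real CARD('n) + 2 * s) / 2"
    and fin: "L2sq h < \<infinity>" "Qform g (kap s) h < \<infinity>"
  shows "Qform 0 (kap s) h < \<infinity>"
proof -
  obtain T where T: "0 < T" "0 < L2sq (cutoff T :: real^'n \<Rightarrow> real)" "L2sq (cutoff T :: real^'n \<Rightarrow> real) < \<infinity>"
    "Qform 0 (kap s) (cutoff T :: real^'n \<Rightarrow> real) \<le> ennreal 1 * L2sq (cutoff T :: real^'n \<Rightarrow> real)"
    using competitor_exists[OF s g zero_less_one] by blast
  let ?f = "cutoff T :: real^'n \<Rightarrow> real"
  have "Qform 0 (kap s) h * L2sq ?f \<le> Qform g (kap s) ?f * L2sq h + Qform 0 (kap s) h * L2sq ?f"
    by simp
  also have "\<dots> = Qform g (kap s) h * L2sq ?f + Qform 0 (kap s) ?f * L2sq h"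
    by (rule Qform_identity[OF invariant_kernel_kap _ _ fin(1) T(3), symmetric]) measurable
  also have "\<dots> < \<infinity>"
    using fin T(3) le_less_trans[OF T(4)] by (simp add: ennreal_mult_less_top)
  finally show ?thesis
    using T(2) by (auto simp: ennreal_mult_less_top)
qed

lemma D_space_L2sq_finite:
  fixes u :: "real^'n::finite \<Rightarrow> real"
  assumes u: "u \<in> D_space s \<alpha>" and [measurable]: "u \<in> borel_measurable borel"
    and g: "g = (real CARD('n) - 2 * s) / 2 - \<alpha>" "0 < g" and s: "0 < s"
  shows "L2sq (lift g u) < \<infinity>"
proof -
  obtain f where f: "f \<in> test_functions" "L2sq (\<lambda>x. lift g u x - lift g f x) < \<infinity>"
    using D_space_decomposition[OF assms] by blast
  have [measurable]: "f \<in> borel_measurable borel" using f(1) by (rule test_functionsD)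
  have "Lpp 2 (\<lambda>x. (lift g u x - lift g f x) + lift g f x) < \<infinity>"
    using f Lpp_test_function_finite[OF f(1) g(2), of 2] by (intro Lpp_add_finite) (auto simp: L2sq_eq_Lpp)
  then show ?thesis by (simp add: L2sq_eq_Lpp)
qed

text \<open>The difference to a suitable test function has finite form at \<open>g = 0\<close>, so
  \<open>near\<close> applies to it after rescaling; the test function is handled directly.\<close>

lemma D_space_Lpp_finite:
  fixes u :: "real^'n::finite \<Rightarrow> real"
  assumes u: "u \<in> D_space s \<alpha>" and [measurable]: "u \<in> borel_measurable borel"
    and g: "g = (real CARD('n) - 2 * s) / 2 - \<alpha>" "0 < g" "g < (real CARD('n) + 2 * s) / 2"
    and s: "0 < s" "s < 1" and p: "0 < p"
    and near: "\<And>h :: real^'n \<Rightarrow> real. h \<in> borel_measurable borel \<Longrightarrow> L2sq h \<le> 1 \<Longrightarrow>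
      Lpp p h \<le> L2sq h + ennreal c * (L2sq h + Qform 0 (kap s) h)"
  shows "Lpp p (lift g u) < \<infinity>"
proof -
  obtain f where f: "f \<in> test_functions" "L2sq (\<lambda>x. lift g u x - lift g f x) < \<infinity>"
    "Qform g (kap s) (\<lambda>x. lift g u x - lift g f x) < \<infinity>"
    using D_space_decomposition[OF assms(1-4) s(1)] by blast
  have [measurable]: "f \<in> borel_measurable borel" using f(1) by (rule test_functionsD)
  let ?w = "\<lambda>x. lift g u x - lift g f x"
  obtain L where L: "L2sq ?w = ennreal L" "0 \<le> L" using f(2) by (cases "L2sq ?w") auto
  \<comment> \<open>Using \<open>L + 1\<close> in place of \<open>L\<close> normalises without
    excluding \<open>L = 0\<close>.\<close>
  define k where "k = 1 / sqrt (L + 1)"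
  have k: "0 < k" "k\<^sup>2 * L \<le> 1" using L by (auto simp: k_def power_divide)
  have "Qform 0 (kap s) ?w < \<infinity>"
    using f g by (intro Qform_zero_finite[OF _ s, of _ g]) auto
  then have Q: "Qform 0 (kap s) (\<lambda>x. k * ?w x) < \<infinity>"
    by (subst invariant_kernel.Qform_scale[OF invariant_kernel_kap]) (auto simp: ennreal_mult_less_top)
  have L1: "L2sq (\<lambda>x. k * ?w x) \<le> 1"
    using k L by (subst L2sq_scale) (auto simp: ennreal_mult'[symmetric])
  have "Lpp p (\<lambda>x. k * ?w x) \<le> L2sq (\<lambda>x. k * ?w x) + ennreal c * (L2sq (\<lambda>x. k * ?w x) + Qform 0 (kap s) (\<lambda>x. k * ?w x))"
    by (rule near[OF _ L1]) measurable
  also have "\<dots> < \<infinity>"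
    using Q L1 by (auto simp: ennreal_mult_less_top intro: le_less_trans)
  finally have "ennreal (\<bar>k\<bar> powr p) * Lpp p ?w < \<infinity>"
    by (subst Lpp_scale[symmetric]) auto
  then have "Lpp p ?w < \<infinity>" using k by (auto simp: ennreal_mult_less_top)
  then have "Lpp p (\<lambda>x. ?w x + lift g f x) < \<infinity>"
    using Lpp_test_function_finite[OF f(1) g(2) p] p by (intro Lpp_add_finite) auto
  then show ?thesis by simp
qed

lemma CKN_rhs_eq_powr:
  fixes u :: "real^'n::finite \<Rightarrow> real"
  assumes "u \<in> borel_measurable borel" "0 < p" "g + \<beta> = real CARD('n) / p" "Lpp p (lift g u) < \<infinity>"
  shows "CKN_rhs p \<beta> u = ennreal (enn2real (Lpp p (lift g u)) powr (2 / p))"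
proof -
  have "(t powr (1 / p))\<^sup>2 = t powr (2 / p)" for t :: real
    by (simp add: power2_eq_square powr_add[symmetric])
  then show ?thesis using CKN_rhs_eq_Lpp[OF assms(1-3)] assms(4) by simp
qed

lemma Lpp_reflection:
  assumes [measurable]: "h \<in> borel_measurable borel"
  shows "Lpp p (\<lambda>x. h (reflection a x)) = Lpp p h"
  unfolding Lpp_def by (rule nn_integral_mu_reflection) measurable

lemma Lpp_odd_part_finite:
  fixes h :: "real^'n::finite \<Rightarrow> real"
  assumes [measurable]: "h \<in> borel_measurable borel" and p: "0 \<le> p" and fin: "Lpp p h < \<infinity>"
  shows "Lpp p (\<lambda>x. (h x - h (reflection a x)) / 2) < \<infinity>"
proof -
  have "Lpp p (\<lambda>x. - 1 * h (reflection a x)) < \<infinity>"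
    using fin by (subst Lpp_scale) (auto simp: Lpp_reflection)
  then have "Lpp p (\<lambda>x. h x + - 1 * h (reflection a x)) < \<infinity>"
    using fin p by (intro Lpp_add_finite) auto
  then have "Lpp p (\<lambda>x. 1/2 * (h x + - 1 * h (reflection a x))) < \<infinity>"
    by (subst Lpp_scale) (auto simp: ennreal_mult_less_top)
  then show ?thesis by simp
qed

text \<open>The parallelogram law for the energy against uniform smoothness for the norm bounds the
  odd part of a minimizer, without an Euler--Lagrange equation.\<close>

lemma minimizer_odd_part:
  fixes u :: "real^'n::finite \<Rightarrow> real"
  assumes min: "CKN_minimizer s p \<alpha> \<beta> u" and u [measurable]: "u \<in> borel_measurable borel"
    and g: "g = (real CARD('n) - 2 * s) / 2 - \<alpha>" "g + \<beta> = real CARD('n) / p"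
    and p: "2 \<le> p" "p \<le> 3" and fin: "Lpp p (lift g u) < \<infinity>"
    and L: "CKN_const TYPE('n) s p \<alpha> \<beta> = ennreal L" "0 \<le> L"
    and d_def: "d = (\<lambda>x. (lift g u x - lift g u (reflection a x)) / 2)"
  shows "Qform g (kap s) (lift g u) < \<infinity>" "Lpp p d < \<infinity>"
    "Qform g (kap s) d \<le> ennreal ((p - 1) * L * enn2real (Lpp p d) powr (2 / p))"
proof -
  interpret kap: invariant_kernel "kap s :: real^'n \<Rightarrow> _" by (rule invariant_kernel_kap)
  have p0: "0 < p" using p by simp
  let ?h = "lift g u"
  let ?m = "\<lambda>x. (?h x + ?h (reflection a x)) / 2"
  let ?um = "\<lambda>x. (u x + u (reflection a x)) / 2"
  have [measurable]: "d \<in> borel_measurable borel" unfolding d_def by measurable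
  have D: "u \<in> D_space s \<alpha>" and eq: "D_norm_sq s \<alpha> u = CKN_const TYPE('n) s p \<alpha> \<beta> * CKN_rhs p \<beta> u"
    using min by (auto simp: CKN_minimizer_def)
  have md: "?m x + d x = ?h x" "?m x - d x = ?h (reflection a x)" for x
    by (simp_all add: d_def field_simps)
  have mlift: "?m = lift g ?um" by (simp add: lift_def fun_eq_iff field_simps)
  have hR: "Lpp p (\<lambda>x. ?h (reflection a x)) = Lpp p ?h" by (rule Lpp_reflection) measurable
  show find: "Lpp p d < \<infinity>"
    unfolding d_def using p fin by (intro Lpp_odd_part_finite) auto
  have "Lpp p (\<lambda>x. ?h (reflection a x) + d x) < \<infinity>"
    using fin hR find p by (intro Lpp_add_finite) auto
  also have "(\<lambda>x. ?h (reflection a x) + d x) = ?m" by (simp add: d_def fun_eq_iff field_simps)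
  finally have finm: "Lpp p ?m < \<infinity>" .
  define X Y Z where "X = enn2real (Lpp p ?h)" and "Y = enn2real (Lpp p ?m)" and "Z = enn2real (Lpp p d)"
  have XYZ: "Lpp p ?h = ennreal X" "Lpp p ?m = ennreal Y" "Lpp p d = ennreal Z"
    using fin finm find by (simp_all add: X_def Y_def Z_def ennreal_enn2real)
  have nn: "0 \<le> X" "0 \<le> Y" "0 \<le> Z" by (simp_all add: X_def Y_def Z_def)
  have smooth: "X powr (2 / p) \<le> Y powr (2 / p) + (p - 1) * Z powr (2 / p)"
  proof (rule Lp_uniform_smoothness[where M = mu and m = ?m and d = d])
    show "(\<integral>\<^sup>+x. ennreal (\<bar>?m x + d x\<bar> powr p) \<partial>mu) = ennreal X"
      unfolding md using XYZ(1) by (simp add: Lpp_def)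
    show "(\<integral>\<^sup>+x. ennreal (\<bar>?m x - d x\<bar> powr p) \<partial>mu) = ennreal X"
      unfolding md using XYZ(1) hR by (simp add: Lpp_def)
  qed (use XYZ nn p in \<open>auto simp: Lpp_def\<close>)
  have Qh: "Qform g (kap s) ?h = ennreal (L * X powr (2 / p))"
    using eq L CKN_rhs_eq_powr[OF u p0 g(2) fin] D_norm_sq_eq_Qform[OF u g(1)]
    by (simp add: X_def ennreal_mult')
  then show "Qform g (kap s) ?h < \<infinity>" by simp
  have "CKN_const TYPE('n) s p \<alpha> \<beta> * CKN_rhs p \<beta> ?um \<le> D_norm_sq s \<alpha> ?um"
    by (rule CKN_const_le[OF D_space_midpoint[OF D u]])
  also have "D_norm_sq s \<alpha> ?um = Qform g (kap s) ?m"
    unfolding mlift by (rule D_norm_sq_eq_Qform[OF _ g(1)]) measurable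
  also have "CKN_rhs p \<beta> ?um = ennreal (Y powr (2 / p))"
    using CKN_rhs_eq_powr[OF _ p0 g(2), of ?um] finm by (simp add: Y_def mlift)
  finally have Qm: "ennreal (L * Y powr (2 / p)) \<le> Qform g (kap s) ?m"
    using L by (simp add: ennreal_mult')
  have "2 * Qform g (kap s) ?h = 2 * (Qform g (kap s) ?m + Qform g (kap s) d)"
    using kap.Qform_parallelogram[of ?m d g] kap.Qform_reflection[of ?h g a] by (simp add: md mult_2)
  then have sum: "Qform g (kap s) ?h = Qform g (kap s) ?m + Qform g (kap s) d"
    by (subst (asm) ennreal_mult_cancel_left) auto
  then have "Qform g (kap s) ?m < \<infinity>" "Qform g (kap s) d < \<infinity>"
    using Qh by (auto simp: less_top[symmetric])
  then obtain qm qd where q: "Qform g (kap s) ?m = ennreal qm" "0 \<le> qm" "Qform g (kap s) d = ennreal qd" "0 \<le> qd"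
    by (cases "Qform g (kap s) ?m"; cases "Qform g (kap s) d") auto
  have 1: "L * X powr (2 / p) = qm + qd"
    using sum Qh q L by (simp flip: ennreal_plus)
  have 2: "L * Y powr (2 / p) \<le> qm" using Qm q by simp
  \<comment> \<open>The minimizer gives equality and its even part an inequality with the same
    constant; the difference bounds the odd energy by the gap of the norms, which smoothness
    controls.\<close>
  have "L * X powr (2 / p) \<le> L * (Y powr (2 / p) + (p - 1) * Z powr (2 / p))"
    using L smooth by (intro mult_left_mono)
  then have "qd \<le> (p - 1) * L * Z powr (2 / p)"
    using 1 2 by (simp add: algebra_simps)
  then show "Qform g (kap s) d \<le> ennreal ((p - 1) * L * enn2real (Lpp p d) powr (2 / p))"
    unfolding q(3) Z_def[symmetric] by (rule ennreal_leI)
qed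

text \<open>At \<open>p = 2\<close> the claim reads \<open>e + F < F + E * G\<close>, true since
  \<open>e <= c / 2 * G\<close> and \<open>c <= E\<close>. For \<open>p\<close> near 2 this margin
  absorbs the changes uniformly, because \<open>F <= M\<close> and because the growth in
  \<open>E\<close> is linear with a factor of order \<open>p - 2\<close>.\<close>

lemma small_exponent:
  fixes G S M C c :: real
  assumes G: "0 < G" and M: "0 \<le> M" and C: "0 < C" and c: "0 < c"
  shows "\<exists>\<epsilon>>0. \<forall>p. 2 < p \<longrightarrow> p < 2 + \<epsilon> \<longrightarrow> 0 < G - (p - 2) * S \<and>
    (\<forall>e F E. 0 \<le> F \<longrightarrow> F \<le> M \<longrightarrow> e \<le> c / 2 * G \<longrightarrow> c \<le> E \<longrightarrow>
      e + G * (p - 1) / (G - (p - 2) * S) powr (2 / p) * F * (1 + C * (p - 2) * (1 + E)) < F + E * G)"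
proof -
  define A where "A p = G * (p - 1) / (G - (p - 2) * S) powr (2 / p)" for p
  have A: "(A \<longlongrightarrow> 1) (at_right 2)"
  proof -
    have "(A \<longlongrightarrow> G * (2 - 1) / (G - (2 - 2) * S) powr (2 / 2)) (at_right 2)"
      unfolding A_def using G by (intro tendsto_intros) auto
    then show ?thesis using G by simp
  qed
  have 1: "((\<lambda>p. A p * M * C * (p - 2)) \<longlongrightarrow> 1 * M * C * (2 - 2)) (at_right 2)"
    by (intro tendsto_intros A)
  have 2: "((\<lambda>p. M * (A p * (1 + C * (p - 2)) - 1)) \<longlongrightarrow> M * (1 * (1 + C * (2 - 2)) - 1)) (at_right 2)"
    by (intro tendsto_intros A)
  have 3: "((\<lambda>p. G - (p - 2) * S) \<longlongrightarrow> G - (2 - 2) * S) (at_right 2)"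
    by (intro tendsto_intros)
  \<comment> \<open>Budget: the next two conditions cost \<open>E * G / 4\<close> and
    \<open>c * G / 8\<close>; together with \<open>e <= c * G / 2\<close> this stays below
    \<open>E * G\<close>.\<close>
  have "\<forall>\<^sub>F p in at_right 2. A p * M * C * (p - 2) < G / 4"
    using G by (intro order_tendstoD(2)[OF 1]) auto
  moreover have "\<forall>\<^sub>F p in at_right 2. M * (A p * (1 + C * (p - 2)) - 1) < c * G / 8"
    using G c by (intro order_tendstoD(2)[OF 2]) auto
  moreover have "\<forall>\<^sub>F p in at_right 2. 0 < G - (p - 2) * S"
    using G by (intro order_tendstoD(1)[OF 3]) auto
  moreover have "\<forall>\<^sub>F p in at_right 2. 0 < A p"
    by (intro order_tendstoD(1)[OF A]) auto
  ultimately have "\<forall>\<^sub>F p in at_right 2. A p * M * C * (p - 2) < G / 4 \<and>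
    M * (A p * (1 + C * (p - 2)) - 1) < c * G / 8 \<and> 0 < G - (p - 2) * S \<and> 0 < A p"
    by eventually_elim auto
  then obtain b where b: "2 < b" and P: "\<And>p. 2 < p \<Longrightarrow> p < b \<Longrightarrow> A p * M * C * (p - 2) < G / 4 \<and>
    M * (A p * (1 + C * (p - 2)) - 1) < c * G / 8 \<and> 0 < G - (p - 2) * S \<and> 0 < A p"
    unfolding eventually_at_right_field by blast
  show ?thesis
  proof (intro exI[of _ "b - 2"] conjI allI impI)
    show "0 < b - 2" using b by simp
    fix p assume p: "2 < p" "p < 2 + (b - 2)"
    then have P': "A p * M * C * (p - 2) < G / 4" "M * (A p * (1 + C * (p - 2)) - 1) < c * G / 8"
      "0 < G - (p - 2) * S" "0 < A p" using P[of p] by auto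
    show "0 < G - (p - 2) * S" by (rule P')
    fix e F E assume F: "0 \<le> F" "F \<le> M" and e: "e \<le> c / 2 * G" and E: "c \<le> E"
    have cG: "0 < c * G" using c G by simp
    have i: "F * (A p * (1 + C * (p - 2)) - 1) < c * G / 8"
    proof (cases "0 \<le> A p * (1 + C * (p - 2)) - 1")
      case True
      then have "F * (A p * (1 + C * (p - 2)) - 1) \<le> M * (A p * (1 + C * (p - 2)) - 1)"
        using F by (intro mult_right_mono) auto
      then show ?thesis using P'(2) by (rule le_less_trans)
    next
      case False
      then have "F * (A p * (1 + C * (p - 2)) - 1) \<le> 0" using F by (intro mult_nonneg_nonpos) auto
      moreover have "0 < c * G / 8" using cG by simp
      ultimately show ?thesis by (rule le_less_trans)
    qed
    have "A p * F * C * (p - 2) \<le> A p * M * C * (p - 2)"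
      using F P' C p by (intro mult_right_mono mult_left_mono) auto
    then have "A p * F * C * (p - 2) \<le> G / 4" using P'(1) by linarith
    then have ii: "A p * F * C * (p - 2) * E \<le> G / 4 * E"
      using E c by (intro mult_right_mono) auto
    have iii: "c * G \<le> E * G" using E G by (intro mult_right_mono) auto
    have "A p * F * (1 + C * (p - 2) * (1 + E)) =
      F + F * (A p * (1 + C * (p - 2)) - 1) + A p * F * C * (p - 2) * E"
      by (simp add: algebra_simps)
    also have "\<dots> < F + c * G / 8 + G / 4 * E" using i ii by linarith
    finally have "e + A p * F * (1 + C * (p - 2) * (1 + E)) < c / 2 * G + (F + c * G / 8 + G / 4 * E)"
      using e by linarith
    also have "\<dots> \<le> F + E * G"
    proof -
      have "c / 2 * G + c * G / 8 + G / 4 * E = 5/8 * (c * G) + 1/4 * (E * G)" by (simp add: mult_ac)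
      also have "\<dots> \<le> E * G" using iii cG by linarith
      finally show ?thesis by simp
    qed
    finally show "e + G * (p - 1) / (G - (p - 2) * S) powr (2 / p) * F * (1 + C * (p - 2) * (1 + E)) < F + E * G"
      by (simp only: A_def)
  qed
qed

lemma Qform_cong_nonzero: "(\<And>x. x \<noteq> 0 \<Longrightarrow> f x = h x) \<Longrightarrow> Qform g K f = Qform g K h"
  unfolding Qform_def by (rule nn_integral2_mu_cong) simp

lemma Lpp_cong_nonzero: "(\<And>x. x \<noteq> 0 \<Longrightarrow> f x = h x) \<Longrightarrow> Lpp p f = Lpp p h"
  unfolding Lpp_def by (rule nn_integral_cong_AE, use AE_mu_nonzero in eventually_elim) simp

text \<open>The competitor is \<open>norm x powr (- g) * cutoff T x\<close>, whose lift is the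
  cutoff off the origin. Since its norm is positive and its energy finite, the optimal constant, a
  supremum in \<open>ennreal\<close>, is finite.\<close>

lemma CKN_const_le_competitor:
  fixes T F Y p :: real
  defines "f \<equiv> cutoff T :: real^'n::finite \<Rightarrow> real"
  assumes T: "0 < T" and g: "g = (real CARD('n) - 2 * s) / 2 - \<alpha>" "g + \<beta> = real CARD('n) / p"
    and p: "2 \<le> p" and F: "Qform g (kap s) f = ennreal F" "0 \<le> F" and L2: "L2sq f < \<infinity>"
    and Y: "0 < Y" "ennreal Y \<le> Lpp p f"
  shows "\<exists>L\<ge>0. CKN_const TYPE('n) s p \<alpha> \<beta> = ennreal L \<and> L * Y powr (2 / p) \<le> F"
proof -
  define \<phi> where "\<phi> = (\<lambda>x::real^'n. norm x powr (- g) * cutoff T x)"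
  have \<phi>: "\<phi> \<in> test_functions" unfolding \<phi>_def by (rule power_cutoff_test_function[OF T])
  have m: "\<phi> \<in> borel_measurable borel" using \<phi> by (rule test_functionsD)
  have lift: "lift g \<phi> x = f x" if "x \<noteq> 0" for x
    using that by (simp add: lift_def \<phi>_def f_def mult.assoc[symmetric] powr_add[symmetric])
  have Lf: "Lpp p (lift g \<phi>) = Lpp p f" by (rule Lpp_cong_nonzero[OF lift])
  have "Lpp p f \<le> L2sq f"
    unfolding Lpp_def L2sq_def
  proof (rule nn_integral_mono, rule ennreal_leI)
    fix x
    have "0 \<le> f x" "f x \<le> 1" unfolding f_def by (rule cutoff_bounds)+
    then show "\<bar>f x\<bar> powr p \<le> (f x)\<^sup>2"
      using powr_mono'[of 2 p "f x"] p by (cases "f x = 0") auto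
  qed
  then have fin: "Lpp p f < \<infinity>" using L2 by (rule le_less_trans)
  then obtain X where X: "Lpp p f = ennreal X" "0 \<le> X" by (cases "Lpp p f") auto
  have YX: "Y \<le> X" using Y X by simp
  have "CKN_const TYPE('n) s p \<alpha> \<beta> * CKN_rhs p \<beta> \<phi> \<le> D_norm_sq s \<alpha> \<phi>"
    by (rule CKN_const_le[OF test_function_D_space[OF \<phi>]])
  also have "CKN_rhs p \<beta> \<phi> = ennreal (X powr (2 / p))"
    using CKN_rhs_eq_powr[OF m _ g(2)] p fin Lf X by simp
  also have "D_norm_sq s \<alpha> \<phi> = ennreal F"
    unfolding D_norm_sq_eq_Qform[OF m g(1)] F(1)[symmetric] by (rule Qform_cong_nonzero[OF lift])
  finally have le: "CKN_const TYPE('n) s p \<alpha> \<beta> * ennreal (X powr (2 / p)) \<le> ennreal F" .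
  have X0: "0 < X powr (2 / p)" using Y YX by simp
  then have "CKN_const TYPE('n) s p \<alpha> \<beta> \<noteq> \<infinity>"
    using le by (auto simp: ennreal_top_mult top_unique)
  then obtain L where L: "CKN_const TYPE('n) s p \<alpha> \<beta> = ennreal L" "0 \<le> L"
    by (cases "CKN_const TYPE('n) s p \<alpha> \<beta>") auto
  have "L * X powr (2 / p) \<le> F" using le L F by (simp add: ennreal_mult'[symmetric])
  moreover have "L * Y powr (2 / p) \<le> L * X powr (2 / p)"
    using L Y YX p by (intro mult_left_mono powr_mono2) auto
  ultimately show ?thesis using L by (intro exI[of _ L]) auto
qed

theorem theorem1p5:
  fixes s \<alpha>\<^sub>0 :: real
  assumes "0 < s" and "s < min 1 (real CARD('n::finite) / 2)"
    and "- 2 * s < \<alpha>\<^sub>0" and "\<alpha>\<^sub>0 < 0"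
  shows "\<exists>\<epsilon>>0. \<forall>\<alpha> p \<beta> :: real.
     \<alpha>\<^sub>0 < \<alpha> \<and> \<alpha> < 0 \<and> 2 < p \<and> p < 2 + \<epsilon> \<and>
     p < 2 * real CARD('n) / (real CARD('n) - 2 * s) \<and>
     \<beta> = \<alpha> + s - real CARD('n) * (1 / 2 - 1 / p) \<longrightarrow>
     (\<forall>u :: real^'n \<Rightarrow> real. CKN_minimizer s p \<alpha> \<beta> u \<longrightarrow> radial u)"
proof -
  let ?N = "real CARD('n)"
  have s: "0 < s" "s < 1" "s < ?N / 2" using assms by auto
  \<comment> \<open>The value of \<open>g\<close> at the endpoint alpha_0; every admissible alpha
    gives \<open>0 < g <= k\<close>, and the exponent range is chosen from \<open>k\<close>
    alone.\<close>
  define k where "k = (?N - 2 * s) / 2 - \<alpha>\<^sub>0"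
  have k: "0 \<le> k" "k < (?N + 2 * s) / 2" using assms s by (auto simp: k_def field_simps)
  interpret kap: invariant_kernel "kap s :: real^'n \<Rightarrow> _" by (rule invariant_kernel_kap)
  obtain c where c: "0 < c" and gain: "\<And>a (h :: real^'n \<Rightarrow> real). h \<in> borel_measurable borel \<Longrightarrow>
      (\<forall>x. h (reflection a x) = - h x) \<Longrightarrow> ennreal c * L2sq h \<le> Qform 0 (kap s) h"
    using odd_gain[OF s(1), where 'n = 'n] by blast
  obtain C q where C: "0 < C" and q: "2 < q" and near: "\<And>p (h :: real^'n \<Rightarrow> real). 2 \<le> p \<Longrightarrow> p \<le> q \<Longrightarrow>
      h \<in> borel_measurable borel \<Longrightarrow> L2sq h \<le> 1 \<Longrightarrow>
      Lpp p h \<le> L2sq h + ennreal (C * (p - 2)) * (L2sq h + Qform 0 (kap s) h)"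
    using Lpp_near_two[OF s(1), where 'n = 'n] by blast
  \<comment> \<open>Half of the odd gain is spent on the cutoff's excess over the Hardy constant;
    the other half is the margin for \<open>p > 2\<close>.\<close>
  have "0 < c / 2" using c by simp
  from competitor_exists[OF s(1,2) k this]
  obtain T where T: "0 < T" "0 < L2sq (cutoff T :: real^'n \<Rightarrow> real)" "L2sq (cutoff T :: real^'n \<Rightarrow> real) < \<infinity>"
    "Qform 0 (kap s) (cutoff T :: real^'n \<Rightarrow> real) \<le> ennreal (c / 2) * L2sq (cutoff T :: real^'n \<Rightarrow> real)"
    "Qform k (kap s) (cutoff T :: real^'n \<Rightarrow> real) < \<infinity>" by blast
  let ?f = "cutoff T :: real^'n \<Rightarrow> real"
  obtain G where G: "L2sq ?f = ennreal G" "0 \<le> G" using T(3) by (cases "L2sq ?f") auto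
  have G0: "0 < G" using T(2) G by simp
  have "Qform 0 (kap s) ?f \<le> ennreal (c / 2 * G)"
    using T(4) unfolding G(1) by (simp only: ennreal_mult''[OF G(2)])
  moreover from this have "Qform 0 (kap s) ?f < \<infinity>" by (rule le_less_trans) simp
  ultimately obtain e where e: "Qform 0 (kap s) ?f = ennreal e" "0 \<le> e" "e \<le> c / 2 * G"
    using c G by (cases "Qform 0 (kap s) ?f") auto
  obtain e1 where e1: "Qform k (kap s) ?f = ennreal e1" "0 \<le> e1" using T(5) by (cases "Qform k (kap s) ?f") auto
  obtain S where S: "emeasure mu (annulus T :: (real^'n) set) = ennreal S" "0 \<le> S"
    using emeasure_annulus[of T, where 'n = 'n] by (cases "emeasure mu (annulus T :: (real^'n) set)") auto
  have M: "0 \<le> e + e1" using e e1 by simp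
  obtain \<epsilon> where \<epsilon>: "0 < \<epsilon>" and small: "\<And>p. 2 < p \<Longrightarrow> p < 2 + \<epsilon> \<Longrightarrow> 0 < G - (p - 2) * S"
    "\<And>p e' F E. 2 < p \<Longrightarrow> p < 2 + \<epsilon> \<Longrightarrow> 0 \<le> F \<Longrightarrow> F \<le> e + e1 \<Longrightarrow> e' \<le> c / 2 * G \<Longrightarrow> c \<le> E \<Longrightarrow>
      e' + G * (p - 1) / (G - (p - 2) * S) powr (2 / p) * F * (1 + C * (p - 2) * (1 + E)) < F + E * G"
    using small_exponent[OF G0 M C c, of S] by blast
  have borel_case: "radial u"
    if \<alpha>: "\<alpha>\<^sub>0 < \<alpha>" "\<alpha> < 0" and p: "2 < p" "p < 2 + \<epsilon>" "p \<le> 3" "p \<le> q"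
      and \<beta>: "\<beta> = \<alpha> + s - ?N * (1 / 2 - 1 / p)"
      and min: "CKN_minimizer s p \<alpha> \<beta> u" and u: "u \<in> borel_measurable borel"
    for \<alpha> p \<beta> and u :: "real^'n \<Rightarrow> real"
  proof -
    note u [measurable]
    define g where "g = (?N - 2 * s) / 2 - \<alpha>"
    have g: "0 < g" "g \<le> k" "g < (?N + 2 * s) / 2"
      using \<alpha> s k by (auto simp: g_def k_def field_simps)
    have g\<beta>: "g + \<beta> = ?N / p" using p by (simp add: g_def \<beta> field_simps)
    have p2: "2 \<le> p" "0 < p" using p by auto
    let ?h = "lift g u"
    have D: "u \<in> D_space s \<alpha>" using min by (simp add: CKN_minimizer_def)
    have L2h: "L2sq ?h < \<infinity>" by (rule D_space_L2sq_finite[OF D u g_def g(1) s(1)])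
    have Lph: "Lpp p ?h < \<infinity>"
      by (rule D_space_Lpp_finite[OF D u g_def g(1,3) s(1,2) p2(2) near[OF p2(1) p(4)]])
    have "Qform g (kap s) ?f \<le> Qform 0 (kap s) ?f + Qform k (kap s) ?f"
      by (rule Qform_convex[OF invariant_kernel_kap]) (use g in auto)
    also have "\<dots> = ennreal (e + e1)" using e e1 by simp
    finally have "Qform g (kap s) ?f \<le> ennreal (e + e1)" .
    moreover from this have "Qform g (kap s) ?f < \<infinity>" by (rule le_less_trans) simp
    ultimately obtain F where F: "Qform g (kap s) ?f = ennreal F" "0 \<le> F" "F \<le> e + e1"
      using M by (cases "Qform g (kap s) ?f") auto
    define Y where "Y = G - (p - 2) * S"
    have Y: "0 < Y" unfolding Y_def by (rule small(1)[OF p(1,2)])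
    have "ennreal Y \<le> Lpp p ?f"
    proof (cases "Lpp p ?f")
      case (real x)
      have "ennreal G \<le> ennreal x + ennreal (p - 2) * ennreal S"
        using Lpp_cutoff_ge[OF T(1) p2(1), where 'n = 'n] G(1) S(1) real by simp
      also have "\<dots> = ennreal (x + (p - 2) * S)"
        using real S p2 by (simp add: ennreal_mult')
      finally have "G \<le> x + (p - 2) * S"
        using real S p2 by (subst (asm) ennreal_le_iff) auto
      then show ?thesis using real by (simp add: Y_def ennreal_leI)
    qed auto
    from CKN_const_le_competitor[OF T(1) g_def g\<beta> p2(1) F(1,2) T(3) Y this]
    obtain L where L: "0 \<le> L" "CKN_const TYPE('n) s p \<alpha> \<beta> = ennreal L" "L * Y powr (2 / p) \<le> F"
      by blast
    have Qh: "Qform g (kap s) ?h < \<infinity>"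
      by (rule minimizer_odd_part(1)[OF min u g_def g\<beta> p2(1) p(3) Lph L(2,1) refl])
    have inv: "AE x in lborel. ?h (reflection a x) = ?h x" for a
    proof -
      define d where "d = (\<lambda>x. (?h x - ?h (reflection a x)) / 2)"
      have [measurable]: "d \<in> borel_measurable borel" unfolding d_def by measurable
      note odd = minimizer_odd_part(2,3)[OF min u g_def g\<beta> p2(1) p(3) Lph L(2,1) d_def]
      have "L2sq d < \<infinity>"
        using L2h unfolding L2sq_eq_Lpp d_def by (intro Lpp_odd_part_finite) auto
      then obtain H where H: "L2sq d = ennreal H" "0 \<le> H" by (cases "L2sq d") auto
      have "H = 0"
      proof (rule ccontr)
        assume "H \<noteq> 0"
        then have H0: "0 < H" using H by simp
        define t where "t = 1 / sqrt H"
        have t: "0 < t" "t\<^sup>2 * H = 1" using H0 by (auto simp: t_def power_divide)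
        let ?d = "\<lambda>x. t * d x"
        have L2d: "L2sq ?d = 1"
          using H t by (subst L2sq_scale) (auto simp: ennreal_mult'[symmetric])
        define Z where "Z = enn2real (Lpp p d)"
        have Z: "Lpp p d = ennreal Z" "0 \<le> Z" using odd(1) by (auto simp: Z_def ennreal_enn2real)
        have Qd: "Qform g (kap s) ?d \<le> ennreal (t\<^sup>2 * ((p - 1) * L * Z powr (2 / p)))"
        proof -
          have "Qform g (kap s) ?d = ennreal (t\<^sup>2) * Qform g (kap s) d"
            by (rule kap.Qform_scale) measurable
          also have "\<dots> \<le> ennreal (t\<^sup>2) * ennreal ((p - 1) * L * Z powr (2 / p))"
            using odd(2) by (intro mult_left_mono) (auto simp: Z_def)
          finally show ?thesis by (simp only: ennreal_mult'[OF zero_le_power2])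
        qed
        then have Qdf: "Qform g (kap s) ?d < \<infinity>" by (rule le_less_trans) simp
        then obtain Q where Q: "Qform g (kap s) ?d = ennreal Q" "0 \<le> Q" by (cases "Qform g (kap s) ?d") auto
        have Q_le: "Q \<le> t\<^sup>2 * ((p - 1) * L * Z powr (2 / p))"
          using Qd Q L p2 by (simp add: ennreal_le_iff)
        have "Qform 0 (kap s) ?d < \<infinity>"
          using g L2d Qdf by (intro Qform_zero_finite[OF _ s(1,2), of _ g]) auto
        then obtain E where E: "Qform 0 (kap s) ?d = ennreal E" "0 \<le> E" by (cases "Qform 0 (kap s) ?d") auto
        have "?d (reflection a x) = - ?d x" for x by (simp add: d_def field_simps)
        then have "ennreal c * L2sq ?d \<le> Qform 0 (kap s) ?d" by (intro gain[of _ a]) auto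
        then have cE: "c \<le> E" using L2d E by simp
        \<comment> \<open>Comparing \<open>?d\<close> with the cutoff eliminates the Hardy constant,
          which contributes the same multiple of \<open>L2sq\<close> to both energies.\<close>
        have "Qform g (kap s) ?d * L2sq ?f + Qform 0 (kap s) ?f * L2sq ?d =
          Qform g (kap s) ?f * L2sq ?d + Qform 0 (kap s) ?d * L2sq ?f"
          by (rule Qform_identity[OF invariant_kernel_kap]) (use L2d T(3) in auto)
        then have id: "Q * G + e = F + E * G"
          using Q E F e G L2d by (simp add: ennreal_mult'[symmetric] flip: ennreal_plus)
        have "Lpp p ?d \<le> L2sq ?d + ennreal (C * (p - 2)) * (L2sq ?d + Qform 0 (kap s) ?d)"
          by (rule near[OF p2(1) p(4)]) (use L2d in auto)
        also have "\<dots> = ennreal (1 + C * (p - 2) * (1 + E))"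
        proof -
          have "1 + ennreal (C * (p - 2)) * (1 + ennreal E) = ennreal 1 + ennreal (C * (p - 2)) * ennreal (1 + E)"
            using E by simp
          also have "\<dots> = ennreal (1 + C * (p - 2) * (1 + E))"
            using C p2 E by (subst ennreal_plus) (auto simp: ennreal_mult')
          finally show ?thesis by (simp add: L2d E(1))
        qed
        also have "Lpp p ?d = ennreal (t powr p * Z)"
          using t Z by (subst Lpp_scale) (auto simp: ennreal_mult')
        finally have Zt: "t powr p * Z \<le> 1 + C * (p - 2) * (1 + E)"
          using C p2 E by (subst (asm) ennreal_le_iff) auto
        have one: "1 \<le> 1 + C * (p - 2) * (1 + E)" using C p2 E by simp
        \<comment> \<open>Passing from \<open>p\<close>-th powers to squared norms costs nothing:
          the exponent \<open>2 / p <= 1\<close> does not increase a number that is at least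
          1.\<close>
        have "t\<^sup>2 * Z powr (2 / p) = (t powr p * Z) powr (2 / p)"
          using t p2 by (simp add: powr_mult powr_powr)
        also have "\<dots> \<le> (1 + C * (p - 2) * (1 + E)) powr (2 / p)"
          using Zt Z p2 by (intro powr_mono2) auto
        also have "\<dots> \<le> (1 + C * (p - 2) * (1 + E)) powr 1"
          using one p2 by (intro powr_mono) auto
        finally have Zp: "t\<^sup>2 * Z powr (2 / p) \<le> 1 + C * (p - 2) * (1 + E)" using one by simp
        have LF: "L \<le> F / Y powr (2 / p)" using L(3) Y by (simp add: field_simps)
        have "Q \<le> (p - 1) * L * (t\<^sup>2 * Z powr (2 / p))" using Q_le by (simp add: mult_ac)
        also have "\<dots> \<le> (p - 1) * (F / Y powr (2 / p)) * (1 + C * (p - 2) * (1 + E))"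
          using LF Zp L(1) p2 F(2) by (intro mult_mono) auto
        finally have "Q * G \<le> (p - 1) * (F / Y powr (2 / p)) * (1 + C * (p - 2) * (1 + E)) * G"
          using G(2) by (intro mult_right_mono)
        also have "\<dots> = G * (p - 1) / Y powr (2 / p) * F * (1 + C * (p - 2) * (1 + E))" by simp
        finally have "F + E * G \<le> e + G * (p - 1) / Y powr (2 / p) * F * (1 + C * (p - 2) * (1 + E))"
          using id by linarith
        moreover have "e + G * (p - 1) / Y powr (2 / p) * F * (1 + C * (p - 2) * (1 + E)) < F + E * G"
          unfolding Y_def by (rule small(2)[OF p(1,2) F(2,3) e(3) cE])
        ultimately show False by simp
      qed
      then have "(\<integral>\<^sup>+x. ennreal ((d x)\<^sup>2) \<partial>mu) = 0" using H by (simp add: L2sq_def)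
      then have "AE x in mu. ennreal ((d x)\<^sup>2) = 0"
        by (subst (asm) nn_integral_0_iff_AE) auto
      then have "AE x in lborel. ennreal ((d x)\<^sup>2) = 0" unfolding AE_mu_iff .
      then show ?thesis by eventually_elim (simp add: d_def ennreal_eq_0_iff)
    qed
    have "Qform 0 (kap s) ?h < \<infinity>"
      using g L2h Qh by (intro Qform_zero_finite[OF _ s(1,2), of _ g]) auto
    then obtain \<phi> where \<phi>: "AE x in lborel. ?h x = \<phi> (norm x)"
      using radial_of_reflection_invariant[OF _ s(1) _ inv] by auto
    have "AE x in lborel. u x = norm x powr - g * \<phi> (norm x)"
      using \<phi> AE_lborel_singleton[of "0::real^'n"]
    proof eventually_elim
      case (elim x)
      then have "norm x powr - g * \<phi> (norm x) = (norm x powr - g * norm x powr g) * u x"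
        by (simp add: lift_def)
      then show ?case using elim by (simp add: powr_add[symmetric])
    qed
    then show "radial u"
      unfolding radial_def AE_lebesgue_iff by (intro exI[of _ "\<lambda>r. r powr - g * \<phi> r"])
  qed
  show ?thesis
  \<comment> \<open>The 1 keeps \<open>p <= 3\<close> for the two-point inequality, and
    \<open>q - 2\<close> keeps \<open>p\<close> below the exponent of the subcritical
    embedding.\<close>
  proof (intro exI[of _ "min \<epsilon> (min 1 (q - 2))"] conjI allI impI)
    show "0 < min \<epsilon> (min 1 (q - 2))" using \<epsilon> q by simp
    fix \<alpha> p \<beta> :: real and u :: "real^'n \<Rightarrow> real"
    assume A: "\<alpha>\<^sub>0 < \<alpha> \<and> \<alpha> < 0 \<and> 2 < p \<and> p < 2 + min \<epsilon> (min 1 (q - 2)) \<and>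
       p < 2 * ?N / (?N - 2 * s) \<and> \<beta> = \<alpha> + s - ?N * (1 / 2 - 1 / p)"
      and min: "CKN_minimizer s p \<alpha> \<beta> u"
    \<comment> \<open>Elements of the energy space are only Lebesgue measurable; minimality and
      radiality survive the passage to a Borel version.\<close>
    have "u \<in> borel_measurable lebesgue"
      using min by (auto simp: CKN_minimizer_def D_space_def)
    then obtain v where v: "v \<in> borel_measurable borel" and uv: "AE x in lebesgue. u x = v x"
      by (rule borel_representative)
    have "\<not> (AE x in lebesgue. v x = 0)"
    proof
      assume "AE x in lebesgue. v x = 0"
      then have "AE x in lebesgue. u x = 0" using uv by eventually_elim simp
      then show False using min by (simp add: CKN_minimizer_def)
    qed
    then have "CKN_minimizer s p \<alpha> \<beta> v"
      using min D_space_cong_AE[OF _ uv borel_measurable_lebesgueI[OF v]]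
        D_norm_sq_cong_AE[OF uv] CKN_rhs_cong_AE[OF uv]
      by (simp add: CKN_minimizer_def)
    then have "radial v"
      using A v by (intro borel_case[of \<alpha> p \<beta>]) auto
    then obtain \<phi> where "AE x in lebesgue. v x = \<phi> (norm x)" unfolding radial_def by blast
    then have "AE x in lebesgue. u x = \<phi> (norm x)" using uv by eventually_elim simp
    then show "radial u" unfolding radial_def by blast
  qed
qed

end
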